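(* Let $\mathsf K$ be a Grothendieck category and $\mathsf S\subset\mathsf K$ be a class of objects. Let $\mathsf T\subset\mathsf K$ be a class of objects of finite projective dimension in $\mathsf K$ such that the union $\mathsf S\cup\mathsf T$ contains a set of generators for $\mathsf K$. Denote by $\mathsf C\subset\mathsf K$ the closure of $\mathsf S\cup\mathsf T$ under coproducts, direct limits, extensions, and kernels of epimorphisms in $\mathsf K$. If the class $\mathsf S\cup\mathsf T$ consists of (some) finitely presentable objects and is closed under extensions and kernels of epimorphisms in $\mathsf K$, then $\mathsf C$ coincides with $\varinjlim(\mathsf S\cup\mathsf T)$, the class consisting of all direct limits of diagrams of objects from $\mathsf S\cup\mathsf T$ indexed by directed posets.
   Context: Direct limits are colimits indexed by directed posets. An object $S$ is finitely presentable if $\mathrm{Hom}_{\mathsf K}(S,-)$ preserves direct limits. The closure of a class under the listed operations is the smallest class of objects (closed under isomorphisms) that contains it and is closed under all these operations; closed under kernels of epimorphisms means that the kernel of any epimorphism $C'\to C''$ with $C',C''$ in the class lies in the class. An object $T$ has finite projective dimension in $\mathsf K$ if there is an integer $d$ such that $\mathrm{Ext}^n_{\mathsf K}(T,X)=0$ for all $X\in\mathsf K$ and $n>d$. A class of objects closed under extensions is understood to be closed under isomorphisms and to contain the zero object. *)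

theory Defs
  imports Main "HOL-Algebra.Group"
begin

unbundle cardinal_syntax

section \<open>Sets and classes\<close>

text \<open>
  The distinction between sets and classes is expressed by an uncountable strongly inaccessible
  cardinal \<open>\<kappa>\<close>: a collection is a set (is small) if it has fewer than \<open>\<kappa>\<close> elements, and
  an arbitrary collection of objects is a class. Every small set is in bijection with a subset of
  the field of \<open>\<kappa>\<close>, so index sets may be taken inside the underlying type of \<open>\<kappa>\<close>.
\<close>

definition inaccessible :: "'u rel \<Rightarrow> bool" where
  "inaccessible \<kappa> \<longleftrightarrow>
     Card_order \<kappa> \<and> natLeq <o \<kappa> \<and> regularCard \<kappa> \<and>
     (\<forall>A :: 'u set. |A| <o \<kappa> \<longrightarrow> |Pow A| <o \<kappa>)"

definition small :: "'u rel \<Rightarrow> 'a set \<Rightarrow> bool" where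
  "small \<kappa> A \<longleftrightarrow> |A| <o \<kappa>"

section \<open>Preadditive categories\<close>

text \<open>
  The objects and arrows are those in \<open>Obj\<close> and \<open>Arr\<close>; \<open>g \<cdot> f\<close> is composition with
  \<open>f\<close> applied first; \<open>Add\<close> and \<open>Zero\<close> give the group structure on each hom-set. Values
  outside the intended domains are irrelevant.
\<close>

record ('o, 'm) precat =
  Obj :: "'o set"
  Arr :: "'m set"
  Dom :: "'m \<Rightarrow> 'o"
  Cod :: "'m \<Rightarrow> 'o"
  Ide :: "'o \<Rightarrow> 'm"
  Comp :: "'m \<Rightarrow> 'm \<Rightarrow> 'm" (infixr "\<cdot>\<index>" 75)
  Add :: "'m \<Rightarrow> 'm \<Rightarrow> 'm"
  Zero :: "'o \<Rightarrow> 'o \<Rightarrow> 'm"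

definition Hom :: "('o, 'm) precat \<Rightarrow> 'o \<Rightarrow> 'o \<Rightarrow> 'm set" where
  "Hom K A B = {f \<in> Arr K. Dom K f = A \<and> Cod K f = B}"

definition Hom_group :: "('o, 'm) precat \<Rightarrow> 'o \<Rightarrow> 'o \<Rightarrow> 'm monoid" where
  "Hom_group K A B = \<lparr>carrier = Hom K A B, monoid.mult = Add K, one = Zero K A B\<rparr>"

locale category =
  fixes K :: "('o, 'm) precat" (structure)
  assumes Dom_Obj: "f \<in> Arr K \<Longrightarrow> Dom K f \<in> Obj K"
    and Cod_Obj: "f \<in> Arr K \<Longrightarrow> Cod K f \<in> Obj K"
    and Ide_Hom: "A \<in> Obj K \<Longrightarrow> Ide K A \<in> Hom K A A"
    and Comp_Hom: "\<lbrakk>f \<in> Hom K A B; g \<in> Hom K B C\<rbrakk> \<Longrightarrow> g \<cdot> f \<in> Hom K A C"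
    and Comp_Ide: "f \<in> Hom K A B \<Longrightarrow> f \<cdot> Ide K A = f"
    and Ide_Comp: "f \<in> Hom K A B \<Longrightarrow> Ide K B \<cdot> f = f"
    and Comp_assoc:
      "\<lbrakk>f \<in> Hom K A B; g \<in> Hom K B C; h \<in> Hom K C D\<rbrakk> \<Longrightarrow> (h \<cdot> g) \<cdot> f = h \<cdot> (g \<cdot> f)"

locale preadditive_category = category +
  assumes Hom_comm_group: "\<lbrakk>A \<in> Obj K; B \<in> Obj K\<rbrakk> \<Longrightarrow> comm_group (Hom_group K A B)"
    and Comp_Add_left:
      "\<lbrakk>f \<in> Hom K A B; g \<in> Hom K B C; h \<in> Hom K B C\<rbrakk>
         \<Longrightarrow> Add K g h \<cdot> f = Add K (g \<cdot> f) (h \<cdot> f)"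
    and Comp_Add_right:
      "\<lbrakk>f \<in> Hom K A B; g \<in> Hom K A B; h \<in> Hom K B C\<rbrakk>
         \<Longrightarrow> h \<cdot> Add K f g = Add K (h \<cdot> f) (h \<cdot> g)"

context
  fixes K :: "('o, 'm) precat" (structure)
begin

definition monic :: "'m \<Rightarrow> bool" where
  "monic f \<longleftrightarrow> f \<in> Arr K \<and>
     (\<forall>A. \<forall>g \<in> Hom K A (Dom K f). \<forall>h \<in> Hom K A (Dom K f). f \<cdot> g = f \<cdot> h \<longrightarrow> g = h)"

definition epic :: "'m \<Rightarrow> bool" where
  "epic f \<longleftrightarrow> f \<in> Arr K \<and>
     (\<forall>A. \<forall>g \<in> Hom K (Cod K f) A. \<forall>h \<in> Hom K (Cod K f) A. g \<cdot> f = h \<cdot> f \<longrightarrow> g = h)"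

definition isomorphic :: "'o \<Rightarrow> 'o \<Rightarrow> bool" where
  "isomorphic A B \<longleftrightarrow> A \<in> Obj K \<and> B \<in> Obj K \<and>
     (\<exists>f \<in> Hom K A B. \<exists>g \<in> Hom K B A. g \<cdot> f = Ide K A \<and> f \<cdot> g = Ide K B)"

definition is_zero_object :: "'o \<Rightarrow> bool" where
  "is_zero_object Z \<longleftrightarrow> Z \<in> Obj K \<and>
     (\<forall>A \<in> Obj K. (\<exists>!f. f \<in> Hom K Z A) \<and> (\<exists>!f. f \<in> Hom K A Z))"

definition is_kernel :: "'m \<Rightarrow> 'm \<Rightarrow> bool" where
  "is_kernel k f \<longleftrightarrow> k \<in> Arr K \<and> f \<in> Arr K \<and> Cod K k = Dom K f \<and>
     f \<cdot> k = Zero K (Dom K k) (Cod K f) \<and>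
     (\<forall>h \<in> Arr K. Cod K h = Dom K f \<and> f \<cdot> h = Zero K (Dom K h) (Cod K f) \<longrightarrow>
        (\<exists>!u. u \<in> Hom K (Dom K h) (Dom K k) \<and> k \<cdot> u = h))"

definition is_cokernel :: "'m \<Rightarrow> 'm \<Rightarrow> bool" where
  "is_cokernel c f \<longleftrightarrow> c \<in> Arr K \<and> f \<in> Arr K \<and> Dom K c = Cod K f \<and>
     c \<cdot> f = Zero K (Dom K f) (Cod K c) \<and>
     (\<forall>h \<in> Arr K. Dom K h = Cod K f \<and> h \<cdot> f = Zero K (Dom K f) (Cod K h) \<longrightarrow>
        (\<exists>!u. u \<in> Hom K (Cod K c) (Cod K h) \<and> u \<cdot> c = h))"

definition is_coproduct :: "'i set \<Rightarrow> ('i \<Rightarrow> 'o) \<Rightarrow> 'o \<Rightarrow> ('i \<Rightarrow> 'm) \<Rightarrow> bool" where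
  "is_coproduct I D P \<iota> \<longleftrightarrow> P \<in> Obj K \<and> (\<forall>i \<in> I. \<iota> i \<in> Hom K (D i) P) \<and>
     (\<forall>M \<mu>. M \<in> Obj K \<and> (\<forall>i \<in> I. \<mu> i \<in> Hom K (D i) M) \<longrightarrow>
        (\<exists>!u. u \<in> Hom K P M \<and> (\<forall>i \<in> I. u \<cdot> \<iota> i = \<mu> i)))"

text \<open>Exactness of \<open>f\<close> followed by \<open>g\<close>: the image of \<open>f\<close> is the kernel of \<open>g\<close>.\<close>

definition exact_pair :: "'m \<Rightarrow> 'm \<Rightarrow> bool" where
  "exact_pair f g \<longleftrightarrow>
     (\<exists>k p. is_kernel k g \<and> epic p \<and> Cod K p = Dom K k \<and> f = k \<cdot> p)"

definition short_exact :: "'m \<Rightarrow> 'm \<Rightarrow> bool" where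
  "short_exact f g \<longleftrightarrow> is_kernel f g \<and> is_cokernel g f"

end

locale abelian_category = preadditive_category +
  assumes zero_object: "\<exists>Z. is_zero_object K Z"
    and binary_coproducts:
      "\<lbrakk>A \<in> Obj K; B \<in> Obj K\<rbrakk>
         \<Longrightarrow> \<exists>P \<iota>. is_coproduct K UNIV (\<lambda>b :: bool. if b then A else B) P \<iota>"
    and kernels: "f \<in> Arr K \<Longrightarrow> \<exists>k. is_kernel K k f"
    and cokernels: "f \<in> Arr K \<Longrightarrow> \<exists>c. is_cokernel K c f"
    and monic_normal: "monic K f \<Longrightarrow> \<exists>g. is_kernel K f g"
    and epic_normal: "epic K f \<Longrightarrow> \<exists>g. is_cokernel K f g"

section \<open>Direct limits\<close>

definition directed_poset :: "'i set \<Rightarrow> 'i rel \<Rightarrow> bool" where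
  "directed_poset I r \<longleftrightarrow> partial_order_on I r \<and> I \<noteq> {} \<and>
     (\<forall>i \<in> I. \<forall>j \<in> I. \<exists>k \<in> I. (i, k) \<in> r \<and> (j, k) \<in> r)"

context
  fixes K :: "('o, 'm) precat" (structure)
begin

definition direct_system ::
    "'i set \<Rightarrow> 'i rel \<Rightarrow> ('i \<Rightarrow> 'o) \<Rightarrow> ('i \<Rightarrow> 'i \<Rightarrow> 'm) \<Rightarrow> bool" where
  "direct_system I r D d \<longleftrightarrow> directed_poset I r \<and> (\<forall>i \<in> I. D i \<in> Obj K) \<and>
     (\<forall>(i, j) \<in> r. d i j \<in> Hom K (D i) (D j)) \<and>
     (\<forall>i \<in> I. d i i = Ide K (D i)) \<and>
     (\<forall>i j k. (i, j) \<in> r \<and> (j, k) \<in> r \<longrightarrow> d j k \<cdot> d i j = d i k)"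

definition system_morphism ::
    "'i set \<Rightarrow> 'i rel \<Rightarrow> ('i \<Rightarrow> 'o) \<Rightarrow> ('i \<Rightarrow> 'i \<Rightarrow> 'm) \<Rightarrow> ('i \<Rightarrow> 'o) \<Rightarrow> ('i \<Rightarrow> 'i \<Rightarrow> 'm)
      \<Rightarrow> ('i \<Rightarrow> 'm) \<Rightarrow> bool" where
  "system_morphism I r D d E e f \<longleftrightarrow> (\<forall>i \<in> I. f i \<in> Hom K (D i) (E i)) \<and>
     (\<forall>(i, j) \<in> r. f j \<cdot> d i j = e i j \<cdot> f i)"

definition cocone ::
    "'i set \<Rightarrow> 'i rel \<Rightarrow> ('i \<Rightarrow> 'o) \<Rightarrow> ('i \<Rightarrow> 'i \<Rightarrow> 'm) \<Rightarrow> 'o \<Rightarrow> ('i \<Rightarrow> 'm) \<Rightarrow> bool" where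
  "cocone I r D d L \<iota> \<longleftrightarrow> L \<in> Obj K \<and> (\<forall>i \<in> I. \<iota> i \<in> Hom K (D i) L) \<and>
     (\<forall>(i, j) \<in> r. \<iota> j \<cdot> d i j = \<iota> i)"

definition is_direct_limit ::
    "'i set \<Rightarrow> 'i rel \<Rightarrow> ('i \<Rightarrow> 'o) \<Rightarrow> ('i \<Rightarrow> 'i \<Rightarrow> 'm) \<Rightarrow> 'o \<Rightarrow> ('i \<Rightarrow> 'm) \<Rightarrow> bool" where
  "is_direct_limit I r D d L \<iota> \<longleftrightarrow>
     direct_system I r D d \<and> cocone I r D d L \<iota> \<and>
     (\<forall>M \<mu>. cocone I r D d M \<mu> \<longrightarrow>
        (\<exists>!u. u \<in> Hom K L M \<and> (\<forall>i \<in> I. u \<cdot> \<iota> i = \<mu> i)))"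

text \<open>
  The direct limit of the sets \<open>Hom(S, D i)\<close>, as the quotient of their disjoint union, and its
  canonical map to \<open>Hom(S, L)\<close> induced by a cocone \<open>\<iota>\<close>; the latter is constant on each
  equivalence class, so the image of a class has exactly one element.
\<close>

definition Hom_limit ::
    "'o \<Rightarrow> 'i set \<Rightarrow> 'i rel \<Rightarrow> ('i \<Rightarrow> 'o) \<Rightarrow> ('i \<Rightarrow> 'i \<Rightarrow> 'm) \<Rightarrow> ('i \<times> 'm) set set" where
  "Hom_limit S I r D d =
     (SIGMA i:I. Hom K S (D i)) //
       {((i, f), (j, g)). f \<in> Hom K S (D i) \<and> g \<in> Hom K S (D j) \<and>
          (\<exists>k. (i, k) \<in> r \<and> (j, k) \<in> r \<and> d i k \<cdot> f = d j k \<cdot> g)}"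

definition Hom_limit_map :: "('i \<Rightarrow> 'm) \<Rightarrow> ('i \<times> 'm) set \<Rightarrow> 'm" where
  "Hom_limit_map \<iota> c = the_elem ((\<lambda>(i, f). \<iota> i \<cdot> f) ` c)"

definition finitely_presentable :: "'u rel \<Rightarrow> 'o \<Rightarrow> bool" where
  "finitely_presentable \<kappa> S \<longleftrightarrow> S \<in> Obj K \<and>
     (\<forall>(I :: 'u set) r D d L \<iota>. small \<kappa> I \<and> is_direct_limit I r D d L \<iota> \<longrightarrow>
        bij_betw (Hom_limit_map \<iota>) (Hom_limit S I r D d) (Hom K S L))"

definition direct_limits_of :: "'u rel \<Rightarrow> 'o set \<Rightarrow> 'o set" where
  "direct_limits_of \<kappa> X =
     {L. \<exists>(I :: 'u set) r D d \<iota>. small \<kappa> I \<and> (\<forall>i \<in> I. D i \<in> X) \<and> is_direct_limit I r D d L \<iota>}"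

section \<open>Grothendieck categories\<close>

definition generating :: "'o set \<Rightarrow> bool" where
  "generating G \<longleftrightarrow> G \<subseteq> Obj K \<and>
     (\<forall>A B. \<forall>f \<in> Hom K A B. \<forall>g \<in> Hom K A B. f \<noteq> g \<longrightarrow>
        (\<exists>X \<in> G. \<exists>h \<in> Hom K X A. f \<cdot> h \<noteq> g \<cdot> h))"

definition exact_direct_limits :: "'u rel \<Rightarrow> bool" where
  "exact_direct_limits \<kappa> \<longleftrightarrow>
     (\<forall>(I :: 'u set) r A a B b C c f g LA \<alpha> LB \<beta> LC \<gamma> u v.
        small \<kappa> I \<and>
        is_direct_limit I r A a LA \<alpha> \<and> is_direct_limit I r B b LB \<beta> \<and>
        is_direct_limit I r C c LC \<gamma> \<and>
        system_morphism I r A a B b f \<and> system_morphism I r B b C c g \<and>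
        (\<forall>i \<in> I. short_exact K (f i) (g i)) \<and>
        u \<in> Hom K LA LB \<and> (\<forall>i \<in> I. u \<cdot> \<alpha> i = \<beta> i \<cdot> f i) \<and>
        v \<in> Hom K LB LC \<and> (\<forall>i \<in> I. v \<cdot> \<beta> i = \<gamma> i \<cdot> g i) \<longrightarrow>
        short_exact K u v)"

end

text \<open>
  Existence of all small colimits, in particular of direct limits, follows from that of coproducts
  and cokernels.
\<close>

locale grothendieck_category = abelian_category K
  for \<kappa> :: "'u rel" and K :: "('o, 'm) precat" (structure) +
  assumes small_Hom: "small \<kappa> (Hom K A B)"
    and coproducts:
      "\<lbrakk>small \<kappa> (I :: 'u set); \<forall>i \<in> I. D i \<in> Obj K\<rbrakk> \<Longrightarrow> \<exists>P \<iota>. is_coproduct K I D P \<iota>"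
    and exact_limits: "exact_direct_limits K \<kappa>"
    and generators: "\<exists>G. small \<kappa> G \<and> generating K G"

section \<open>Yoneda Ext and projective dimension\<close>

context
  fixes K :: "('o, 'm) precat" (structure)
begin

text \<open>
  An \<open>n\<close>-extension \<open>0 \<rightarrow> X \<rightarrow> E\<^sub>1 \<rightarrow> \<dots> \<rightarrow> E\<^sub>n \<rightarrow> T \<rightarrow> 0\<close> is given by its arrows
  \<open>e 0, \<dots>, e n\<close>. For \<open>n \<ge> 1\<close>, \<open>Ext\<^sup>n(T, X)\<close> is the set of \<open>n\<close>-extensions modulo
  the equivalence relation generated by morphisms that are the identity on \<open>X\<close> and \<open>T\<close>.
\<close>

definition yoneda_extension :: "nat \<Rightarrow> 'o \<Rightarrow> 'o \<Rightarrow> (nat \<Rightarrow> 'm) \<Rightarrow> bool" where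
  "yoneda_extension n T X e \<longleftrightarrow>
     Dom K (e 0) = X \<and> Cod K (e n) = T \<and> monic K (e 0) \<and> epic K (e n) \<and>
     (\<forall>i < n. exact_pair K (e i) (e (Suc i)))"

definition yoneda_step :: "nat \<Rightarrow> 'o \<Rightarrow> 'o \<Rightarrow> (nat \<Rightarrow> 'm) \<Rightarrow> (nat \<Rightarrow> 'm) \<Rightarrow> bool" where
  "yoneda_step n T X e e' \<longleftrightarrow> yoneda_extension n T X e \<and> yoneda_extension n T X e' \<and>
     (\<exists>f. f 0 = Ide K X \<and> f (Suc n) = Ide K T \<and>
        (\<forall>i \<le> n. f i \<in> Hom K (Dom K (e i)) (Dom K (e' i)) \<and>
           f (Suc i) \<in> Hom K (Cod K (e i)) (Cod K (e' i)) \<and> f (Suc i) \<cdot> e i = e' i \<cdot> f i))"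

definition Yoneda_Ext :: "nat \<Rightarrow> 'o \<Rightarrow> 'o \<Rightarrow> (nat \<Rightarrow> 'm) set set" where
  "Yoneda_Ext n T X =
     {e. yoneda_extension n T X e} // {(e, e'). equivclp (yoneda_step n T X) e e'}"

text \<open>
  \<open>Ext\<^sup>0 = Hom\<close>. An abelian group is zero if and only if it has exactly one element, so the Baer
  sum is not needed.
\<close>

definition Ext_zero :: "nat \<Rightarrow> 'o \<Rightarrow> 'o \<Rightarrow> bool" where
  "Ext_zero n T X \<longleftrightarrow>
     (if n = 0 then is_singleton (Hom K T X) else is_singleton (Yoneda_Ext n T X))"

definition finite_projective_dimension :: "'o \<Rightarrow> bool" where
  "finite_projective_dimension T \<longleftrightarrow>
     (\<exists>d :: int. \<forall>X \<in> Obj K. \<forall>n :: nat. int n > d \<longrightarrow> Ext_zero n T X)"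

section \<open>Closure properties of classes of objects\<close>

definition iso_closed :: "'o set \<Rightarrow> bool" where
  "iso_closed X \<longleftrightarrow> (\<forall>A B. A \<in> X \<and> isomorphic K A B \<longrightarrow> B \<in> X)"

definition closed_coproducts :: "'u rel \<Rightarrow> 'o set \<Rightarrow> bool" where
  "closed_coproducts \<kappa> X \<longleftrightarrow>
     (\<forall>(I :: 'u set) D P \<iota>. small \<kappa> I \<and> (\<forall>i \<in> I. D i \<in> X) \<and> is_coproduct K I D P \<iota> \<longrightarrow> P \<in> X)"

definition closed_direct_limits :: "'u rel \<Rightarrow> 'o set \<Rightarrow> bool" where
  "closed_direct_limits \<kappa> X \<longleftrightarrow> direct_limits_of K \<kappa> X \<subseteq> X"

definition closed_extensions :: "'o set \<Rightarrow> bool" where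
  "closed_extensions X \<longleftrightarrow> iso_closed X \<and> (\<forall>Z. is_zero_object K Z \<longrightarrow> Z \<in> X) \<and>
     (\<forall>f g. short_exact K f g \<and> Dom K f \<in> X \<and> Cod K g \<in> X \<longrightarrow> Cod K f \<in> X)"

definition closed_kernels_of_epis :: "'o set \<Rightarrow> bool" where
  "closed_kernels_of_epis X \<longleftrightarrow>
     (\<forall>g k. epic K g \<and> Dom K g \<in> X \<and> Cod K g \<in> X \<and> is_kernel K k g \<longrightarrow> Dom K k \<in> X)"

definition closure_class :: "'u rel \<Rightarrow> 'o set \<Rightarrow> 'o set" where
  "closure_class \<kappa> Y =
     \<Inter> {X. Y \<subseteq> X \<and> X \<subseteq> Obj K \<and> iso_closed X \<and> closed_coproducts \<kappa> X \<and>
          closed_direct_limits \<kappa> X \<and> closed_extensions X \<and> closed_kernels_of_epis X}"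

end

end

theory Submission
  imports Defs
begin

text \<open>
  Write \<open>X\<close> for \<open>S \<union> T\<close>. The theorem rests on an intrinsic description of the direct limits of
  objects of \<open>X\<close>: an object \<open>L\<close> is such a limit if and only if it is \<^emph>\<open>factoring\<close>, that is, whenever
  \<open>p : S\<^sub>0 \<rightarrow> S\<^sub>1\<close> is an arrow between objects of \<open>X\<close> and \<open>f : S\<^sub>1 \<rightarrow> L\<close> satisfies \<open>f p = 0\<close>, then \<open>f\<close>
  factors through an object of \<open>X\<close> by an arrow that already kills \<open>p\<close>. This is a form of the usual
  criterion that every arrow from a finitely presentable object (here the cokernel of \<open>p\<close>) to \<open>L\<close>
  factors through \<open>X\<close>, but it speaks of objects of \<open>X\<close> only.

  Direct limits of factoring objects are factoring by finite presentability
  (\<open>factoring_direct_limit\<close>). The converse (\<open>direct_limit_of_canonical_system\<close>) says that \<open>L\<close> is the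
  colimit of the category of all arrows from \<open>X\<close> to \<open>L\<close>. The factoring property makes this category
  filtered, and also makes the comparison map from its colimit to \<open>L\<close> monic; it is epic
  because \<open>X\<close> contains generators. There are two technical points: \<open>X\<close> is replaced by a small
  skeleton (\<open>small_skeleton\<close>), and the filtered category is replaced by a directed poset, whose
  elements are finite families of arrows to \<open>L\<close> together with a compatible family of maps from them
  to one of their members.

  It remains to see that factoring objects are closed under all the operations. Two facts do the
  work. First, a finitely presentable object only sees a finite part of a jointly
  epic family (\<open>finitely_presentable_finite_subfamily\<close>); this reduces coproducts to finite ones.
  Secondly, given an epimorphism \<open>B \<rightarrow> C\<close> and an arrow \<open>S \<rightarrow> C\<close> with \<open>S\<close> in \<open>X\<close>, there are an object \<open>Q\<close>
  of \<open>X\<close> and an epimorphism \<open>Q \<rightarrow> S\<close> such that \<open>Q \<rightarrow> S \<rightarrow> C\<close> lifts to \<open>B\<close> (\<open>lift_over_epic\<close>). The kernel of \<open>Q \<rightarrow> S\<close> is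
  in \<open>X\<close>, as \<open>X\<close> is closed under kernels of epimorphisms. For the kernel of an epimorphism
  this kernel is the required object of \<open>X\<close>; for an extension it is the pushout of \<open>Q\<close> along a
  map from this kernel, which is again an extension of objects of \<open>X\<close>.
\<close>

section \<open>Small sets\<close>

lemma small_subset: "small \<kappa> B \<Longrightarrow> A \<subseteq> B \<Longrightarrow> small \<kappa> A"
  unfolding small_def using card_of_mono1 ordLeq_ordLess_trans by blast

lemma small_image: "small \<kappa> A \<Longrightarrow> small \<kappa> (f ` A)"
  unfolding small_def using card_of_image ordLeq_ordLess_trans by blast

lemma small_inj_on: "small \<kappa> B \<Longrightarrow> inj_on f A \<Longrightarrow> f ` A \<subseteq> B \<Longrightarrow> small \<kappa> A"
proof -
  assume "small \<kappa> B" "inj_on f A" "f ` A \<subseteq> B"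
  then have "small \<kappa> (inv_into A f ` f ` A)"
    by - (rule small_image, erule small_subset)
  then show "small \<kappa> A"
    using \<open>inj_on f A\<close> by (simp only: inv_into_image_cancel order_refl)
qed

lemma inaccessible_Cinfinite:
  assumes "inaccessible \<kappa>"
  shows "Cinfinite \<kappa>"
  using assms cinfinite_mono[OF ordLess_imp_ordLeq natLeq_cinfinite] unfolding inaccessible_def by blast

text \<open>
  Index sets of any type can be moved into the type of \<open>\<kappa>\<close>, over which the definitions of coproducts,
  direct limits and finite presentability quantify.
\<close>

lemma small_embedding:
  assumes "inaccessible (\<kappa> :: 'u rel)" "small \<kappa> A"
  obtains \<phi> :: "'a \<Rightarrow> 'u" where "inj_on \<phi> A"
proof -
  have "|A| <o \<kappa>" "\<kappa> =o |Field \<kappa>|"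
    using assms ordIso_symmetric[OF card_of_Field_ordIso] unfolding inaccessible_def small_def by auto
  then have "|A| \<le>o |Field \<kappa>|"
    using ordLess_imp_ordLeq[OF ordLess_ordIso_trans] by blast
  then show ?thesis
    using that card_of_ordLeq[of A "Field \<kappa>"] by blast
qed

lemma small_nat:
  assumes "inaccessible \<kappa>"
  shows "small \<kappa> (UNIV :: nat set)"
  using assms card_of_nat ordIso_ordLess_trans unfolding small_def inaccessible_def by blast

lemma small_Sigma:
  assumes \<kappa>: "inaccessible \<kappa>" and A: "small \<kappa> A" and B: "\<And>a. a \<in> A \<Longrightarrow> small \<kappa> (B a)"
  shows "small \<kappa> (SIGMA a:A. B a)"
proof -
  have "stable \<kappa>"
    using \<kappa> inaccessible_Cinfinite[OF \<kappa>] regularCard_stable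
    unfolding inaccessible_def cinfinite_def by blast
  then show ?thesis
    using A B stable_elim[of \<kappa> A B] unfolding small_def by blast
qed

lemma small_UN:
  assumes "inaccessible \<kappa>" "small \<kappa> A" "\<And>a. a \<in> A \<Longrightarrow> small \<kappa> (B a)"
  shows "small \<kappa> (\<Union>a\<in>A. B a)"
proof -
  have "(\<Union>a\<in>A. B a) = snd ` (SIGMA a:A. B a)"
    by force
  then show ?thesis
    by (simp only:) (intro small_image small_Sigma assms)
qed

lemma small_Pow:
  assumes "inaccessible (\<kappa> :: 'u rel)" "small \<kappa> A"
  shows "small \<kappa> (Pow A)"
proof -
  obtain \<phi> :: "_ \<Rightarrow> 'u" where \<phi>: "inj_on \<phi> A"
    using small_embedding[OF assms] by blast
  have "small \<kappa> (Pow (\<phi> ` A))"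
    using assms(1) small_image[OF assms(2)] unfolding small_def inaccessible_def by blast
  then show ?thesis
    by (rule small_inj_on[where f = "image \<phi>"]) (use \<phi> in \<open>auto intro: inj_on_image_Pow\<close>)
qed

section \<open>Preadditive categories\<close>

lemma Hom_iff: "f \<in> Hom K A B \<longleftrightarrow> f \<in> Arr K \<and> Dom K f = A \<and> Cod K f = B"
  unfolding Hom_def by blast

context category
begin

lemma comp_simps [simp]:
  assumes "f \<in> Arr K" "g \<in> Arr K" "Cod K f = Dom K g"
  shows "g \<cdot> f \<in> Arr K" "Dom K (g \<cdot> f) = Dom K f" "Cod K (g \<cdot> f) = Cod K g"
  using Comp_Hom[of f "Dom K f" "Dom K g" g "Cod K g"] assms by (auto simp: Hom_iff)

lemma ide_simps [simp]:
  assumes "A \<in> Obj K"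
  shows "Ide K A \<in> Arr K" "Dom K (Ide K A) = A" "Cod K (Ide K A) = A"
  using Ide_Hom[OF assms] by (auto simp: Hom_iff)

lemma comp_ide [simp]: "f \<in> Arr K \<Longrightarrow> Dom K f = A \<Longrightarrow> f \<cdot> Ide K A = f"
  using Comp_Ide by (auto simp: Hom_iff)

lemma ide_comp [simp]: "f \<in> Arr K \<Longrightarrow> Cod K f = A \<Longrightarrow> Ide K A \<cdot> f = f"
  using Ide_Comp by (auto simp: Hom_iff)

lemma comp_assoc [simp]:
  assumes "f \<in> Arr K" "g \<in> Arr K" "h \<in> Arr K" "Cod K f = Dom K g" "Cod K g = Dom K h"
  shows "(h \<cdot> g) \<cdot> f = h \<cdot> (g \<cdot> f)"
  using Comp_assoc[of f "Dom K f" "Dom K g" g "Dom K h" h "Cod K h"] assms by (auto simp: Hom_iff)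

text \<open>
  Compositions are kept bracketed to the right, so an equation for \<open>g \<cdot> f\<close> has to be applied to the first
  two factors of a longer composite.
\<close>

lemma comp_rewrite:
  assumes "g \<cdot> f = h" "f \<in> Arr K" "g \<in> Arr K" "Cod K f = Dom K g" "x \<in> Arr K" "Cod K x = Dom K f"
  shows "g \<cdot> (f \<cdot> x) = h \<cdot> x"
  using assms by (metis comp_assoc)

lemma isomorphicE:
  assumes "isomorphic K A B"
  obtains f g where "f \<in> Hom K A B" "g \<in> Hom K B A" "g \<cdot> f = Ide K A" "f \<cdot> g = Ide K B"
    "A \<in> Obj K" "B \<in> Obj K"
  using assms unfolding isomorphic_def by blast

lemma monicD: "monic K f \<Longrightarrow> g \<in> Hom K A (Dom K f) \<Longrightarrow> h \<in> Hom K A (Dom K f)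
    \<Longrightarrow> f \<cdot> g = f \<cdot> h \<Longrightarrow> g = h"
  unfolding monic_def by blast

lemma epicD: "epic K f \<Longrightarrow> g \<in> Hom K (Cod K f) A \<Longrightarrow> h \<in> Hom K (Cod K f) A
    \<Longrightarrow> g \<cdot> f = h \<cdot> f \<Longrightarrow> g = h"
  unfolding epic_def by blast

end

context preadditive_category
begin

abbreviation parallel :: "'b \<Rightarrow> 'b \<Rightarrow> bool" where
  "parallel f g \<equiv> f \<in> Arr K \<and> g \<in> Arr K \<and> Dom K f = Dom K g \<and> Cod K f = Cod K g"

text \<open>
  Differences turn equations between parallel arrows into the vanishing of one arrow, to which kernels and
  cokernels apply.
\<close>

definition Sub :: "'b \<Rightarrow> 'b \<Rightarrow> 'b" where
  "Sub f g = Add K f (inv\<^bsub>Hom_group K (Dom K g) (Cod K g)\<^esub> g)"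

lemma hom_group: "A \<in> Obj K \<Longrightarrow> B \<in> Obj K \<Longrightarrow> group (Hom_group K A B)"
  using Hom_comm_group comm_group_def by blast

lemma zero_simps [simp]:
  assumes "A \<in> Obj K" "B \<in> Obj K"
  shows "Zero K A B \<in> Arr K" "Dom K (Zero K A B) = A" "Cod K (Zero K A B) = B"
  using group.is_monoid[OF hom_group[OF assms], THEN monoid.one_closed]
  by (auto simp: Hom_group_def Hom_iff)

lemma hom_idempotent_zero:
  assumes "f \<in> Hom K A B" "Add K f f = f"
  shows "f = Zero K A B"
proof -
  have "A \<in> Obj K" "B \<in> Obj K"
    using assms(1) Dom_Obj Cod_Obj by (auto simp: Hom_iff)
  then interpret group "Hom_group K A B"
    by (rule hom_group)
  show ?thesis
    using r_cancel_one'[of f f] assms by (auto simp: Hom_group_def)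
qed

lemma zero_add_zero: "A \<in> Obj K \<Longrightarrow> B \<in> Obj K \<Longrightarrow> Add K (Zero K A B) (Zero K A B) = Zero K A B"
  using group.is_monoid[OF hom_group[of A B], THEN monoid.l_one, of "Zero K A B"]
  by (auto simp: Hom_group_def Hom_iff)

lemma comp_zero [simp]:
  assumes "f \<in> Arr K" "A \<in> Obj K" "Dom K f = B"
  shows "f \<cdot> Zero K A B = Zero K A (Cod K f)"
proof (rule hom_idempotent_zero)
  have B: "B \<in> Obj K" using assms Dom_Obj by blast
  then show "f \<cdot> Zero K A B \<in> Hom K A (Cod K f)"
    using assms by (simp add: Hom_iff)
  show "Add K (f \<cdot> Zero K A B) (f \<cdot> Zero K A B) = f \<cdot> Zero K A B"
    using Comp_Add_right[of "Zero K A B" A B "Zero K A B" f "Cod K f"] zero_add_zero[of A B] assms B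
    by (simp add: Hom_iff)
qed

lemma zero_comp [simp]:
  assumes "f \<in> Arr K" "B \<in> Obj K" "Cod K f = A"
  shows "Zero K A B \<cdot> f = Zero K (Dom K f) B"
proof (rule hom_idempotent_zero)
  have A: "A \<in> Obj K" using assms Cod_Obj by blast
  then show "Zero K A B \<cdot> f \<in> Hom K (Dom K f) B"
    using assms by (simp add: Hom_iff)
  show "Add K (Zero K A B \<cdot> f) (Zero K A B \<cdot> f) = Zero K A B \<cdot> f"
    using Comp_Add_left[of f "Dom K f" A "Zero K A B" B "Zero K A B"] zero_add_zero[of A B] assms A
    by (simp add: Hom_iff)
qed

lemma sub_simps [simp]:
  assumes "parallel f g"
  shows "Sub f g \<in> Arr K" "Dom K (Sub f g) = Dom K g" "Cod K (Sub f g) = Cod K g"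
proof -
  interpret group "Hom_group K (Dom K g) (Cod K g)"
    using assms hom_group Dom_Obj Cod_Obj by simp
  have "Sub f g \<in> Hom K (Dom K g) (Cod K g)"
    unfolding Sub_def using m_closed[of f "inv\<^bsub>Hom_group K (Dom K g) (Cod K g)\<^esub> g"] inv_closed[of g] assms
    by (auto simp: Hom_group_def Hom_iff)
  then show "Sub f g \<in> Arr K" "Dom K (Sub f g) = Dom K g" "Cod K (Sub f g) = Cod K g"
    by (auto simp: Hom_iff)
qed

text \<open>The cancellation law \<open>(f - g) + g = f\<close> determines the difference.\<close>

lemma sub_eqI:
  assumes "parallel f g" "parallel f h" "Add K h g = f"
  shows "Sub f g = h"
proof -
  interpret group "Hom_group K (Dom K g) (Cod K g)"
    using assms hom_group Dom_Obj Cod_Obj by simp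
  show ?thesis
    unfolding Sub_def using m_assoc[of h g "inv\<^bsub>Hom_group K (Dom K g) (Cod K g)\<^esub> g"] r_inv[of g] r_one[of h] inv_closed[of g] assms
    by (auto simp: Hom_group_def Hom_iff)
qed

lemma sub_add:
  assumes "parallel f g"
  shows "Add K (Sub f g) g = f"
proof -
  interpret group "Hom_group K (Dom K g) (Cod K g)"
    using assms hom_group Dom_Obj Cod_Obj by simp
  show ?thesis
    unfolding Sub_def using m_assoc[of f "inv\<^bsub>Hom_group K (Dom K g) (Cod K g)\<^esub> g" g] l_inv[of g] r_one[of f] inv_closed[of g] assms
    by (auto simp: Hom_group_def Hom_iff)
qed

lemma sub_zero_right [simp]:
  assumes "f \<in> Arr K" "Dom K f = A" "Cod K f = B"
  shows "Sub f (Zero K A B) = f"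
proof -
  have AB: "A \<in> Obj K" "B \<in> Obj K"
    using assms Dom_Obj Cod_Obj by auto
  interpret group "Hom_group K A B"
    using AB by (rule hom_group)
  show ?thesis
    by (rule sub_eqI) (use r_one[of f] assms AB in \<open>auto simp: Hom_group_def Hom_iff\<close>)
qed

lemma sub_eq_zero:
  assumes "parallel f g"
  shows "Sub f g = Zero K (Dom K g) (Cod K g) \<longleftrightarrow> f = g"
proof -
  have AB: "Dom K g \<in> Obj K" "Cod K g \<in> Obj K"
    using assms Dom_Obj Cod_Obj by auto
  interpret group "Hom_group K (Dom K g) (Cod K g)"
    using AB by (rule hom_group)
  have *: "Add K (Zero K (Dom K g) (Cod K g)) g = g"
    using l_one[of g] assms by (auto simp: Hom_group_def Hom_iff)
  show ?thesis
  proof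
    assume "Sub f g = Zero K (Dom K g) (Cod K g)"
    then show "f = g"
      using sub_add[OF assms] * by simp
  next
    assume "f = g"
    then show "Sub f g = Zero K (Dom K g) (Cod K g)"
      by (intro sub_eqI) (use * assms AB in auto)
  qed
qed

lemma comp_sub:
  assumes "parallel f g" "h \<in> Arr K" "Dom K h = Cod K g"
  shows "h \<cdot> Sub f g = Sub (h \<cdot> f) (h \<cdot> g)"
proof (rule sub_eqI[symmetric])
  show "Add K (h \<cdot> Sub f g) (h \<cdot> g) = h \<cdot> f"
    using Comp_Add_right[of "Sub f g" "Dom K g" "Cod K g" g h "Cod K h"] sub_add[of f g] assms
    by (simp add: Hom_iff)
qed (use assms in auto)

lemma sub_comp:
  assumes "parallel f g" "h \<in> Arr K" "Cod K h = Dom K g"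
  shows "Sub f g \<cdot> h = Sub (f \<cdot> h) (g \<cdot> h)"
proof (rule sub_eqI[symmetric])
  show "Add K (Sub f g \<cdot> h) (g \<cdot> h) = f \<cdot> h"
    using Comp_Add_left[of h "Dom K h" "Dom K g" "Sub f g" "Cod K g" g] sub_add[of f g] assms
    by (simp add: Hom_iff)
qed (use assms in auto)

lemma monicI:
  assumes f: "f \<in> Arr K"
    and zero: "\<And>x. x \<in> Arr K \<Longrightarrow> Cod K x = Dom K f \<Longrightarrow> f \<cdot> x = Zero K (Dom K x) (Cod K f)
      \<Longrightarrow> x = Zero K (Dom K x) (Dom K f)"
  shows "monic K f"
  unfolding monic_def
proof (intro conjI allI ballI impI)
  fix A g h
  assume gh: "g \<in> Hom K A (Dom K f)" "h \<in> Hom K A (Dom K f)" and eq: "f \<cdot> g = f \<cdot> h"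
  have p: "parallel g h" "Cod K h = Dom K f"
    using gh by (auto simp: Hom_iff)
  have "f \<cdot> Sub g h = Zero K (Dom K h) (Cod K f)"
    using sub_eq_zero[of "f \<cdot> h" "f \<cdot> h"] p f eq by (simp add: comp_sub)
  then have "Sub g h = Zero K (Dom K (Sub g h)) (Dom K f)"
    by (intro zero) (use p in auto)
  then show "g = h"
    using p sub_eq_zero[of g h] by simp
qed (rule f)

lemma epicI:
  assumes f: "f \<in> Arr K"
    and zero: "\<And>t. t \<in> Arr K \<Longrightarrow> Dom K t = Cod K f \<Longrightarrow> t \<cdot> f = Zero K (Dom K f) (Cod K t)
      \<Longrightarrow> t = Zero K (Cod K f) (Cod K t)"
  shows "epic K f"
  unfolding epic_def
proof (intro conjI allI ballI impI)
  fix A g h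
  assume gh: "g \<in> Hom K (Cod K f) A" "h \<in> Hom K (Cod K f) A" and eq: "g \<cdot> f = h \<cdot> f"
  have p: "parallel g h" "Dom K h = Cod K f"
    using gh by (auto simp: Hom_iff)
  have "Sub g h \<cdot> f = Zero K (Dom K f) (Cod K h)"
    using sub_eq_zero[of "h \<cdot> f" "h \<cdot> f"] p f eq by (simp add: sub_comp)
  then have "Sub g h = Zero K (Cod K f) (Cod K (Sub g h))"
    by (intro zero) (use p in auto)
  then show "g = h"
    using p sub_eq_zero[of g h] by simp
qed (rule f)

lemma monic_zeroD:
  assumes "monic K f" "x \<in> Arr K" "Cod K x = Dom K f" "f \<cdot> x = Zero K (Dom K x) (Cod K f)"
  shows "x = Zero K (Dom K x) (Dom K f)"
proof -
  have f: "f \<in> Arr K" using assms(1) unfolding monic_def by blast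
  then have "Dom K x \<in> Obj K" "Dom K f \<in> Obj K"
    using assms Dom_Obj by auto
  then show ?thesis
    by (intro monicD[of f x "Dom K x" "Zero K (Dom K x) (Dom K f)"]) (use assms f in \<open>auto simp: Hom_iff\<close>)
qed

lemma epic_zeroD:
  assumes "epic K f" "t \<in> Arr K" "Dom K t = Cod K f" "t \<cdot> f = Zero K (Dom K f) (Cod K t)"
  shows "t = Zero K (Cod K f) (Cod K t)"
proof -
  have f: "f \<in> Arr K" using assms(1) unfolding epic_def by blast
  then have "Cod K t \<in> Obj K" "Cod K f \<in> Obj K"
    using assms Cod_Obj by auto
  then show ?thesis
    by (intro epicD[of f t "Cod K t" "Zero K (Cod K f) (Cod K t)"]) (use assms f in \<open>auto simp: Hom_iff\<close>)
qed

lemma kernel_monic: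
  assumes "is_kernel K k f"
  shows "monic K k"
proof (rule monicI)
  show k: "k \<in> Arr K"
    using assms unfolding is_kernel_def by blast
  fix x
  assume x: "x \<in> Arr K" "Cod K x = Dom K k" "k \<cdot> x = Zero K (Dom K x) (Cod K k)"
  have ob: "Dom K x \<in> Obj K" "Dom K k \<in> Obj K"
    using x k Dom_Obj by auto
  let ?z = "Zero K (Dom K x) (Cod K k)"
  have f: "f \<in> Arr K" "Cod K k = Dom K f" "Dom K f \<in> Obj K"
    and ker: "\<And>h. h \<in> Arr K \<Longrightarrow> Cod K h = Dom K f \<Longrightarrow> f \<cdot> h = Zero K (Dom K h) (Cod K f) \<Longrightarrow>
        \<exists>!u. u \<in> Hom K (Dom K h) (Dom K k) \<and> k \<cdot> u = h"
    using assms Dom_Obj unfolding is_kernel_def by blast+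
  have "\<exists>!u. u \<in> Hom K (Dom K ?z) (Dom K k) \<and> k \<cdot> u = ?z"
    by (rule ker) (use f ob in auto)
  moreover have "x \<in> Hom K (Dom K ?z) (Dom K k) \<and> k \<cdot> x = ?z"
    using x ob k Cod_Obj by (auto simp: Hom_iff)
  moreover have "Zero K (Dom K x) (Dom K k) \<in> Hom K (Dom K ?z) (Dom K k)
      \<and> k \<cdot> Zero K (Dom K x) (Dom K k) = ?z"
    using ob k Cod_Obj by (auto simp: Hom_iff)
  ultimately show "x = Zero K (Dom K x) (Dom K k)"
    by blast
qed

lemma cokernel_epic:
  assumes "is_cokernel K c f"
  shows "epic K c"
proof (rule epicI)
  show c: "c \<in> Arr K"
    using assms unfolding is_cokernel_def by blast
  fix x
  assume x: "x \<in> Arr K" "Dom K x = Cod K c" "x \<cdot> c = Zero K (Dom K c) (Cod K x)"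
  have ob: "Cod K x \<in> Obj K" "Cod K c \<in> Obj K" "Dom K c \<in> Obj K"
    using x c Cod_Obj Dom_Obj by auto
  let ?z = "Zero K (Dom K c) (Cod K x)"
  have f: "f \<in> Arr K" "Dom K c = Cod K f" "Cod K f \<in> Obj K"
    and coker: "\<And>h. h \<in> Arr K \<Longrightarrow> Dom K h = Cod K f \<Longrightarrow> h \<cdot> f = Zero K (Dom K f) (Cod K h) \<Longrightarrow>
        \<exists>!u. u \<in> Hom K (Cod K c) (Cod K h) \<and> u \<cdot> c = h"
    using assms Cod_Obj unfolding is_cokernel_def by blast+
  have "\<exists>!u. u \<in> Hom K (Cod K c) (Cod K ?z) \<and> u \<cdot> c = ?z"
    by (rule coker) (use f ob in auto)
  moreover have "x \<in> Hom K (Cod K c) (Cod K ?z) \<and> x \<cdot> c = ?z"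
    using x ob by (auto simp: Hom_iff)
  moreover have "Zero K (Cod K c) (Cod K x) \<in> Hom K (Cod K c) (Cod K ?z)
      \<and> Zero K (Cod K c) (Cod K x) \<cdot> c = ?z"
    using ob c by (auto simp: Hom_iff)
  ultimately show "x = Zero K (Cod K c) (Cod K x)"
    by blast
qed

lemma kernel_lift:
  assumes "is_kernel K k f" "h \<in> Arr K" "Cod K h = Dom K f" "f \<cdot> h = Zero K (Dom K h) (Cod K f)"
  obtains u where "u \<in> Arr K" "Dom K u = Dom K h" "Cod K u = Dom K k" "k \<cdot> u = h"
  using assms unfolding is_kernel_def Hom_iff by meson

lemma cokernel_desc:
  assumes "is_cokernel K c f" "h \<in> Arr K" "Dom K h = Cod K f" "h \<cdot> f = Zero K (Dom K f) (Cod K h)"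
  obtains u where "u \<in> Arr K" "Dom K u = Cod K c" "Cod K u = Cod K h" "u \<cdot> c = h"
  using assms unfolding is_cokernel_def Hom_iff by meson

lemma is_kernelI:
  assumes "k \<in> Arr K" "f \<in> Arr K" "Cod K k = Dom K f" "f \<cdot> k = Zero K (Dom K k) (Cod K f)"
    and "monic K k"
    and "\<And>h. h \<in> Arr K \<Longrightarrow> Cod K h = Dom K f \<Longrightarrow> f \<cdot> h = Zero K (Dom K h) (Cod K f)
      \<Longrightarrow> \<exists>u. u \<in> Hom K (Dom K h) (Dom K k) \<and> k \<cdot> u = h"
  shows "is_kernel K k f"
  unfolding is_kernel_def
proof (intro conjI allI ballI impI)
  fix h
  assume h: "h \<in> Arr K" "Cod K h = Dom K f \<and> f \<cdot> h = Zero K (Dom K h) (Cod K f)"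
  then obtain u where "u \<in> Hom K (Dom K h) (Dom K k)" "k \<cdot> u = h"
    using assms(6) by blast
  then show "\<exists>!u. u \<in> Hom K (Dom K h) (Dom K k) \<and> k \<cdot> u = h"
    by (intro ex1I[of _ u]) (auto intro: monicD[OF assms(5)])
qed (use assms in auto)

lemma is_cokernelI:
  assumes "c \<in> Arr K" "f \<in> Arr K" "Dom K c = Cod K f" "c \<cdot> f = Zero K (Dom K f) (Cod K c)"
    and "epic K c"
    and "\<And>h. h \<in> Arr K \<Longrightarrow> Dom K h = Cod K f \<Longrightarrow> h \<cdot> f = Zero K (Dom K f) (Cod K h)
      \<Longrightarrow> \<exists>u. u \<in> Hom K (Cod K c) (Cod K h) \<and> u \<cdot> c = h"
  shows "is_cokernel K c f"
  unfolding is_cokernel_def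
proof (intro conjI allI ballI impI)
  fix h
  assume h: "h \<in> Arr K" "Dom K h = Cod K f \<and> h \<cdot> f = Zero K (Dom K f) (Cod K h)"
  then obtain u where "u \<in> Hom K (Cod K c) (Cod K h)" "u \<cdot> c = h"
    using assms(6) by blast
  then show "\<exists>!u. u \<in> Hom K (Cod K c) (Cod K h) \<and> u \<cdot> c = h"
    by (intro ex1I[of _ u]) (auto intro: epicD[OF assms(5)])
qed (use assms in auto)

end

context preadditive_category
begin

lemma hom_objs: "f \<in> Hom K A B \<Longrightarrow> A \<in> Obj K \<and> B \<in> Obj K"
  using Dom_Obj Cod_Obj by (auto simp: Hom_iff)

lemma monic_cancel_zero:
  assumes "monic K f" "f \<in> Hom K A B" "x \<in> Hom K X A" "f \<cdot> x = Zero K X B"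
  shows "x = Zero K X A"
  using monic_zeroD[of f x] assms by (auto simp: Hom_iff)

lemma epic_cancel_zero:
  assumes "epic K f" "f \<in> Hom K A B" "t \<in> Hom K B M" "t \<cdot> f = Zero K A M"
  shows "t = Zero K B M"
  using epic_zeroD[of f t] assms by (auto simp: Hom_iff)

lemma monic_cancel:
  assumes "monic K f" "f \<in> Hom K A B" "x \<in> Hom K X A" "y \<in> Hom K X A" "f \<cdot> x = f \<cdot> y"
  shows "x = y"
  using monicD[of f x X y] assms by (auto simp: Hom_iff)

lemma epic_cancel:
  assumes "epic K f" "f \<in> Hom K A B" "x \<in> Hom K B M" "y \<in> Hom K B M" "x \<cdot> f = y \<cdot> f"
  shows "x = y"
  using epicD[of f x M y] assms by (auto simp: Hom_iff)

lemma kernel_lift_hom: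
  assumes "is_kernel K k f" "k \<in> Hom K R A" "f \<in> Hom K A B" "h \<in> Hom K X A"
    "f \<cdot> h = Zero K X B"
  obtains u where "u \<in> Hom K X R" "k \<cdot> u = h"
  using kernel_lift[of k f h] assms by (auto simp: Hom_iff)

lemma cokernel_desc_hom:
  assumes "is_cokernel K c f" "c \<in> Hom K B C" "f \<in> Hom K A B" "h \<in> Hom K B M"
    "h \<cdot> f = Zero K A M"
  obtains u where "u \<in> Hom K C M" "u \<cdot> c = h"
  using cokernel_desc[of c f h] assms by (auto simp: Hom_iff)

lemma kernel_comp_zero:
  "is_kernel K k f \<Longrightarrow> k \<in> Hom K R A \<Longrightarrow> f \<in> Hom K A B \<Longrightarrow> f \<cdot> k = Zero K R B"
  unfolding is_kernel_def by (auto simp: Hom_iff)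

lemma cokernel_comp_zero:
  "is_cokernel K c f \<Longrightarrow> c \<in> Hom K B C \<Longrightarrow> f \<in> Hom K A B \<Longrightarrow> c \<cdot> f = Zero K A C"
  unfolding is_cokernel_def by (auto simp: Hom_iff)

lemma split_epic:
  assumes "p \<in> Hom K A B" "i \<in> Hom K B A" "p \<cdot> i = Ide K B"
  shows "epic K p"
proof (rule epicI)
  fix t assume t: "t \<in> Arr K" "Dom K t = Cod K p" "t \<cdot> p = Zero K (Dom K p) (Cod K t)"
  have "Cod K t \<in> Obj K" using t Cod_Obj by blast
  moreover have "t \<cdot> p \<cdot> i = Zero K (Dom K p) (Cod K t) \<cdot> i"
    by (rule comp_rewrite[OF t(3)]) (use assms t in \<open>auto simp: Hom_iff\<close>)
  ultimately show "t = Zero K (Cod K p) (Cod K t)"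
    using assms t by (simp add: Hom_iff)
qed (use assms in \<open>simp add: Hom_iff\<close>)

lemma split_monic:
  assumes "p \<in> Hom K A B" "i \<in> Hom K B A" "p \<cdot> i = Ide K B"
  shows "monic K i"
proof (rule monicI)
  fix t assume t: "t \<in> Arr K" "Cod K t = Dom K i" "i \<cdot> t = Zero K (Dom K t) (Cod K i)"
  have "Dom K t \<in> Obj K" using t Dom_Obj by blast
  moreover have "p \<cdot> i \<cdot> t = Ide K B \<cdot> t"
    by (rule comp_rewrite[OF assms(3)]) (use assms t in \<open>auto simp: Hom_iff\<close>)
  ultimately show "t = Zero K (Dom K t) (Dom K i)"
    using assms t by (simp add: Hom_iff)
qed (use assms in \<open>simp add: Hom_iff\<close>)

end

section \<open>Abelian categories\<close>

context abelian_category
begin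

lemma kernel_exists:
  assumes "f \<in> Hom K A B"
  obtains R k where "k \<in> Hom K R A" "is_kernel K k f"
proof -
  obtain k where k: "is_kernel K k f"
    using kernels assms by (auto simp: Hom_iff)
  then have "k \<in> Hom K (Dom K k) A"
    using assms unfolding is_kernel_def by (auto simp: Hom_iff)
  with k show ?thesis
    using that by blast
qed

lemma cokernel_exists:
  assumes "f \<in> Hom K A B"
  obtains C c where "c \<in> Hom K B C" "is_cokernel K c f"
proof -
  obtain c where c: "is_cokernel K c f"
    using cokernels assms by (auto simp: Hom_iff)
  then have "c \<in> Hom K B (Cod K c)"
    using assms unfolding is_cokernel_def by (auto simp: Hom_iff)
  with c show ?thesis
    using that by blast
qed

text \<open>
  Every epimorphism is the cokernel of some \<open>g\<close>; as \<open>g\<close> factors through the kernel \<open>k\<close>, what vanishes on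
  \<open>k\<close> vanishes on \<open>g\<close>.
\<close>

lemma epic_is_cokernel_of_kernel:
  assumes e: "epic K e" "e \<in> Hom K A B" and k: "is_kernel K k e" "k \<in> Hom K R A"
  shows "is_cokernel K e k"
proof (rule is_cokernelI)
  fix h
  assume h: "h \<in> Arr K" "Dom K h = Cod K k" "h \<cdot> k = Zero K (Dom K k) (Cod K h)"
  obtain g where g: "is_cokernel K e g"
    using epic_normal[OF e(1)] by blast
  obtain X where X: "g \<in> Hom K X A" "e \<cdot> g = Zero K X B"
    using g e(2) unfolding is_cokernel_def by (auto simp: Hom_iff)
  obtain u where u: "u \<in> Hom K X R" "k \<cdot> u = g"
    using kernel_lift_hom[OF k e(2) X] by blast
  have M: "Cod K h \<in> Obj K" using h Cod_Obj by blast
  have "h \<cdot> k \<cdot> u = Zero K (Dom K k) (Cod K h) \<cdot> u"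
    by (rule comp_rewrite[OF h(3)]) (use u h k in \<open>auto simp: Hom_iff\<close>)
  then have "h \<cdot> g = Zero K X (Cod K h)"
    using u h k M by (simp add: Hom_iff)
  then show "\<exists>u. u \<in> Hom K (Cod K e) (Cod K h) \<and> u \<cdot> e = h"
    using cokernel_desc_hom[OF g e(2) X(1), of h "Cod K h"] h k e by (auto simp: Hom_iff)
qed (use assms kernel_comp_zero[OF k e(2)] in \<open>auto simp: Hom_iff\<close>)

lemma monic_is_kernel_of_cokernel:
  assumes m: "monic K m" "m \<in> Hom K A B" and c: "is_cokernel K c m" "c \<in> Hom K B C"
  shows "is_kernel K m c"
proof (rule is_kernelI)
  fix h
  assume h: "h \<in> Arr K" "Cod K h = Dom K c" "c \<cdot> h = Zero K (Dom K h) (Cod K c)"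
  obtain g where g: "is_kernel K m g"
    using monic_normal[OF m(1)] by blast
  obtain X where X: "g \<in> Hom K B X" "g \<cdot> m = Zero K A X"
    using g m(2) unfolding is_kernel_def by (auto simp: Hom_iff)
  obtain u where u: "u \<in> Hom K C X" "u \<cdot> c = g"
    using cokernel_desc_hom[OF c m(2) X] by blast
  have M: "Dom K h \<in> Obj K" using h Dom_Obj by blast
  have "u \<cdot> c \<cdot> h = g \<cdot> h"
    by (rule comp_rewrite[OF u(2)]) (use u h c in \<open>auto simp: Hom_iff\<close>)
  then have "g \<cdot> h = Zero K (Dom K h) X"
    using u h c M by (simp add: Hom_iff)
  then show "\<exists>u. u \<in> Hom K (Dom K h) (Dom K m) \<and> m \<cdot> u = h"
    using kernel_lift_hom[OF g m(2) X(1), of h "Dom K h"] h c m by (auto simp: Hom_iff)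
qed (use assms cokernel_comp_zero[OF c m(2)] in \<open>auto simp: Hom_iff\<close>)

lemma monic_epic_isomorphic:
  assumes m: "monic K m" and e: "epic K m" and h: "m \<in> Hom K A B"
  shows "isomorphic K A B"
proof -
  obtain g where g: "is_kernel K m g"
    using monic_normal[OF m] by blast
  obtain X where X: "g \<in> Hom K B X" "g \<cdot> m = Zero K A X"
    using g h unfolding is_kernel_def by (auto simp: Hom_iff)
  have ob: "A \<in> Obj K" "B \<in> Obj K" "X \<in> Obj K"
    using hom_objs h X by auto
  have "g = Zero K B X"
    using epic_cancel_zero[OF e h X] .
  then have "g \<cdot> Ide K B = Zero K B X"
    using X ob by (simp add: Hom_iff)
  then obtain u where u: "u \<in> Hom K B A" "m \<cdot> u = Ide K B"
    using kernel_lift_hom[OF g h X(1) Ide_Hom] ob by blast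
  have "u \<cdot> m = Ide K A"
    by (rule monic_cancel[OF m h]) (use u h ob comp_rewrite[of m u "Ide K B" m] in \<open>auto simp: Hom_iff\<close>)
  then show ?thesis
    unfolding isomorphic_def using u h ob by blast
qed

definition biproduct ::
  "'a \<Rightarrow> 'a \<Rightarrow> 'a \<Rightarrow> 'b \<Rightarrow> 'b \<Rightarrow> 'b \<Rightarrow> 'b \<Rightarrow> bool" where
  "biproduct A B P i p j q \<longleftrightarrow>
     i \<in> Hom K A P \<and> p \<in> Hom K P A \<and> j \<in> Hom K B P \<and> q \<in> Hom K P B \<and>
     p \<cdot> i = Ide K A \<and> q \<cdot> j = Ide K B \<and> p \<cdot> j = Zero K B A \<and> q \<cdot> i = Zero K A B \<and>
     (\<forall>M f g. f \<in> Hom K A M \<and> g \<in> Hom K B M \<longrightarrow>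
        (\<exists>!u. u \<in> Hom K P M \<and> u \<cdot> i = f \<and> u \<cdot> j = g))"

lemma biproduct_exists:
  assumes AB: "A \<in> Obj K" "B \<in> Obj K"
  obtains P i p j q where "biproduct A B P i p j q"
proof -
  obtain P \<iota> where P: "is_coproduct K UNIV (\<lambda>b :: bool. if b then A else B) P \<iota>"
    using binary_coproducts[OF AB] by blast
  have univ: "\<exists>!u. u \<in> Hom K P M \<and> u \<cdot> \<iota> True = f \<and> u \<cdot> \<iota> False = g"
    if "f \<in> Hom K A M" "g \<in> Hom K B M" for M f g
  proof -
    have "\<exists>!u. u \<in> Hom K P M \<and> (\<forall>b \<in> UNIV. u \<cdot> \<iota> b = (if b then f else g))"
      using P that hom_objs unfolding is_coproduct_def by simp
    then show ?thesis
      by (auto simp: all_bool_eq)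
  qed
  have i: "\<iota> True \<in> Hom K A P" "\<iota> False \<in> Hom K B P"
    using P unfolding is_coproduct_def by (auto simp: all_bool_eq)
  obtain p where p: "p \<in> Hom K P A" "p \<cdot> \<iota> True = Ide K A" "p \<cdot> \<iota> False = Zero K B A"
    using univ[of "Ide K A" A "Zero K B A"] AB by (auto simp: Hom_iff)
  obtain q where q: "q \<in> Hom K P B" "q \<cdot> \<iota> True = Zero K A B" "q \<cdot> \<iota> False = Ide K B"
    using univ[of "Zero K A B" B "Ide K B"] AB by (auto simp: Hom_iff)
  show ?thesis
    by (rule that[of P "\<iota> True" p "\<iota> False" q]) (use i p q univ in \<open>auto simp: biproduct_def\<close>)
qed

lemma biproductD:
  assumes "biproduct A B P i p j q"
  shows "i \<in> Hom K A P" "p \<in> Hom K P A" "j \<in> Hom K B P" "q \<in> Hom K P B"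
    "p \<cdot> i = Ide K A" "q \<cdot> j = Ide K B" "p \<cdot> j = Zero K B A" "q \<cdot> i = Zero K A B"
    "A \<in> Obj K" "B \<in> Obj K" "P \<in> Obj K"
  using assms hom_objs unfolding biproduct_def by blast+

lemma biproduct_copair:
  assumes "biproduct A B P i p j q" "f \<in> Hom K A M" "g \<in> Hom K B M"
  obtains u where "u \<in> Hom K P M" "u \<cdot> i = f" "u \<cdot> j = g"
  using assms unfolding biproduct_def by blast

lemma biproduct_eqI:
  assumes P: "biproduct A B P i p j q" and uv: "u \<in> Hom K P M" "v \<in> Hom K P M"
    and eq: "u \<cdot> i = v \<cdot> i" "u \<cdot> j = v \<cdot> j"
  shows "u = v"
proof -
  have "v \<cdot> i \<in> Hom K A M" "v \<cdot> j \<in> Hom K B M"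
    using uv biproductD[OF P] Comp_Hom by auto
  then have "\<exists>!u. u \<in> Hom K P M \<and> u \<cdot> i = v \<cdot> i \<and> u \<cdot> j = v \<cdot> j"
    using P unfolding biproduct_def by blast
  then show ?thesis
    using uv eq by blast
qed

lemma biproduct_short_exact:
  assumes P: "biproduct A B P i p j q"
  shows "short_exact K i q"
proof -
  note D = biproductD[OF P]
  have c: "is_cokernel K q i"
  proof (rule is_cokernelI)
    show "epic K q"
      using split_epic D by blast
    fix h
    assume h: "h \<in> Arr K" "Dom K h = Cod K i" "h \<cdot> i = Zero K (Dom K i) (Cod K h)"
    have M: "Cod K h \<in> Obj K" using h Cod_Obj by blast
    have "(h \<cdot> j) \<cdot> q = h"
    proof (rule biproduct_eqI[OF P])
      show "((h \<cdot> j) \<cdot> q) \<cdot> i = h \<cdot> i"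
        using D h M by (auto simp: Hom_iff)
      show "((h \<cdot> j) \<cdot> q) \<cdot> j = h \<cdot> j"
        using D h M by (auto simp: Hom_iff)
    qed (use D h in \<open>auto simp: Hom_iff\<close>)
    then show "\<exists>u. u \<in> Hom K (Cod K q) (Cod K h) \<and> u \<cdot> q = h"
      by (intro exI[of _ "h \<cdot> j"]) (use D h in \<open>auto simp: Hom_iff\<close>)
  qed (use D in \<open>auto simp: Hom_iff\<close>)
  then show ?thesis
    unfolding short_exact_def
    using monic_is_kernel_of_cokernel[OF split_monic[OF D(2,1,5)] D(1) c D(4)] by blast
qed

text \<open>
  Pulling an epimorphism \<open>e\<close> back along \<open>s\<close> gives an epimorphism; in terms of a generating class:
  the arrows \<open>a\<close> from generators for which \<open>s \<cdot> a\<close> lifts along \<open>e\<close> are jointly epic. The pullback is the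
  kernel of \<open>w = e p - s q\<close> on the biproduct of \<open>B\<close> and \<open>S\<close>. If \<open>t q\<close> vanishes on it, then \<open>t q = v w\<close> for some \<open>v\<close>;
  restricting to \<open>B\<close> gives \<open>v e = 0\<close>, so \<open>v = 0\<close> and \<open>t = 0\<close>.
\<close>

lemma lifting_arrows_jointly_epic:
  assumes e: "epic K e" "e \<in> Hom K B C" and s: "s \<in> Hom K S C" and t: "t \<in> Hom K S M"
    and G: "generating K G"
    and zero: "\<And>X a b. X \<in> G \<Longrightarrow> a \<in> Hom K X S \<Longrightarrow> b \<in> Hom K X B \<Longrightarrow> e \<cdot> b = s \<cdot> a
      \<Longrightarrow> t \<cdot> a = Zero K X M"
  shows "t = Zero K S M"
proof -
  have ob: "B \<in> Obj K" "C \<in> Obj K" "S \<in> Obj K" "M \<in> Obj K"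
    using e s t hom_objs by auto
  obtain P i p j q where P: "biproduct B S P i p j q"
    using biproduct_exists ob by blast
  note D = biproductD[OF P]
  define w where "w = Sub (e \<cdot> p) (s \<cdot> q)"
  have w: "w \<in> Hom K P C"
    unfolding w_def using D e s by (auto simp: Hom_iff)
  have wi: "w \<cdot> i = e"
    unfolding w_def using D e s ob by (auto simp: Hom_iff sub_comp)
  have "epic K w"
  proof (rule epicI)
    fix x
    assume x: "x \<in> Arr K" "Dom K x = Cod K w" "x \<cdot> w = Zero K (Dom K w) (Cod K x)"
    have M: "Cod K x \<in> Obj K" using x Cod_Obj by blast
    have "x \<cdot> w \<cdot> i = Zero K (Dom K w) (Cod K x) \<cdot> i"
      by (rule comp_rewrite[OF x(3)]) (use x w D in \<open>auto simp: Hom_iff\<close>)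
    then have "x \<cdot> e = Zero K B (Cod K x)"
      using x w D M wi by (simp add: Hom_iff)
    then show "x = Zero K (Cod K w) (Cod K x)"
      using epic_cancel_zero[OF e, of x "Cod K x"] x w by (auto simp: Hom_iff)
  qed (use w in \<open>simp add: Hom_iff\<close>)
  obtain R k where k: "k \<in> Hom K R P" "is_kernel K k w"
    using kernel_exists[OF w] by blast
  have R: "R \<in> Obj K" using hom_objs k by auto
  have wk: "w \<cdot> k = Zero K R C"
    using kernel_comp_zero k w by blast
  have "t \<cdot> (q \<cdot> k) = Zero K R M"
  proof (rule ccontr)
    assume neq: "t \<cdot> (q \<cdot> k) \<noteq> Zero K R M"
    have "t \<cdot> (q \<cdot> k) \<in> Hom K R M" "Zero K R M \<in> Hom K R M"
      using t D k R ob by (auto simp: Hom_iff)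
    then obtain X h where h: "X \<in> G" "h \<in> Hom K X R" "(t \<cdot> (q \<cdot> k)) \<cdot> h \<noteq> Zero K R M \<cdot> h"
      using G neq unfolding generating_def by blast
    have X: "X \<in> Obj K" using h hom_objs by auto
    have "Sub (e \<cdot> p) (s \<cdot> q) \<cdot> (k \<cdot> h) = Zero K X C"
      using wk h k w ob X comp_rewrite[OF wk, of h] unfolding w_def[symmetric] by (simp add: Hom_iff)
    then have "Sub (e \<cdot> p \<cdot> k \<cdot> h) (s \<cdot> q \<cdot> k \<cdot> h) = Zero K X C"
      using h k D e s by (simp add: sub_comp Hom_iff)
    then have "e \<cdot> (p \<cdot> k \<cdot> h) = s \<cdot> (q \<cdot> k \<cdot> h)"
      using sub_eq_zero[of "e \<cdot> p \<cdot> k \<cdot> h" "s \<cdot> q \<cdot> k \<cdot> h"] h k D e s by (simp add: Hom_iff)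
    then have "t \<cdot> (q \<cdot> k \<cdot> h) = Zero K X M"
      by (intro zero[of X "q \<cdot> k \<cdot> h" "p \<cdot> k \<cdot> h"]) (use h k D in \<open>auto simp: Hom_iff\<close>)
    then show False
      using h k D t ob R X by (simp add: Hom_iff)
  qed
  then have "(t \<cdot> q) \<cdot> k = Zero K R M"
    using t D k by (simp add: Hom_iff)
  then obtain v where v: "v \<in> Hom K C M" "v \<cdot> w = t \<cdot> q"
    using cokernel_desc_hom[OF epic_is_cokernel_of_kernel[OF \<open>epic K w\<close> w k(2,1)] w k(1), of "t \<cdot> q" M]
      t D by (auto simp: Hom_iff)
  have "v \<cdot> w \<cdot> i = (t \<cdot> q) \<cdot> i"
    by (rule comp_rewrite[OF v(2)]) (use v w D in \<open>auto simp: Hom_iff\<close>)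
  then have "v \<cdot> e = Zero K B M"
    using t D ob wi by (simp add: Hom_iff)
  then have "v = Zero K C M"
    using epic_cancel_zero[OF e v(1)] by blast
  then have "t \<cdot> q = Zero K P M"
    using v w ob D by (simp add: Hom_iff)
  then have "t \<cdot> q \<cdot> j = Zero K P M \<cdot> j"
    by (rule comp_rewrite) (use t D in \<open>auto simp: Hom_iff\<close>)
  then show ?thesis
    using t D ob by (simp add: Hom_iff)
qed

text \<open>
  Since generators detect zero arrows, the kernel of \<open>\<epsilon>\<close> is controlled by the arrows from generators
  that \<open>\<epsilon>\<close> kills.
\<close>

lemma factor_through_epic:
  assumes G: "generating K G" and \<epsilon>: "epic K \<epsilon>" "\<epsilon> \<in> Hom K U S" and \<epsilon>': "\<epsilon>' \<in> Hom K U S'"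
    and ker: "\<And>Y h. Y \<in> G \<Longrightarrow> h \<in> Hom K Y U \<Longrightarrow> \<epsilon> \<cdot> h = Zero K Y S \<Longrightarrow> \<epsilon>' \<cdot> h = Zero K Y S'"
  obtains v where "v \<in> Hom K S S'" "v \<cdot> \<epsilon> = \<epsilon>'"
proof -
  obtain R k where k: "k \<in> Hom K R U" "is_kernel K k \<epsilon>"
    using kernel_exists[OF \<epsilon>(2)] by blast
  have ob: "R \<in> Obj K" "S \<in> Obj K" "S' \<in> Obj K"
    using hom_objs k \<epsilon> \<epsilon>' by auto
  have \<epsilon>k: "\<epsilon> \<cdot> k = Zero K R S"
    using kernel_comp_zero k \<epsilon> by blast
  have "\<epsilon>' \<cdot> k = Zero K R S'"
  proof (rule ccontr)
    assume neq: "\<epsilon>' \<cdot> k \<noteq> Zero K R S'"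
    have "\<epsilon>' \<cdot> k \<in> Hom K R S'" "Zero K R S' \<in> Hom K R S'"
      using k \<epsilon>' ob by (auto simp: Hom_iff)
    then obtain Y h where h: "Y \<in> G" "h \<in> Hom K Y R" "(\<epsilon>' \<cdot> k) \<cdot> h \<noteq> Zero K R S' \<cdot> h"
      using G neq unfolding generating_def by blast
    have kh: "k \<cdot> h \<in> Hom K Y U" "\<epsilon> \<cdot> k \<cdot> h = Zero K Y S"
      using comp_rewrite[OF \<epsilon>k, of h] k h \<epsilon> ob by (auto simp: Hom_iff)
    show False
      using ker[OF h(1) kh] h k \<epsilon>' ob by (simp add: Hom_iff)
  qed
  then show ?thesis
    using cokernel_desc_hom[OF epic_is_cokernel_of_kernel[OF \<epsilon> k(2,1)] \<epsilon>(2) k(1) \<epsilon>'] that by blast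
qed

text \<open>
  The pushout \<open>E\<close> of \<open>\<alpha>\<close> and \<open>\<rho>\<close> is the cokernel of their difference \<open>\<sigma>\<close> into the biproduct of \<open>A\<close> and \<open>Q\<close>.
  The arrow \<open>a\<close> is monic because \<open>\<sigma>\<close> is, hence is the kernel of its cokernel: if \<open>a x = 0\<close>, then \<open>i x\<close> comes
  from some \<open>y\<close> along \<open>\<sigma>\<close>, and projecting to \<open>Q\<close> shows that \<open>\<rho> y = 0\<close>.
\<close>

lemma pushout_extension:
  assumes \<epsilon>: "epic K \<epsilon>" "\<epsilon> \<in> Hom K Q S" and \<rho>: "is_kernel K \<rho> \<epsilon>" "\<rho> \<in> Hom K R Q"
    and \<alpha>: "\<alpha> \<in> Hom K R A"
  obtains E a b \<psi> where "a \<in> Hom K A E" "b \<in> Hom K Q E" "a \<cdot> \<alpha> = b \<cdot> \<rho>"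
    "short_exact K a \<psi>" "\<psi> \<in> Hom K E S"
    "\<And>M f g. f \<in> Hom K A M \<Longrightarrow> g \<in> Hom K Q M \<Longrightarrow> f \<cdot> \<alpha> = g \<cdot> \<rho> \<Longrightarrow>
       \<exists>u. u \<in> Hom K E M \<and> u \<cdot> a = f \<and> u \<cdot> b = g"
proof -
  have ob: "Q \<in> Obj K" "S \<in> Obj K" "R \<in> Obj K" "A \<in> Obj K"
    using hom_objs \<epsilon> \<rho> \<alpha> by auto
  obtain P i p j q where P: "biproduct A Q P i p j q"
    using biproduct_exists ob by blast
  note D = biproductD[OF P]
  define \<sigma> where "\<sigma> = Sub (i \<cdot> \<alpha>) (j \<cdot> \<rho>)"
  have \<sigma>: "\<sigma> \<in> Hom K R P"
    unfolding \<sigma>_def using D \<rho> \<alpha> by (auto simp: Hom_iff)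
  have sub_zero: "h \<cdot> \<sigma> = Zero K R M \<longleftrightarrow> h \<cdot> i \<cdot> \<alpha> = h \<cdot> j \<cdot> \<rho>" if "h \<in> Hom K P M" for h M
    unfolding \<sigma>_def using that D \<rho> \<alpha> sub_eq_zero[of "h \<cdot> i \<cdot> \<alpha>" "h \<cdot> j \<cdot> \<rho>"]
    by (auto simp: Hom_iff comp_sub)
  obtain E c where c: "c \<in> Hom K P E" "is_cokernel K c \<sigma>"
    using cokernel_exists[OF \<sigma>] by blast
  have E: "E \<in> Obj K" using hom_objs c by auto
  have epic_c: "epic K c" using cokernel_epic c by blast
  define a where "a = c \<cdot> i"
  define b where "b = c \<cdot> j"
  have ab: "a \<in> Hom K A E" "b \<in> Hom K Q E"
    unfolding a_def b_def using D c by (auto simp: Hom_iff)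
  have a\<alpha>: "a \<cdot> \<alpha> = b \<cdot> \<rho>"
    using sub_zero[OF c(1)] cokernel_comp_zero[OF c(2,1) \<sigma>] D c \<rho> \<alpha>
    unfolding a_def b_def by (simp add: Hom_iff)
  have \<epsilon>\<rho>: "\<epsilon> \<cdot> \<rho> = Zero K R S"
    using kernel_comp_zero \<epsilon> \<rho> by blast
  have univ: "\<exists>u. u \<in> Hom K E M \<and> u \<cdot> a = f \<and> u \<cdot> b = g"
    if fg: "f \<in> Hom K A M" "g \<in> Hom K Q M" "f \<cdot> \<alpha> = g \<cdot> \<rho>" for M f g
  proof -
    obtain h where h: "h \<in> Hom K P M" "h \<cdot> i = f" "h \<cdot> j = g"
      using biproduct_copair[OF P fg(1,2)] by blast
    have "h \<cdot> i \<cdot> \<alpha> = h \<cdot> j \<cdot> \<rho>"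
      using h D \<alpha> \<rho> fg comp_rewrite[OF h(2), of \<alpha>] comp_rewrite[OF h(3), of \<rho>] by (simp add: Hom_iff)
    then have "h \<cdot> \<sigma> = Zero K R M"
      using sub_zero h by blast
    then obtain u where u: "u \<in> Hom K E M" "u \<cdot> c = h"
      using cokernel_desc_hom[OF c(2,1) \<sigma> h(1)] by blast
    then have "u \<cdot> a = f" "u \<cdot> b = g"
      unfolding a_def b_def using h D c comp_assoc[of i c u] comp_assoc[of j c u]
      by (simp_all add: Hom_iff)
    then show ?thesis
      using u by blast
  qed
  obtain \<psi> where \<psi>: "\<psi> \<in> Hom K E S" "\<psi> \<cdot> a = Zero K A S" "\<psi> \<cdot> b = \<epsilon>"
    using univ[of "Zero K A S" S \<epsilon>] \<epsilon> \<epsilon>\<rho> \<alpha> ob by (auto simp: Hom_iff)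
  have ext: "u = v" if "u \<in> Hom K E M" "v \<in> Hom K E M" "u \<cdot> a = v \<cdot> a" "u \<cdot> b = v \<cdot> b" for u v M
  proof (rule epic_cancel[OF epic_c c(1) that(1,2)])
    show "u \<cdot> c = v \<cdot> c"
      by (rule biproduct_eqI[OF P, of _ M])
        (use that c D in \<open>auto simp: Hom_iff a_def b_def\<close>)
  qed
  have coker: "is_cokernel K \<psi> a"
  proof (rule is_cokernelI)
    show "epic K \<psi>"
    proof (rule epicI)
      fix t
      assume t: "t \<in> Arr K" "Dom K t = Cod K \<psi>" "t \<cdot> \<psi> = Zero K (Dom K \<psi>) (Cod K t)"
      have M: "Cod K t \<in> Obj K" using t Cod_Obj by blast
      have "t \<cdot> \<psi> \<cdot> b = Zero K (Dom K \<psi>) (Cod K t) \<cdot> b"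
        by (rule comp_rewrite[OF t(3)]) (use \<psi> t ab in \<open>auto simp: Hom_iff\<close>)
      then have "t \<cdot> \<epsilon> = Zero K Q (Cod K t)"
        using \<psi> t ab M by (simp add: Hom_iff)
      then show "t = Zero K (Cod K \<psi>) (Cod K t)"
        using epic_cancel_zero[OF \<epsilon>, of t "Cod K t"] t \<psi> by (simp add: Hom_iff)
    qed (use \<psi> in \<open>auto simp: Hom_iff\<close>)
    fix h
    assume h: "h \<in> Arr K" "Dom K h = Cod K a" "h \<cdot> a = Zero K (Dom K a) (Cod K h)"
    have M: "Cod K h \<in> Obj K" using h Cod_Obj by blast
    have "h \<cdot> a \<cdot> \<alpha> = Zero K (Dom K a) (Cod K h) \<cdot> \<alpha>"
      by (rule comp_rewrite[OF h(3)]) (use h ab \<alpha> in \<open>auto simp: Hom_iff\<close>)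
    then have "(h \<cdot> b) \<cdot> \<rho> = Zero K R (Cod K h)"
      using h ab \<alpha> \<rho> a\<alpha> M by (simp add: Hom_iff)
    then obtain v where v: "v \<in> Hom K S (Cod K h)" "v \<cdot> \<epsilon> = h \<cdot> b"
      using cokernel_desc_hom[OF epic_is_cokernel_of_kernel[OF \<epsilon> \<rho>] \<epsilon>(2) \<rho>(2), of "h \<cdot> b" "Cod K h"]
        h ab by (auto simp: Hom_iff)
    have "v \<cdot> \<psi> = h"
      by (rule ext[of _ "Cod K h"]) (use v \<psi> h ab M ob in \<open>simp_all add: Hom_iff\<close>)
    then show "\<exists>u. u \<in> Hom K (Cod K \<psi>) (Cod K h) \<and> u \<cdot> \<psi> = h"
      using v \<psi> by (auto simp: Hom_iff)
  qed (use \<psi> ab in \<open>auto simp: Hom_iff\<close>)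
  have qi\<sigma>: "q \<cdot> \<sigma> \<cdot> y = Sub (Zero K X Q) (\<rho> \<cdot> y)" if y: "y \<in> Hom K X R" for y X
    using y D \<rho> \<alpha> hom_objs[OF y] ob comp_rewrite[OF D(6), of "\<rho> \<cdot> y"] comp_rewrite[OF D(8), of "\<alpha> \<cdot> y"]
    unfolding \<sigma>_def by (simp add: Hom_iff comp_sub sub_comp)
  have \<rho>_zero: "y = Zero K X R" if y: "y \<in> Hom K X R" "q \<cdot> \<sigma> \<cdot> y = Zero K X Q" for y X
  proof -
    have X: "X \<in> Obj K" using y hom_objs by auto
    have "Zero K X Q = \<rho> \<cdot> y"
      using qi\<sigma>[OF y(1)] y \<rho> X ob sub_eq_zero[of "Zero K X Q" "\<rho> \<cdot> y"] by (simp add: Hom_iff)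
    then show ?thesis
      using monic_cancel_zero[OF kernel_monic[OF \<rho>(1)] \<rho>(2) y(1)] by simp
  qed
  have monic_\<sigma>: "monic K \<sigma>"
  proof (rule monicI)
    fix y
    assume y: "y \<in> Arr K" "Cod K y = Dom K \<sigma>" "\<sigma> \<cdot> y = Zero K (Dom K y) (Cod K \<sigma>)"
    have "Dom K y \<in> Obj K" using y Dom_Obj by blast
    then show "y = Zero K (Dom K y) (Dom K \<sigma>)"
      using \<rho>_zero[of y "Dom K y"] y \<sigma> D by (simp add: Hom_iff)
  qed (use \<sigma> in \<open>auto simp: Hom_iff\<close>)
  have "monic K a"
  proof (rule monicI)
    fix x
    assume x: "x \<in> Arr K" "Cod K x = Dom K a" "a \<cdot> x = Zero K (Dom K x) (Cod K a)"
    have X: "Dom K x \<in> Obj K" using x Dom_Obj by blast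
    obtain y where y: "y \<in> Hom K (Dom K x) R" "\<sigma> \<cdot> y = i \<cdot> x"
      by (rule kernel_lift_hom[OF monic_is_kernel_of_cokernel[OF monic_\<sigma> \<sigma> c(2,1)] \<sigma> c(1), of "i \<cdot> x" "Dom K x"])
        (use x ab D c in \<open>auto simp: Hom_iff a_def\<close>)
    have "q \<cdot> \<sigma> \<cdot> y = Zero K (Dom K x) Q"
      unfolding y(2) using comp_rewrite[OF D(8), of x] x ab D X by (simp add: Hom_iff)
    then have "y = Zero K (Dom K x) R"
      using \<rho>_zero y by blast
    then have ix: "i \<cdot> x = Zero K (Dom K x) P"
      using y \<sigma> X by (simp add: Hom_iff)
    show "x = Zero K (Dom K x) (Dom K a)"
      using monic_cancel_zero[OF split_monic[OF D(2,1,5)] D(1) _ ix] x ab by (simp add: Hom_iff)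
  qed (use ab in \<open>auto simp: Hom_iff\<close>)
  then have "short_exact K a \<psi>"
    unfolding short_exact_def using coker monic_is_kernel_of_cokernel[OF _ ab(1) coker \<psi>(1)] by blast
  then show ?thesis
    using that[of a E b \<psi>] ab a\<alpha> \<psi> univ by blast
qed

end

section \<open>Small colimits\<close>

locale grothendieck_universe = grothendieck_category \<kappa> K
  for \<kappa> :: "'u rel" and K :: "('o, 'm) precat" (structure) +
  assumes inacc: "inaccessible \<kappa>"
begin

lemma coproductD:
  assumes "is_coproduct K I D P \<iota>"
  shows "P \<in> Obj K" "\<And>i. i \<in> I \<Longrightarrow> \<iota> i \<in> Hom K (D i) P"
  using assms unfolding is_coproduct_def by blast+

lemma coproduct_universal:
  assumes "is_coproduct K I D P \<iota>" "M \<in> Obj K" "\<And>i. i \<in> I \<Longrightarrow> \<mu> i \<in> Hom K (D i) M"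
  shows "\<exists>!u. u \<in> Hom K P M \<and> (\<forall>i \<in> I. u \<cdot> \<iota> i = \<mu> i)"
  using assms(1)[unfolded is_coproduct_def, THEN conjunct2, THEN conjunct2, rule_format, of M \<mu>]
    assms(2,3) by simp

lemma coproduct_copair:
  assumes "is_coproduct K I D P \<iota>" "M \<in> Obj K" "\<And>i. i \<in> I \<Longrightarrow> \<mu> i \<in> Hom K (D i) M"
  obtains u where "u \<in> Hom K P M" "\<And>i. i \<in> I \<Longrightarrow> u \<cdot> \<iota> i = \<mu> i"
  using coproduct_universal[OF assms] by blast

lemma coproduct_eqI:
  assumes P: "is_coproduct K I D P \<iota>" and u: "u \<in> Hom K P M" and v: "v \<in> Hom K P M"
    and eq: "\<And>i. i \<in> I \<Longrightarrow> u \<cdot> \<iota> i = v \<cdot> \<iota> i"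
  shows "u = v"
proof -
  have "M \<in> Obj K" "\<And>i. i \<in> I \<Longrightarrow> v \<cdot> \<iota> i \<in> Hom K (D i) M"
    using hom_objs u v coproductD[OF P] Comp_Hom by blast+
  from coproduct_universal[OF P this] show ?thesis
    using u v eq by blast
qed

lemma coproduct_exists:
  assumes I: "small \<kappa> I" and D: "\<And>i. i \<in> I \<Longrightarrow> D i \<in> Obj K"
  obtains P \<iota> where "is_coproduct K I D P \<iota>"
proof -
  obtain \<phi> :: "_ \<Rightarrow> 'u" where \<phi>: "inj_on \<phi> I"
    using small_embedding[OF inacc I] by blast
  define \<psi> where "\<psi> = inv_into I \<phi>"
  have \<psi>: "\<psi> (\<phi> i) = i" if "i \<in> I" for i
    unfolding \<psi>_def using inv_into_f_f[OF \<phi> that] .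
  obtain P \<iota> where P: "is_coproduct K (\<phi> ` I) (\<lambda>a. D (\<psi> a)) P \<iota>"
    using coproducts[OF small_image[OF I], of \<phi> "\<lambda>a. D (\<psi> a)"] D \<psi> by auto
  have "is_coproduct K I D P (\<lambda>i. \<iota> (\<phi> i))"
    unfolding is_coproduct_def
  proof (intro conjI ballI allI impI)
    show "P \<in> Obj K" "\<And>i. i \<in> I \<Longrightarrow> \<iota> (\<phi> i) \<in> Hom K (D i) P"
      using coproductD[OF P] \<psi> by fastforce+
    fix M \<mu>
    assume M: "M \<in> Obj K \<and> (\<forall>i\<in>I. \<mu> i \<in> Hom K (D i) M)"
    have "\<exists>!u. u \<in> Hom K P M \<and> (\<forall>a \<in> \<phi> ` I. u \<cdot> \<iota> a = \<mu> (\<psi> a))"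
      by (rule coproduct_universal[OF P]) (use M \<psi> in auto)
    then show "\<exists>!u. u \<in> Hom K P M \<and> (\<forall>i\<in>I. u \<cdot> \<iota> (\<phi> i) = \<mu> i)"
      using \<psi> by auto
  qed
  then show ?thesis
    using that by blast
qed

text \<open>
  The cokernel of the arrow from the coproduct of the domains of \<open>\<Gamma>\<close> to \<open>M\<close> that is induced by the family \<open>\<Gamma>\<close>.
\<close>

definition joint_cokernel :: "'m set \<Rightarrow> 'o \<Rightarrow> 'o \<Rightarrow> 'm \<Rightarrow> bool" where
  "joint_cokernel \<Gamma> M C c \<longleftrightarrow> c \<in> Hom K M C \<and> epic K c \<and>
     (\<forall>g \<in> \<Gamma>. c \<cdot> g = Zero K (Dom K g) C) \<and>
     (\<forall>N. \<forall>h \<in> Hom K M N. (\<forall>g \<in> \<Gamma>. h \<cdot> g = Zero K (Dom K g) N) \<longrightarrow> (\<exists>u \<in> Hom K C N. u \<cdot> c = h))"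

lemma joint_cokernel_exists:
  assumes \<Gamma>: "small \<kappa> \<Gamma>" "\<And>g. g \<in> \<Gamma> \<Longrightarrow> g \<in> Hom K (Dom K g) M" and M: "M \<in> Obj K"
  obtains C c where "joint_cokernel \<Gamma> M C c"
proof -
  obtain P \<iota> where P: "is_coproduct K \<Gamma> (Dom K) P \<iota>"
    using coproduct_exists[OF \<Gamma>(1), of "Dom K"] \<Gamma>(2) hom_objs by blast
  obtain s where s: "s \<in> Hom K P M" "\<And>g. g \<in> \<Gamma> \<Longrightarrow> s \<cdot> \<iota> g = g"
    using coproduct_copair[OF P M, of "\<lambda>g. g"] \<Gamma>(2) by blast
  obtain C c where c: "c \<in> Hom K M C" "is_cokernel K c s"
    using cokernel_exists s by blast
  note D = coproductD[OF P]
  have kills: "h \<cdot> s = Zero K P N \<longleftrightarrow> (\<forall>g \<in> \<Gamma>. h \<cdot> g = Zero K (Dom K g) N)" if h: "h \<in> Hom K M N" for h N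
  proof
    have N: "N \<in> Obj K" using h hom_objs by blast
    have hg: "(h \<cdot> s) \<cdot> \<iota> g = h \<cdot> g" "Zero K P N \<cdot> \<iota> g = Zero K (Dom K g) N" if "g \<in> \<Gamma>" for g
      using s h D(2)[OF that] D(1) N s(2)[OF that] by (simp_all add: Hom_iff)
    { assume "h \<cdot> s = Zero K P N"
      then show "\<forall>g \<in> \<Gamma>. h \<cdot> g = Zero K (Dom K g) N"
        using hg by fastforce }
    assume zero: "\<forall>g \<in> \<Gamma>. h \<cdot> g = Zero K (Dom K g) N"
    show "h \<cdot> s = Zero K P N"
    proof (rule coproduct_eqI[OF P])
      show "h \<cdot> s \<in> Hom K P N" "Zero K P N \<in> Hom K P N"
        using h s(1) D(1) N by (auto simp: Hom_iff)
      show "(h \<cdot> s) \<cdot> \<iota> g = Zero K P N \<cdot> \<iota> g" if "g \<in> \<Gamma>" for g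
        unfolding hg[OF that] using zero that by blast
    qed
  qed
  have "joint_cokernel \<Gamma> M C c"
    unfolding joint_cokernel_def
  proof (intro conjI allI ballI impI)
    show "epic K c"
      using cokernel_epic c by blast
    show "c \<cdot> g = Zero K (Dom K g) C" if "g \<in> \<Gamma>" for g
      using kills[OF c(1)] cokernel_comp_zero[OF c(2,1) s(1)] that by blast
    show "\<exists>u\<in>Hom K C N. u \<cdot> c = h" if "h \<in> Hom K M N" "\<forall>g\<in>\<Gamma>. h \<cdot> g = Zero K (Dom K g) N" for N h
      using cokernel_desc_hom[OF c(2,1) s(1) that(1)] kills that by blast
  qed (rule c)
  then show ?thesis
    using that by blast
qed

section \<open>Direct limits\<close>

lemma direct_systemD:
  assumes "direct_system K I r D d"
  shows "r \<subseteq> I \<times> I" "\<And>i. i \<in> I \<Longrightarrow> (i, i) \<in> r" "\<And>i j k. (i, j) \<in> r \<Longrightarrow> (j, k) \<in> r \<Longrightarrow> (i, k) \<in> r"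
    "\<And>i j. i \<in> I \<Longrightarrow> j \<in> I \<Longrightarrow> \<exists>k \<in> I. (i, k) \<in> r \<and> (j, k) \<in> r" "I \<noteq> {}"
    "\<And>i. i \<in> I \<Longrightarrow> D i \<in> Obj K" "\<And>i j. (i, j) \<in> r \<Longrightarrow> d i j \<in> Hom K (D i) (D j)"
    "\<And>i. i \<in> I \<Longrightarrow> d i i = Ide K (D i)" "\<And>i j k. (i, j) \<in> r \<Longrightarrow> (j, k) \<in> r \<Longrightarrow> d j k \<cdot> d i j = d i k"
  using assms
  unfolding direct_system_def directed_poset_def partial_order_on_def preorder_on_def refl_on_def trans_def
  by blast+

lemma direct_limitD:
  assumes "is_direct_limit K I r D d L \<iota>"
  shows "direct_system K I r D d" "L \<in> Obj K" "\<And>i. i \<in> I \<Longrightarrow> \<iota> i \<in> Hom K (D i) L"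
    "\<And>i j. (i, j) \<in> r \<Longrightarrow> \<iota> j \<cdot> d i j = \<iota> i"
  using assms unfolding is_direct_limit_def cocone_def by blast+

lemma direct_limit_copair:
  assumes "is_direct_limit K I r D d L \<iota>" "M \<in> Obj K" "\<And>i. i \<in> I \<Longrightarrow> \<mu> i \<in> Hom K (D i) M"
    "\<And>i j. (i, j) \<in> r \<Longrightarrow> \<mu> j \<cdot> d i j = \<mu> i"
  obtains u where "u \<in> Hom K L M" "\<And>i. i \<in> I \<Longrightarrow> u \<cdot> \<iota> i = \<mu> i"
proof -
  have "cocone K I r D d M \<mu>"
    using assms unfolding cocone_def by blast
  then have "\<exists>!u. u \<in> Hom K L M \<and> (\<forall>i \<in> I. u \<cdot> \<iota> i = \<mu> i)"
    using assms(1) unfolding is_direct_limit_def by blast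
  then show ?thesis
    using that by blast
qed

lemma direct_limit_eqI:
  assumes L: "is_direct_limit K I r D d L \<iota>" and u: "u \<in> Hom K L M" and v: "v \<in> Hom K L M"
    and eq: "\<And>i. i \<in> I \<Longrightarrow> u \<cdot> \<iota> i = v \<cdot> \<iota> i"
  shows "u = v"
proof -
  note DL = direct_limitD[OF L] and DS = direct_systemD[OF direct_limitD(1)[OF L]]
  have "cocone K I r D d M (\<lambda>i. v \<cdot> \<iota> i)"
    unfolding cocone_def
  proof (intro conjI ballI)
    show "M \<in> Obj K" using u hom_objs by blast
    show "v \<cdot> \<iota> i \<in> Hom K (D i) M" if "i \<in> I" for i
      using DL(3)[OF that] v Comp_Hom by blast
    fix x assume x: "x \<in> r"
    then obtain i j where "x = (i, j)" "i \<in> I" "j \<in> I"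
      using DS(1) by blast
    then show "case x of (i, j) \<Rightarrow> (v \<cdot> \<iota> j) \<cdot> d i j = v \<cdot> \<iota> i"
      using DL(4)[of i j] DL(3)[of j] DS(7)[of i j] v x by (simp add: Hom_iff)
  qed
  then have "\<exists>!w. w \<in> Hom K L M \<and> (\<forall>i \<in> I. w \<cdot> \<iota> i = v \<cdot> \<iota> i)"
    using L unfolding is_direct_limit_def by blast
  then show ?thesis
    using u v eq by blast
qed

lemma is_direct_limitI:
  assumes "direct_system K I r D d" "L \<in> Obj K" "\<And>i. i \<in> I \<Longrightarrow> \<iota> i \<in> Hom K (D i) L"
    "\<And>i j. (i, j) \<in> r \<Longrightarrow> \<iota> j \<cdot> d i j = \<iota> i"
    and "\<And>M u v. u \<in> Hom K L M \<Longrightarrow> v \<in> Hom K L M \<Longrightarrow> (\<And>i. i \<in> I \<Longrightarrow> u \<cdot> \<iota> i = v \<cdot> \<iota> i) \<Longrightarrow> u = v"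
    and "\<And>M \<mu>. M \<in> Obj K \<Longrightarrow> (\<And>i. i \<in> I \<Longrightarrow> \<mu> i \<in> Hom K (D i) M) \<Longrightarrow>
      (\<And>i j. (i, j) \<in> r \<Longrightarrow> \<mu> j \<cdot> d i j = \<mu> i) \<Longrightarrow> \<exists>u. u \<in> Hom K L M \<and> (\<forall>i \<in> I. u \<cdot> \<iota> i = \<mu> i)"
  shows "is_direct_limit K I r D d L \<iota>"
  unfolding is_direct_limit_def
proof (intro conjI allI impI)
  show "cocone K I r D d L \<iota>"
    using assms(2-4) unfolding cocone_def by blast
  fix M \<mu>
  assume "cocone K I r D d M \<mu>"
  then have M: "M \<in> Obj K" "\<And>i. i \<in> I \<Longrightarrow> \<mu> i \<in> Hom K (D i) M" "\<And>i j. (i, j) \<in> r \<Longrightarrow> \<mu> j \<cdot> d i j = \<mu> i"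
    unfolding cocone_def by blast+
  obtain u where "u \<in> Hom K L M" "\<forall>i \<in> I. u \<cdot> \<iota> i = \<mu> i"
    using assms(6)[OF M] by blast
  then show "\<exists>!u. u \<in> Hom K L M \<and> (\<forall>i \<in> I. u \<cdot> \<iota> i = \<mu> i)"
    by (intro ex1I[of _ u]) (auto intro: assms(5))
qed (rule assms(1))

text \<open>
  The direct limit is the largest quotient of the coproduct of all stages on which the transition maps
  become identities.
\<close>

lemma direct_limit_exists:
  assumes I: "small \<kappa> I" and sys: "direct_system K I r D d"
  obtains L \<iota> where "is_direct_limit K I r D d L \<iota>"
proof -
  note DS = direct_systemD[OF sys]
  obtain P i where P: "is_coproduct K I D P i"
    using coproduct_exists[of I D] I DS(6) by blast
  note DP = coproductD[OF P]
  define \<delta> where "\<delta> = (\<lambda>(a, b). Sub (i b \<cdot> d a b) (i a))"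
  have ab: "a \<in> I" "b \<in> I" if "(a, b) \<in> r" for a b
    using that DS(1) by auto
  have \<delta>: "\<delta> (a, b) \<in> Hom K (D a) P" if "(a, b) \<in> r" for a b
    unfolding \<delta>_def using that DP(2)[of a] DP(2)[of b] DS(7)[of a b] ab[OF that] by (simp add: Hom_iff)
  have zero: "h \<cdot> \<delta> (a, b) = Zero K (D a) N \<longleftrightarrow> h \<cdot> i b \<cdot> d a b = h \<cdot> i a"
    if "(a, b) \<in> r" "h \<in> Hom K P N" for a b h N
    unfolding \<delta>_def using that DP(2)[of a] DP(2)[of b] DS(7)[of a b] ab[OF that(1)]
      sub_eq_zero[of "h \<cdot> i b \<cdot> d a b" "h \<cdot> i a"] by (simp add: Hom_iff comp_sub)
  have "small \<kappa> (\<delta> ` r)"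
    by (rule small_image, rule small_subset[OF _ DS(1)]) (intro small_Sigma inacc I)
  moreover have "g \<in> Hom K (Dom K g) P" if "g \<in> \<delta> ` r" for g
    using that \<delta> by (auto simp: Hom_iff)
  ultimately obtain L c where c: "joint_cokernel (\<delta> ` r) P L c"
    using joint_cokernel_exists DP(1) by blast
  then have c_hom: "c \<in> Hom K P L" and c_epic: "epic K c"
    and c_zero: "\<And>a b. (a, b) \<in> r \<Longrightarrow> c \<cdot> \<delta> (a, b) = Zero K (Dom K (\<delta> (a, b))) L"
    and c_univ: "\<And>N h. h \<in> Hom K P N \<Longrightarrow> (\<forall>g \<in> \<delta> ` r. h \<cdot> g = Zero K (Dom K g) N) \<Longrightarrow>
      \<exists>u \<in> Hom K L N. u \<cdot> c = h"
    unfolding joint_cokernel_def by blast+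
  have "is_direct_limit K I r D d L (\<lambda>a. c \<cdot> i a)"
  proof (rule is_direct_limitI)
    show "L \<in> Obj K" using c_hom hom_objs by blast
    show "c \<cdot> i a \<in> Hom K (D a) L" if "a \<in> I" for a
      using DP(2)[OF that] c_hom Comp_Hom by blast
    show "(c \<cdot> i b) \<cdot> d a b = c \<cdot> i a" if "(a, b) \<in> r" for a b
      using zero[OF that c_hom] c_zero[OF that] \<delta>[OF that] DP(2)[OF ab(2)[OF that]] DS(7)[OF that] c_hom
      by (simp add: Hom_iff)
    show "u = v" if uv: "u \<in> Hom K L M" "v \<in> Hom K L M" and
      eq: "\<And>a. a \<in> I \<Longrightarrow> u \<cdot> c \<cdot> i a = v \<cdot> c \<cdot> i a" for M u v
    proof (rule epic_cancel[OF c_epic c_hom uv], rule coproduct_eqI[OF P])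
      show "u \<cdot> c \<in> Hom K P M" "v \<cdot> c \<in> Hom K P M"
        using uv c_hom by (auto simp: Hom_iff)
      show "(u \<cdot> c) \<cdot> i a = (v \<cdot> c) \<cdot> i a" if "a \<in> I" for a
        using eq[OF that] uv c_hom DP(2)[OF that] by (simp add: Hom_iff)
    qed
    show "\<exists>u. u \<in> Hom K L M \<and> (\<forall>a \<in> I. u \<cdot> c \<cdot> i a = \<mu> a)"
      if M: "M \<in> Obj K" "\<And>a. a \<in> I \<Longrightarrow> \<mu> a \<in> Hom K (D a) M"
        "\<And>a b. (a, b) \<in> r \<Longrightarrow> \<mu> b \<cdot> d a b = \<mu> a" for M \<mu>
    proof -
      obtain h where h: "h \<in> Hom K P M" "\<And>a. a \<in> I \<Longrightarrow> h \<cdot> i a = \<mu> a"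
        using coproduct_copair[OF P M(1,2)] by blast
      have "h \<cdot> \<delta> (a, b) = Zero K (D a) M" if "(a, b) \<in> r" for a b
      proof -
        have "h \<cdot> i b \<cdot> d a b = \<mu> b \<cdot> d a b"
          by (rule comp_rewrite[OF h(2)]) (use ab[OF that] DP(2)[of b] DS(7)[OF that] h(1) in \<open>auto simp: Hom_iff\<close>)
        then show ?thesis
          using zero[OF that h(1)] M(3)[OF that] h(2) ab[OF that] by simp
      qed
      then have "\<forall>g \<in> \<delta> ` r. h \<cdot> g = Zero K (Dom K g) M"
        using \<delta> by (auto simp: Hom_iff)
      then obtain u where u: "u \<in> Hom K L M" "u \<cdot> c = h"
        using c_univ h(1) by blast
      have "u \<cdot> c \<cdot> i a = \<mu> a" if "a \<in> I" for a
        using comp_rewrite[OF u(2), of "i a"] h(2)[OF that] u c_hom DP(2)[OF that] by (simp add: Hom_iff)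
      then show ?thesis
        using u by blast
    qed
  qed (rule sys)
  then show ?thesis
    using that by blast
qed

lemma direct_limit_reindex:
  assumes L: "is_direct_limit K I r D d L \<iota>" and \<phi>: "inj_on \<phi> I"
  defines "\<psi> \<equiv> inv_into I \<phi>"
  shows "is_direct_limit K (\<phi> ` I) (map_prod \<phi> \<phi> ` r) (\<lambda>a. D (\<psi> a)) (\<lambda>a b. d (\<psi> a) (\<psi> b)) L (\<lambda>a. \<iota> (\<psi> a))"
proof -
  note DL = direct_limitD[OF L] and DS = direct_systemD[OF direct_limitD(1)[OF L]]
  have \<psi>: "\<psi> (\<phi> i) = i" if "i \<in> I" for i
    unfolding \<psi>_def using inv_into_f_f[OF \<phi> that] .
  have rI: "i \<in> I" "j \<in> I" if "(i, j) \<in> r" for i j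
    using that DS(1) by auto
  have r': "(\<phi> i, \<phi> j) \<in> map_prod \<phi> \<phi> ` r \<longleftrightarrow> (i, j) \<in> r" if "i \<in> I" "j \<in> I" for i j
  proof
    assume "(\<phi> i, \<phi> j) \<in> map_prod \<phi> \<phi> ` r"
    then obtain i' j' where h: "\<phi> i = \<phi> i'" "\<phi> j = \<phi> j'" "(i', j') \<in> r"
      by auto
    then show "(i, j) \<in> r"
      using inj_onD[OF \<phi> h(1)] inj_onD[OF \<phi> h(2)] that rI[OF h(3)] by simp
  qed (auto intro: rev_image_eqI)
  have pre: "directed_poset (\<phi> ` I) (map_prod \<phi> \<phi> ` r)"
  proof -
    have "directed_poset I r"
      using DL(1) unfolding direct_system_def by blast
    then have anti: "antisym r"
      unfolding directed_poset_def partial_order_on_def by blast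
    have "map_prod \<phi> \<phi> ` r \<subseteq> \<phi> ` I \<times> \<phi> ` I"
      using DS(1) by auto
    moreover have "refl_on (\<phi> ` I) (map_prod \<phi> \<phi> ` r)"
      using DS(2) r' by (auto simp: refl_on_def)
    moreover have "trans (map_prod \<phi> \<phi> ` r)"
    proof (rule transI)
      fix x y z
      assume xy: "(x, y) \<in> map_prod \<phi> \<phi> ` r" and yz: "(y, z) \<in> map_prod \<phi> \<phi> ` r"
      obtain i j where ij: "x = \<phi> i" "y = \<phi> j" "(i, j) \<in> r"
        using xy by auto
      obtain j' k where jk: "y = \<phi> j'" "z = \<phi> k" "(j', k) \<in> r"
        using yz by auto
      have "j = j'"
        using ij jk rI inj_onD[OF \<phi>] by metis
      then show "(x, z) \<in> map_prod \<phi> \<phi> ` r"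
        using DS(3) ij jk r' rI by metis
    qed
    moreover have "antisym (map_prod \<phi> \<phi> ` r)"
    proof (rule antisymI)
      fix x y
      assume xy: "(x, y) \<in> map_prod \<phi> \<phi> ` r" "(y, x) \<in> map_prod \<phi> \<phi> ` r"
      then obtain i j where ij: "x = \<phi> i" "y = \<phi> j" "(i, j) \<in> r"
        by auto
      then have "(j, i) \<in> r"
        using xy(2) r' rI by metis
      then show "x = y"
        using ij anti by (metis antisymD)
    qed
    moreover have "\<exists>c \<in> \<phi> ` I. (a, c) \<in> map_prod \<phi> \<phi> ` r \<and> (b, c) \<in> map_prod \<phi> \<phi> ` r"
      if ab: "a \<in> \<phi> ` I" "b \<in> \<phi> ` I" for a b
    proof -
      obtain i j where ij: "a = \<phi> i" "b = \<phi> j" "i \<in> I" "j \<in> I"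
        using ab by blast
      then obtain k where "k \<in> I" "(i, k) \<in> r" "(j, k) \<in> r"
        using DS(4) by blast
      then show ?thesis
        using ij r' by blast
    qed
    ultimately show ?thesis
      using DS(5) unfolding directed_poset_def partial_order_on_def preorder_on_def by blast
  qed
  show ?thesis
  proof (rule is_direct_limitI)
    have trans': "d (\<psi> b) (\<psi> c) \<cdot> d (\<psi> a) (\<psi> b) = d (\<psi> a) (\<psi> c)"
      if bc: "(a, b) \<in> map_prod \<phi> \<phi> ` r" "(b, c) \<in> map_prod \<phi> \<phi> ` r" for a b c
    proof -
      obtain i j where ij: "a = \<phi> i" "b = \<phi> j" "(i, j) \<in> r"
        using bc(1) by auto
      obtain j' k where jk: "b = \<phi> j'" "c = \<phi> k" "(j', k) \<in> r"
        using bc(2) by auto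
      note h = ij jk
      have "i \<in> I" "j \<in> I" "k \<in> I" using h rI by blast+
      moreover have "j = j'"
        using h rI inj_onD[OF \<phi>] by metis
      ultimately show ?thesis
        using h DS(9)[of i j k] \<psi> by metis
    qed
    show "direct_system K (\<phi> ` I) (map_prod \<phi> \<phi> ` r) (\<lambda>a. D (\<psi> a)) (\<lambda>a b. d (\<psi> a) (\<psi> b))"
      unfolding direct_system_def
    proof (intro conjI allI impI)
      show "\<forall>x \<in> map_prod \<phi> \<phi> ` r. case x of (a, b) \<Rightarrow> d (\<psi> a) (\<psi> b) \<in> Hom K (D (\<psi> a)) (D (\<psi> b))"
        using DS(7) rI \<psi> by fastforce
      show "\<And>a b c. (a, b) \<in> map_prod \<phi> \<phi> ` r \<and> (b, c) \<in> map_prod \<phi> \<phi> ` r \<Longrightarrow>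
          d (\<psi> b) (\<psi> c) \<cdot> d (\<psi> a) (\<psi> b) = d (\<psi> a) (\<psi> c)"
        by (elim conjE) (rule trans')
    qed (use pre DS \<psi> in auto)
    show "\<iota> (\<psi> b) \<cdot> d (\<psi> a) (\<psi> b) = \<iota> (\<psi> a)" if "(a, b) \<in> map_prod \<phi> \<phi> ` r" for a b
      using that DL(4) rI \<psi> by auto
    show "\<exists>u. u \<in> Hom K L M \<and> (\<forall>a \<in> \<phi> ` I. u \<cdot> \<iota> (\<psi> a) = \<mu> a)"
      if M: "M \<in> Obj K" "\<And>a. a \<in> \<phi> ` I \<Longrightarrow> \<mu> a \<in> Hom K (D (\<psi> a)) M"
        "\<And>a b. (a, b) \<in> map_prod \<phi> \<phi> ` r \<Longrightarrow> \<mu> b \<cdot> d (\<psi> a) (\<psi> b) = \<mu> a" for M \<mu>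
    proof -
      have "\<mu> (\<phi> i) \<in> Hom K (D i) M" if "i \<in> I" for i
        using M(2)[of "\<phi> i"] \<psi> that by simp
      moreover have "\<mu> (\<phi> j) \<cdot> d i j = \<mu> (\<phi> i)" if "(i, j) \<in> r" for i j
        using M(3)[of "\<phi> i" "\<phi> j"] \<psi> rI[OF that] r' that by simp
      ultimately obtain u where "u \<in> Hom K L M" "\<And>i. i \<in> I \<Longrightarrow> u \<cdot> \<iota> i = \<mu> (\<phi> i)"
        using direct_limit_copair[OF L M(1), of "\<lambda>i. \<mu> (\<phi> i)"] by blast
      then show ?thesis
        using \<psi> by auto
    qed
    show "u = v" if "u \<in> Hom K L M" "v \<in> Hom K L M" "\<And>a. a \<in> \<phi> ` I \<Longrightarrow> u \<cdot> \<iota> (\<psi> a) = v \<cdot> \<iota> (\<psi> a)" for M u v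
      using direct_limit_eqI[OF L that(1,2)] that(3) \<psi> by (metis imageI)
  qed (use DL \<psi> in auto)
qed

lemma direct_limit_isomorphic:
  assumes L: "is_direct_limit K I r D d C \<iota>" and iso: "isomorphic K C C'"
  obtains \<iota>' where "is_direct_limit K I r D d C' \<iota>'"
proof -
  note DL = direct_limitD[OF L] and DS = direct_systemD[OF direct_limitD(1)[OF L]]
  obtain u v where u: "u \<in> Hom K C C'" and v: "v \<in> Hom K C' C" and uv: "v \<cdot> u = Ide K C" "u \<cdot> v = Ide K C'"
    and C': "C' \<in> Obj K"
    using isomorphicE[OF iso] by metis
  have "is_direct_limit K I r D d C' (\<lambda>i. u \<cdot> \<iota> i)"
  proof (rule is_direct_limitI)
    show "u \<cdot> \<iota> i \<in> Hom K (D i) C'" if "i \<in> I" for i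
      using DL(3)[OF that] u by (auto simp: Hom_iff)
    show "(u \<cdot> \<iota> j) \<cdot> d i j = u \<cdot> \<iota> i" if ij: "(i, j) \<in> r" for i j
    proof -
      have "j \<in> I" using ij DS(1) by blast
      then show ?thesis
        using DL(4)[OF ij] DL(3)[of j] DS(7)[OF ij] u by (simp add: Hom_iff)
    qed
    show "a = b" if ab: "a \<in> Hom K C' M" "b \<in> Hom K C' M" and
      eq: "\<And>i. i \<in> I \<Longrightarrow> a \<cdot> u \<cdot> \<iota> i = b \<cdot> u \<cdot> \<iota> i" for M a b
    proof -
      have "a \<cdot> u = b \<cdot> u"
      proof (rule direct_limit_eqI[OF L])
        show "a \<cdot> u \<in> Hom K C M" "b \<cdot> u \<in> Hom K C M"
          using ab u by (auto simp: Hom_iff)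
        show "(a \<cdot> u) \<cdot> \<iota> i = (b \<cdot> u) \<cdot> \<iota> i" if "i \<in> I" for i
          using eq[OF that] ab u DL(3)[OF that] by (simp add: Hom_iff)
      qed
      then have "a \<cdot> u \<cdot> v = (b \<cdot> u) \<cdot> v"
        by (rule comp_rewrite) (use ab u v in \<open>auto simp: Hom_iff\<close>)
      then show ?thesis
        using ab u v uv(2) by (simp add: Hom_iff)
    qed
    show "\<exists>w. w \<in> Hom K C' M \<and> (\<forall>i \<in> I. w \<cdot> u \<cdot> \<iota> i = \<mu> i)"
      if M: "M \<in> Obj K" "\<And>i. i \<in> I \<Longrightarrow> \<mu> i \<in> Hom K (D i) M"
        "\<And>i j. (i, j) \<in> r \<Longrightarrow> \<mu> j \<cdot> d i j = \<mu> i" for M \<mu>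
    proof -
      obtain w where w: "w \<in> Hom K C M" "\<And>i. i \<in> I \<Longrightarrow> w \<cdot> \<iota> i = \<mu> i"
        using direct_limit_copair[OF L M] by blast
      have "(w \<cdot> v) \<cdot> u \<cdot> \<iota> i = \<mu> i" if "i \<in> I" for i
        using comp_rewrite[OF uv(1), of "\<iota> i"] w(2)[OF that] w(1) u v DL(3)[OF that] by (simp add: Hom_iff)
      moreover have "w \<cdot> v \<in> Hom K C' M"
        using w v by (auto simp: Hom_iff)
      ultimately show ?thesis by blast
    qed
  qed (rule DL(1), rule C')
  then show ?thesis
    using that by blast
qed

lemma direct_limits_ofI:
  assumes "small \<kappa> I" "\<And>i. i \<in> I \<Longrightarrow> D i \<in> X" "is_direct_limit K I r D d L \<iota>"
  shows "L \<in> direct_limits_of K \<kappa> X"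
proof -
  obtain \<phi> :: "_ \<Rightarrow> 'u" where \<phi>: "inj_on \<phi> I"
    using small_embedding[OF inacc assms(1)] by blast
  have "\<forall>a \<in> \<phi> ` I. D (inv_into I \<phi> a) \<in> X"
    using assms(2) inv_into_into[of _ \<phi> I] by blast
  moreover have "small \<kappa> (\<phi> ` I)"
    by (rule small_image[OF assms(1)])
  ultimately show ?thesis
    unfolding direct_limits_of_def using direct_limit_reindex[OF assms(3) \<phi>]
    by (intro CollectI exI conjI)
qed

section \<open>Finitely presentable objects\<close>

lemma finitely_presentable_obj: "finitely_presentable K \<kappa> S \<Longrightarrow> S \<in> Obj K"
  unfolding finitely_presentable_def by blast

text \<open>
  On the class of an arrow the canonical map can be evaluated at that arrow. Its surjectivity and
  injectivity then become the two factorization properties below; because arrows can be subtracted,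
  injectivity amounts to arrows that vanish in the limit vanishing at a later stage.
\<close>

lemma Hom_limit_map_class:
  assumes L: "is_direct_limit K I r D d L \<iota>" and i: "i \<in> I" and f: "f \<in> Hom K S (D i)"
  defines "Q \<equiv> {((i, f), (j, g)). f \<in> Hom K S (D i) \<and> g \<in> Hom K S (D j) \<and>
          (\<exists>k. (i, k) \<in> r \<and> (j, k) \<in> r \<and> d i k \<cdot> f = d j k \<cdot> g)}"
  shows "Q `` {(i, f)} \<in> Hom_limit K S I r D d" "Hom_limit_map K \<iota> (Q `` {(i, f)}) = \<iota> i \<cdot> f"
    "(i, f) \<in> Q `` {(i, f)}"
proof -
  note DL = direct_limitD[OF L] and DS = direct_systemD[OF direct_limitD(1)[OF L]]
  show "Q `` {(i, f)} \<in> Hom_limit K S I r D d"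
    unfolding Hom_limit_def Q_def quotient_def using i f by blast
  show self: "(i, f) \<in> Q `` {(i, f)}"
    unfolding Q_def using DS(2)[OF i] f by blast
  have "\<iota> j \<cdot> g = \<iota> i \<cdot> f" if jg: "(j, g) \<in> Q `` {(i, f)}" for j g
  proof -
    obtain k where k: "g \<in> Hom K S (D j)" "(i, k) \<in> r" "(j, k) \<in> r" "d i k \<cdot> f = d j k \<cdot> g"
      using jg unfolding Q_def by blast
    have h: "d i k \<in> Hom K (D i) (D k)" "d j k \<in> Hom K (D j) (D k)" "\<iota> k \<in> Hom K (D k) L"
      using k DS(1,7) DL(3) by blast+
    have "\<iota> k \<cdot> d i k \<cdot> f = \<iota> i \<cdot> f"
      by (rule comp_rewrite[OF DL(4)[OF k(2)]]) (use h f in \<open>auto simp: Hom_iff\<close>)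
    moreover have "\<iota> k \<cdot> d j k \<cdot> g = \<iota> j \<cdot> g"
      by (rule comp_rewrite[OF DL(4)[OF k(3)]]) (use h k in \<open>auto simp: Hom_iff\<close>)
    ultimately show ?thesis
      using k(4) by simp
  qed
  note stage = this
  have "(\<lambda>(j, g). \<iota> j \<cdot> g) ` (Q `` {(i, f)}) = {\<iota> i \<cdot> f}"
  proof (intro equalityI subsetI)
    fix x assume "x \<in> (\<lambda>(j, g). \<iota> j \<cdot> g) ` (Q `` {(i, f)})"
    then obtain y where "y \<in> Q `` {(i, f)}" "x = \<iota> (fst y) \<cdot> snd y"
      by (auto simp: case_prod_unfold)
    moreover then have "(fst y, snd y) \<in> Q `` {(i, f)}"
      by simp
    ultimately show "x \<in> {\<iota> i \<cdot> f}"
      using stage(1) by blast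
  next
    fix x assume "x \<in> {\<iota> i \<cdot> f}"
    then show "x \<in> (\<lambda>(j, g). \<iota> j \<cdot> g) ` (Q `` {(i, f)})"
      by (intro image_eqI[OF _ self]) simp
  qed
  then show "Hom_limit_map K \<iota> (Q `` {(i, f)}) = \<iota> i \<cdot> f"
    unfolding Hom_limit_map_def by simp
qed

lemma finitely_presentable_factor:
  assumes S: "finitely_presentable K \<kappa> S" and I: "small \<kappa> I" and L: "is_direct_limit K I r D d L \<iota>"
    and f: "f \<in> Hom K S L"
  obtains i g where "i \<in> I" "g \<in> Hom K S (D i)" "\<iota> i \<cdot> g = f"
proof -
  obtain \<phi> :: "_ \<Rightarrow> 'u" where \<phi>: "inj_on \<phi> I"
    using small_embedding[OF inacc I] by blast
  define \<psi> where "\<psi> = inv_into I \<phi>"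
  note L' = direct_limit_reindex[OF L \<phi>, folded \<psi>_def]
  have "bij_betw (Hom_limit_map K (\<lambda>a. \<iota> (\<psi> a)))
      (Hom_limit K S (\<phi> ` I) (map_prod \<phi> \<phi> ` r) (\<lambda>a. D (\<psi> a)) (\<lambda>a b. d (\<psi> a) (\<psi> b))) (Hom K S L)"
    using S small_image[OF I] L' unfolding finitely_presentable_def by blast
  then obtain c where c: "c \<in> Hom_limit K S (\<phi> ` I) (map_prod \<phi> \<phi> ` r) (\<lambda>a. D (\<psi> a)) (\<lambda>a b. d (\<psi> a) (\<psi> b))"
    "f = Hom_limit_map K (\<lambda>a. \<iota> (\<psi> a)) c"
    using f unfolding bij_betw_def by blast
  then obtain a g where ag: "a \<in> \<phi> ` I" "g \<in> Hom K S (D (\<psi> a))" "f = \<iota> (\<psi> a) \<cdot> g"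
    using Hom_limit_map_class(2)[OF L'] unfolding Hom_limit_def quotient_def by force
  then have "\<psi> a \<in> I"
    unfolding \<psi>_def using inv_into_into by metis
  then show ?thesis
    using that ag by blast
qed

lemma finitely_presentable_zero:
  assumes S: "finitely_presentable K \<kappa> S" and I: "small \<kappa> I" and L: "is_direct_limit K I r D d L \<iota>"
    and i: "i \<in> I" and f: "f \<in> Hom K S (D i)" and zero: "\<iota> i \<cdot> f = Zero K S L"
  obtains j where "(i, j) \<in> r" "d i j \<cdot> f = Zero K S (D j)"
proof -
  note DL = direct_limitD[OF L] and DS = direct_systemD[OF direct_limitD(1)[OF L]]
  obtain \<phi> :: "_ \<Rightarrow> 'u" where \<phi>: "inj_on \<phi> I"
    using small_embedding[OF inacc I] by blast
  define \<psi> where "\<psi> = inv_into I \<phi>"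
  have \<psi>: "\<psi> (\<phi> i) = i" if "i \<in> I" for i
    unfolding \<psi>_def using inv_into_f_f[OF \<phi> that] .
  define r' where "r' = map_prod \<phi> \<phi> ` r"
  note L' = direct_limit_reindex[OF L \<phi>, folded \<psi>_def r'_def]
  have S_obj: "S \<in> Obj K"
    using finitely_presentable_obj[OF S] .
  have h: "\<phi> i \<in> \<phi> ` I" "f \<in> Hom K S (D (\<psi> (\<phi> i)))" "Zero K S (D i) \<in> Hom K S (D (\<psi> (\<phi> i)))"
    using i f \<psi> S_obj DS(6) by (auto simp: Hom_iff)
  note cf = Hom_limit_map_class[OF L' h(1,2)] and cz = Hom_limit_map_class[OF L' h(1,3)]
  have "inj_on (Hom_limit_map K (\<lambda>a. \<iota> (\<psi> a)))
      (Hom_limit K S (\<phi> ` I) r' (\<lambda>a. D (\<psi> a)) (\<lambda>a b. d (\<psi> a) (\<psi> b)))"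
    using S small_image[OF I] L' unfolding finitely_presentable_def bij_betw_def by blast
  from inj_onD[OF this _ cf(1) cz(1)] cf(2) cz(2)
  have "(\<phi> i, Zero K S (D i)) \<in> {((i, f), (j, g)). f \<in> Hom K S (D (\<psi> i)) \<and> g \<in> Hom K S (D (\<psi> j)) \<and>
          (\<exists>k. (i, k) \<in> r' \<and> (j, k) \<in> r' \<and> d (\<psi> i) (\<psi> k) \<cdot> f = d (\<psi> j) (\<psi> k) \<cdot> g)} `` {(\<phi> i, f)}"
    using cz(3) zero \<psi>[OF i] DL(3)[OF i] S_obj DS(6)[OF i] by (simp add: Hom_iff)
  then obtain a where a: "(\<phi> i, a) \<in> r'" "d i (\<psi> a) \<cdot> f = d i (\<psi> a) \<cdot> Zero K S (D i)"
    using \<psi>[OF i] by auto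
  obtain i' j where ij: "\<phi> i = \<phi> i'" "a = \<phi> j" "(i', j) \<in> r"
    using a(1) unfolding r'_def by auto
  then have j: "(i, j) \<in> r" "\<psi> a = j"
    using inj_onD[OF \<phi> ij(1)] DS(1) i \<psi> by auto
  have "d i j \<cdot> f = Zero K S (D j)"
    using a(2) DS(7)[OF j(1)] S_obj unfolding j(2) by (simp add: Hom_iff)
  then show ?thesis
    using that j by blast
qed

text \<open>
  The finite subfamilies \<open>F\<close> of a jointly epic family form a directed poset, and the direct limit
  of their joint cokernels is \<open>0\<close>. So the composite of \<open>f\<close> with the projection to the cokernel
  vanishes at some finite stage.
\<close>

lemma finitely_presentable_finite_subfamily:
  assumes S: "finitely_presentable K \<kappa> S" and f: "f \<in> Hom K S M"
    and \<Gamma>: "small \<kappa> \<Gamma>" "\<And>g. g \<in> \<Gamma> \<Longrightarrow> g \<in> Hom K (Dom K g) M"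
    and jointly_epic: "\<And>N t. t \<in> Hom K M N \<Longrightarrow> (\<And>g. g \<in> \<Gamma> \<Longrightarrow> t \<cdot> g = Zero K (Dom K g) N) \<Longrightarrow> t = Zero K M N"
  obtains F where "finite F" "F \<subseteq> \<Gamma>"
    "\<And>N t. t \<in> Hom K M N \<Longrightarrow> (\<And>g. g \<in> F \<Longrightarrow> t \<cdot> g = Zero K (Dom K g) N) \<Longrightarrow> t \<cdot> f = Zero K S N"
proof -
  have M: "M \<in> Obj K" using f hom_objs by blast
  define I where "I = {F. F \<subseteq> \<Gamma> \<and> finite F}"
  define r where "r = {(F, F'). F \<in> I \<and> F' \<in> I \<and> F \<subseteq> F'}"
  have I: "small \<kappa> I"
    by (rule small_subset[OF small_Pow[OF inacc \<Gamma>(1)]]) (auto simp: I_def)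
  have "\<exists>C c. joint_cokernel F M C c" if "F \<in> I" for F
  proof -
    have "F \<subseteq> \<Gamma>" using that unfolding I_def by blast
    then have "small \<kappa> F" "\<And>g. g \<in> F \<Longrightarrow> g \<in> Hom K (Dom K g) M"
      using small_subset[OF \<Gamma>(1)] \<Gamma>(2) by auto
    from joint_cokernel_exists[OF this M] show ?thesis
      by metis
  qed
  then obtain C c where "\<forall>F \<in> I. joint_cokernel F M (C F) (c F)"
    by metis
  then have c: "c F \<in> Hom K M (C F)" "epic K (c F)" "\<And>g. g \<in> F \<Longrightarrow> c F \<cdot> g = Zero K (Dom K g) (C F)"
    and c_desc: "\<And>N h. h \<in> Hom K M N \<Longrightarrow> (\<forall>g\<in>F. h \<cdot> g = Zero K (Dom K g) N) \<Longrightarrow> \<exists>u \<in> Hom K (C F) N. u \<cdot> c F = h"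
    if "F \<in> I" for F
  proof -
    have *: "joint_cokernel F M (C F) (c F)"
      using \<open>\<forall>F \<in> I. joint_cokernel F M (C F) (c F)\<close> that by blast
    show "c F \<in> Hom K M (C F)" "epic K (c F)" "\<And>g. g \<in> F \<Longrightarrow> c F \<cdot> g = Zero K (Dom K g) (C F)"
      "\<And>N h. h \<in> Hom K M N \<Longrightarrow> (\<forall>g\<in>F. h \<cdot> g = Zero K (Dom K g) N) \<Longrightarrow> \<exists>u \<in> Hom K (C F) N. u \<cdot> c F = h"
      using * unfolding joint_cokernel_def by blast+
  qed
  have "\<exists>u. u \<in> Hom K (C F) (C F') \<and> u \<cdot> c F = c F'" if "(F, F') \<in> r" for F F'
    using c_desc[of F "c F'" "C F'"] c[of F'] that unfolding r_def by blast
  then obtain d where d: "\<And>F F'. (F, F') \<in> r \<Longrightarrow> d F F' \<in> Hom K (C F) (C F') \<and> d F F' \<cdot> c F = c F'"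
    by metis
  have C: "C F \<in> Obj K" if "F \<in> I" for F
    using c(1)[OF that] hom_objs by blast
  have poset: "directed_poset I r"
  proof -
    have "{} \<in> I" unfolding I_def by blast
    moreover have "\<exists>k\<in>I. (F, k) \<in> r \<and> (F', k) \<in> r" if "F \<in> I" "F' \<in> I" for F F'
      using that by (intro bexI[of _ "F \<union> F'"]) (auto simp: I_def r_def)
    moreover have "partial_order_on I r"
      by (auto simp: order_on_defs refl_on_def trans_def antisym_def r_def)
    ultimately show ?thesis
      unfolding directed_poset_def by blast
  qed
  have sys: "direct_system K I r C d"
    unfolding direct_system_def
  proof (intro conjI ballI allI impI)
    show "d F F = Ide K (C F)" if "F \<in> I" for F
      by (rule epic_cancel[OF c(2,1)[OF that], of _ "C F"])
        (use d[of F F] that C[OF that] c(1)[OF that] in \<open>auto simp: r_def Hom_iff\<close>)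
    fix F F' F'' assume F: "(F, F') \<in> r \<and> (F', F'') \<in> r"
    then have I': "F \<in> I" "F' \<in> I" "F'' \<in> I" "(F, F'') \<in> r"
      unfolding r_def by auto
    have dF: "d F F' \<in> Hom K (C F) (C F')" "d F' F'' \<in> Hom K (C F') (C F'')" "d F F'' \<in> Hom K (C F) (C F'')"
      and dc: "d F F' \<cdot> c F = c F'" "d F' F'' \<cdot> c F' = c F''" "d F F'' \<cdot> c F = c F''"
      using d F I'(4) by blast+
    have "(d F' F'' \<cdot> d F F') \<cdot> c F = d F' F'' \<cdot> d F F' \<cdot> c F"
      using dF c(1)[OF I'(1)] by (simp add: Hom_iff)
    then have "(d F' F'' \<cdot> d F F') \<cdot> c F = d F F'' \<cdot> c F"
      unfolding dc .
    then show "d F' F'' \<cdot> d F F' = d F F''"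
      using epic_cancel[OF c(2,1)[OF I'(1)] Comp_Hom[OF dF(1,2)] dF(3)] by blast
  qed (use poset C d in auto)
  obtain Z where Z: "is_zero_object K Z"
    using zero_object by blast
  then have Z_obj: "Z \<in> Obj K" unfolding is_zero_object_def by blast
  have "is_direct_limit K I r C d Z (\<lambda>F. Zero K (C F) Z)"
  proof (rule is_direct_limitI)
    show "Zero K (C F') Z \<cdot> d F F' = Zero K (C F) Z" if "(F, F') \<in> r" for F F'
      using d[OF that] C that Z_obj unfolding r_def by (auto simp: Hom_iff)
    show "u = v" if "u \<in> Hom K Z N" "v \<in> Hom K Z N" for N u v
    proof -
      have "N \<in> Obj K" using that hom_objs by blast
      then show ?thesis
        using Z that(1,2) unfolding is_zero_object_def by blast
    qed
    show "\<exists>u. u \<in> Hom K Z N \<and> (\<forall>F \<in> I. u \<cdot> Zero K (C F) Z = \<mu> F)"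
      if N: "N \<in> Obj K" "\<And>F. F \<in> I \<Longrightarrow> \<mu> F \<in> Hom K (C F) N"
        "\<And>F F'. (F, F') \<in> r \<Longrightarrow> \<mu> F' \<cdot> d F F' = \<mu> F" for N \<mu>
    proof -
      have empty: "{} \<in> I" unfolding I_def by blast
      \<comment> \<open>A cocone is an arrow from \<open>M\<close> that factors through every joint cokernel, so it kills all of \<open>\<Gamma>\<close>.\<close>
      define t where "t = \<mu> {} \<cdot> c {}"
      have t: "t \<in> Hom K M N"
        unfolding t_def using N(2)[OF empty] c(1)[OF empty] by (auto simp: Hom_iff)
      have t_eq: "\<mu> F \<cdot> c F = t" if "F \<in> I" for F
      proof -
        have F: "({}, F) \<in> r"
          unfolding r_def using that empty by blast
        have "\<mu> F \<cdot> d {} F \<cdot> c {} = \<mu> {} \<cdot> c {}"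
          by (rule comp_rewrite[OF N(3)[OF F]])
            (use d[OF F] N(2)[OF that] c(1)[OF empty] in \<open>auto simp: Hom_iff\<close>)
        then show ?thesis
          unfolding t_def using d[OF F] by simp
      qed
      have "t \<cdot> g = Zero K (Dom K g) N" if g: "g \<in> \<Gamma>" for g
      proof -
        have F: "{g} \<in> I" using g unfolding I_def by blast
        have "\<mu> {g} \<cdot> c {g} \<cdot> g = t \<cdot> g"
          by (rule comp_rewrite[OF t_eq[OF F]])
            (use N(2)[OF F] c(1)[OF F] \<Gamma>(2)[OF g] in \<open>auto simp: Hom_iff\<close>)
        then show ?thesis
          using c(3)[OF F, of g] N(2)[OF F] \<Gamma>(2)[OF g] hom_objs[OF \<Gamma>(2)[OF g]] by (simp add: Hom_iff)
      qed
      then have "t = Zero K M N"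
        using jointly_epic[OF t] by blast
      then have "\<mu> F = Zero K (C F) N" if "F \<in> I" for F
        using epic_cancel_zero[OF c(2,1)[OF that] N(2)[OF that]] t_eq[OF that] by simp
      then show ?thesis
        by (intro exI[of _ "Zero K Z N"]) (use Z_obj N(1) C in \<open>auto simp: Hom_iff\<close>)
    qed
  qed (use sys Z_obj C in \<open>auto simp: Hom_iff\<close>)
  moreover have empty: "{} \<in> I" unfolding I_def by blast
  moreover have cf: "c {} \<cdot> f \<in> Hom K S (C {})"
    using c(1)[OF empty] f by (auto simp: Hom_iff)
  moreover have "Zero K (C {}) Z \<cdot> c {} \<cdot> f = Zero K S Z"
    using cf Z_obj by (auto simp: Hom_iff)
  ultimately obtain F where F: "({}, F) \<in> r" "d {} F \<cdot> c {} \<cdot> f = Zero K S (C F)"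
    using finitely_presentable_zero[OF S I] by blast
  have FI: "F \<in> I" using F unfolding r_def by blast
  have "d {} F \<cdot> c {} \<cdot> f = c F \<cdot> f"
    by (rule comp_rewrite) (use d[OF F(1)] c(1)[OF empty] f in \<open>auto simp: Hom_iff\<close>)
  then have cF: "c F \<cdot> f = Zero K S (C F)"
    using F by simp
  show ?thesis
  proof (rule that)
    show "finite F" "F \<subseteq> \<Gamma>" using FI unfolding I_def by auto
    fix N t
    assume t: "t \<in> Hom K M N" "\<And>g. g \<in> F \<Longrightarrow> t \<cdot> g = Zero K (Dom K g) N"
    then obtain u where u: "u \<in> Hom K (C F) N" "u \<cdot> c F = t"
      using c_desc[OF FI] by blast
    have "u \<cdot> c F \<cdot> f = t \<cdot> f"
      by (rule comp_rewrite[OF u(2)]) (use u c(1)[OF FI] f in \<open>auto simp: Hom_iff\<close>)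
    then show "t \<cdot> f = Zero K S N"
      using cF u finitely_presentable_obj[OF S] by (auto simp: Hom_iff)
  qed
qed

end

section \<open>Factoring through finitely presentable objects\<close>

text \<open>
  In the application \<open>X\<close> is \<open>S \<union> T\<close>.
\<close>

locale presentable_class = grothendieck_universe \<kappa> K
  for \<kappa> :: "'u rel" and K :: "('o, 'm) precat" (structure) +
  fixes X :: "'o set"
  assumes finitely_presentable: "S \<in> X \<Longrightarrow> finitely_presentable K \<kappa> S"
    and small_generators: "\<exists>G \<subseteq> X. small \<kappa> G \<and> generating K G"
    and extensions: "closed_extensions K X"
    and kernels_of_epis: "closed_kernels_of_epis K X"
begin

lemma X_obj: "S \<in> X \<Longrightarrow> S \<in> Obj K"
  using finitely_presentable finitely_presentable_obj by blast

lemma X_zero: "is_zero_object K Z \<Longrightarrow> Z \<in> X"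
  using extensions unfolding closed_extensions_def by blast

lemma X_extension:
  assumes "short_exact K f g" "f \<in> Hom K A B" "g \<in> Hom K B C" "A \<in> X" "C \<in> X"
  shows "B \<in> X"
  using extensions assms unfolding closed_extensions_def by (auto simp: Hom_iff)

lemma X_kernel:
  assumes "epic K g" "g \<in> Hom K B C" "is_kernel K k g" "k \<in> Hom K A B" "B \<in> X" "C \<in> X"
  shows "A \<in> X"
  using kernels_of_epis assms unfolding closed_kernels_of_epis_def by (auto simp: Hom_iff)

lemma X_biproduct:
  assumes P: "biproduct A B P i p j q" and "A \<in> X" "B \<in> X"
  shows "P \<in> X"
  using X_extension[OF biproduct_short_exact[OF P]] biproductD[OF P] assms(2,3) by blast

text \<open>
  The intrinsic form of being a direct limit of objects of \<open>X\<close>.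
\<close>

definition factoring :: "'o \<Rightarrow> bool" where
  "factoring L \<longleftrightarrow> L \<in> Obj K \<and>
     (\<forall>S\<^sub>0 \<in> X. \<forall>S\<^sub>1 \<in> X. \<forall>p \<in> Hom K S\<^sub>0 S\<^sub>1. \<forall>f \<in> Hom K S\<^sub>1 L. f \<cdot> p = Zero K S\<^sub>0 L \<longrightarrow>
        (\<exists>S\<^sub>2 \<in> X. \<exists>g \<in> Hom K S\<^sub>1 S\<^sub>2. \<exists>f' \<in> Hom K S\<^sub>2 L. f' \<cdot> g = f \<and> g \<cdot> p = Zero K S\<^sub>0 S\<^sub>2))"

lemma factoring_obj: "factoring L \<Longrightarrow> L \<in> Obj K"
  unfolding factoring_def by blast

lemma factoringE:
  assumes "factoring L" "S\<^sub>0 \<in> X" "S\<^sub>1 \<in> X" "p \<in> Hom K S\<^sub>0 S\<^sub>1" "f \<in> Hom K S\<^sub>1 L" "f \<cdot> p = Zero K S\<^sub>0 L"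
  obtains S\<^sub>2 g f' where "S\<^sub>2 \<in> X" "g \<in> Hom K S\<^sub>1 S\<^sub>2" "f' \<in> Hom K S\<^sub>2 L" "f' \<cdot> g = f" "g \<cdot> p = Zero K S\<^sub>0 S\<^sub>2"
  using assms unfolding factoring_def by blast

lemma factoringI:
  assumes "L \<in> Obj K"
    and "\<And>S\<^sub>0 S\<^sub>1 p f. S\<^sub>0 \<in> X \<Longrightarrow> S\<^sub>1 \<in> X \<Longrightarrow> p \<in> Hom K S\<^sub>0 S\<^sub>1 \<Longrightarrow> f \<in> Hom K S\<^sub>1 L \<Longrightarrow> f \<cdot> p = Zero K S\<^sub>0 L \<Longrightarrow>
      \<exists>S\<^sub>2 g f'. S\<^sub>2 \<in> X \<and> g \<in> Hom K S\<^sub>1 S\<^sub>2 \<and> f' \<in> Hom K S\<^sub>2 L \<and> f' \<cdot> g = f \<and> g \<cdot> p = Zero K S\<^sub>0 S\<^sub>2"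
  shows "factoring L"
  using assms unfolding factoring_def by blast

lemma factoring_X:
  assumes "S \<in> X"
  shows "factoring S"
proof (rule factoringI)
  fix S0 S1 p f
  assume f: "f \<in> Hom K S1 S" "f \<cdot> p = Zero K S0 S"
  show "\<exists>S2 g f'. S2 \<in> X \<and> g \<in> Hom K S1 S2 \<and> f' \<in> Hom K S2 S \<and> f' \<cdot> g = f \<and> g \<cdot> p = Zero K S0 S2"
    by (intro exI[of _ S] exI[of _ f] exI[of _ "Ide K S"]) (use f assms X_obj[OF assms] in \<open>auto simp: Hom_iff\<close>)
qed (rule X_obj[OF assms])

lemma factoring_isomorphic:
  assumes A: "factoring A" and iso: "isomorphic K A B"
  shows "factoring B"
proof -
  obtain u v where u: "u \<in> Hom K A B" and v: "v \<in> Hom K B A" and uv: "v \<cdot> u = Ide K A" "u \<cdot> v = Ide K B"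
    and ob: "A \<in> Obj K" "B \<in> Obj K"
    using isomorphicE[OF iso] by metis
  show ?thesis
  proof (rule factoringI[OF ob(2)])
    fix S0 S1 p f
    assume h: "S0 \<in> X" "S1 \<in> X" "p \<in> Hom K S0 S1" "f \<in> Hom K S1 B" "f \<cdot> p = Zero K S0 B"
    have vf: "v \<cdot> f \<in> Hom K S1 A" "(v \<cdot> f) \<cdot> p = Zero K S0 A"
      using h v X_obj[OF h(1)] by (auto simp: Hom_iff)
    obtain S2 g f' where g: "S2 \<in> X" "g \<in> Hom K S1 S2" "f' \<in> Hom K S2 A" "f' \<cdot> g = v \<cdot> f"
      "g \<cdot> p = Zero K S0 S2"
      using factoringE[OF A h(1,2,3) vf] by blast
    have "(u \<cdot> f') \<cdot> g = f"
      using g u v h comp_rewrite[OF uv(2), of f] by (simp add: Hom_iff)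
    moreover have "u \<cdot> f' \<in> Hom K S2 B"
      using g u by (auto simp: Hom_iff)
    ultimately show "\<exists>S2 g f'. S2 \<in> X \<and> g \<in> Hom K S1 S2 \<and> f' \<in> Hom K S2 B \<and> f' \<cdot> g = f \<and> g \<cdot> p = Zero K S0 S2"
      using g by blast
  qed
qed

text \<open>
  Both \<open>f\<close> and the relation \<open>f p = 0\<close> descend to a stage of the direct system, by finite presentability
  of \<open>S\<^sub>1\<close> and \<open>S\<^sub>0\<close> respectively; there the factoring property of that stage applies.
\<close>

lemma factoring_direct_limit:
  assumes I: "small \<kappa> I" and L: "is_direct_limit K I r D d L \<iota>" and D: "\<And>i. i \<in> I \<Longrightarrow> factoring (D i)"
  shows "factoring L"
proof (rule factoringI)
  note DL = direct_limitD[OF L] and DS = direct_systemD[OF direct_limitD(1)[OF L]]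
  show "L \<in> Obj K" by (rule DL(2))
  fix S0 S1 p f
  assume h: "S0 \<in> X" "S1 \<in> X" "p \<in> Hom K S0 S1" "f \<in> Hom K S1 L" "f \<cdot> p = Zero K S0 L"
  obtain i f1 where i: "i \<in> I" and f1: "f1 \<in> Hom K S1 (D i)" "\<iota> i \<cdot> f1 = f"
    using finitely_presentable_factor[OF finitely_presentable[OF h(2)] I L h(4)] by blast
  have f1p: "f1 \<cdot> p \<in> Hom K S0 (D i)" "\<iota> i \<cdot> f1 \<cdot> p = Zero K S0 L"
    using f1 h comp_rewrite[OF f1(2), of p] DL(3)[OF i] by (auto simp: Hom_iff)
  obtain j where j: "(i, j) \<in> r" "d i j \<cdot> f1 \<cdot> p = Zero K S0 (D j)"
    using finitely_presentable_zero[OF finitely_presentable[OF h(1)] I L i f1p] by blast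
  have jI: "j \<in> I" and dij: "d i j \<in> Hom K (D i) (D j)"
    using DS(1,7) j by blast+
  have f2: "d i j \<cdot> f1 \<in> Hom K S1 (D j)" "(d i j \<cdot> f1) \<cdot> p = Zero K S0 (D j)"
    using dij f1 h j by (auto simp: Hom_iff)
  obtain S2 g f' where g: "S2 \<in> X" "g \<in> Hom K S1 S2" "f' \<in> Hom K S2 (D j)" "f' \<cdot> g = d i j \<cdot> f1"
      "g \<cdot> p = Zero K S0 S2"
    using factoringE[OF D[OF jI] h(1,2,3) f2] by blast
  have "\<iota> j \<cdot> d i j \<cdot> f1 = \<iota> i \<cdot> f1"
    by (rule comp_rewrite[OF DL(4)[OF j(1)]]) (use dij f1 DL(3)[OF jI] in \<open>auto simp: Hom_iff\<close>)
  then have "(\<iota> j \<cdot> f') \<cdot> g = f"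
    using g f1 DL(3)[OF jI] by (simp add: Hom_iff)
  moreover have "\<iota> j \<cdot> f' \<in> Hom K S2 L"
    using g DL(3)[OF jI] by (auto simp: Hom_iff)
  ultimately show "\<exists>S2 g f'. S2 \<in> X \<and> g \<in> Hom K S1 S2 \<and> f' \<in> Hom K S2 L \<and> f' \<cdot> g = f \<and> g \<cdot> p = Zero K S0 S2"
    using g by blast
qed

text \<open>
  The arrows from generators to \<open>S\<close> that lift to \<open>B\<close> after composition with \<open>s\<close> are jointly epic, and \<open>S\<close> is
  finitely presentable, so finitely many of them suffice; \<open>Q\<close> is the direct sum of their domains and \<open>S1\<close>. Adding
  \<open>S1\<close> makes \<open>l\<close> restrict to the given lift \<open>f\<close> along \<open>j\<close>; two unrelated lifts would agree only up to an arrow to the kernel of \<open>e\<close>.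
\<close>

lemma lift_over_epic:
  assumes e: "epic K e" "e \<in> Hom K B C" and S: "S \<in> X" and s: "s \<in> Hom K S C"
    and S1: "S1 \<in> X" and f: "f \<in> Hom K S1 B" and g: "g \<in> Hom K S1 S" and eq: "e \<cdot> f = s \<cdot> g"
  obtains Q \<epsilon> l j where "Q \<in> X" "epic K \<epsilon>" "\<epsilon> \<in> Hom K Q S" "l \<in> Hom K Q B" "e \<cdot> l = s \<cdot> \<epsilon>"
    "j \<in> Hom K S1 Q" "\<epsilon> \<cdot> j = g" "l \<cdot> j = f"
proof -
  obtain G where G: "G \<subseteq> X" "small \<kappa> G" "generating K G"
    using small_generators by blast
  define \<Gamma> where "\<Gamma> = {a. \<exists>Y \<in> G. a \<in> Hom K Y S \<and> (\<exists>b \<in> Hom K Y B. e \<cdot> b = s \<cdot> a)}"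
  have \<Gamma>_hom: "a \<in> Hom K (Dom K a) S" "Dom K a \<in> X" if "a \<in> \<Gamma>" for a
    using that G(1) unfolding \<Gamma>_def by (auto simp: Hom_iff)
  have "small \<kappa> (\<Union>Y\<in>G. Hom K Y S)"
    by (rule small_UN[OF inacc G(2)]) (rule small_Hom)
  then have "small \<kappa> \<Gamma>"
    by (rule small_subset) (auto simp: \<Gamma>_def)
  moreover have "Ide K S \<in> Hom K S S"
    using X_obj[OF S] by (simp add: Hom_iff)
  moreover have "t = Zero K S N" if t: "t \<in> Hom K S N" "\<And>a. a \<in> \<Gamma> \<Longrightarrow> t \<cdot> a = Zero K (Dom K a) N" for N t
  proof (rule lifting_arrows_jointly_epic[OF e s t(1) G(3)])
    fix Y a b assume a: "Y \<in> G" "a \<in> Hom K Y S" "b \<in> Hom K Y B" "e \<cdot> b = s \<cdot> a"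
    then have "a \<in> \<Gamma>"
      unfolding \<Gamma>_def by blast
    then show "t \<cdot> a = Zero K Y N"
      using t(2)[of a] a(2) by (simp add: Hom_iff)
  qed
  ultimately obtain F where F: "finite F" "F \<subseteq> \<Gamma>"
    and F_epic: "\<And>N t. t \<in> Hom K S N \<Longrightarrow> (\<And>a. a \<in> F \<Longrightarrow> t \<cdot> a = Zero K (Dom K a) N) \<Longrightarrow> t \<cdot> Ide K S = Zero K S N"
    using finitely_presentable_finite_subfamily[OF finitely_presentable[OF S], of "Ide K S" S \<Gamma>] \<Gamma>_hom(1)
    by metis
  have "\<exists>Q \<epsilon> l j. Q \<in> X \<and> \<epsilon> \<in> Hom K Q S \<and> l \<in> Hom K Q B \<and> e \<cdot> l = s \<cdot> \<epsilon> \<and>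
      j \<in> Hom K S1 Q \<and> \<epsilon> \<cdot> j = g \<and> l \<cdot> j = f \<and> (\<forall>a \<in> F. \<exists>b \<in> Hom K (Dom K a) Q. \<epsilon> \<cdot> b = a)"
    using F
  proof (induction F rule: finite_induct)
    case empty
    show ?case
      by (intro exI[of _ S1] exI[of _ g] exI[of _ f] exI[of _ "Ide K S1"])
        (use S1 X_obj[OF S1] f g eq in \<open>auto simp: Hom_iff\<close>)
  next
    case (insert a F)
    obtain Q \<epsilon> l j where Q: "Q \<in> X" "\<epsilon> \<in> Hom K Q S" "l \<in> Hom K Q B" "e \<cdot> l = s \<cdot> \<epsilon>"
      "j \<in> Hom K S1 Q" "\<epsilon> \<cdot> j = g" "l \<cdot> j = f"
      and QF: "\<And>a. a \<in> F \<Longrightarrow> \<exists>b \<in> Hom K (Dom K a) Q. \<epsilon> \<cdot> b = a"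
      using insert by auto
    obtain b where Y: "Dom K a \<in> X" "a \<in> Hom K (Dom K a) S" "b \<in> Hom K (Dom K a) B" "e \<cdot> b = s \<cdot> a"
      using insert(4) G(1) unfolding \<Gamma>_def by (auto simp: Hom_iff)
    obtain P i1 p1 i2 p2 where P: "biproduct Q (Dom K a) P i1 p1 i2 p2"
      using biproduct_exists X_obj Q(1) Y(1) by blast
    note D = biproductD[OF P]
    obtain \<epsilon>' where \<epsilon>': "\<epsilon>' \<in> Hom K P S" "\<epsilon>' \<cdot> i1 = \<epsilon>" "\<epsilon>' \<cdot> i2 = a"
      using biproduct_copair[OF P Q(2) Y(2)] by blast
    obtain l' where l': "l' \<in> Hom K P B" "l' \<cdot> i1 = l" "l' \<cdot> i2 = b"
      using biproduct_copair[OF P Q(3) Y(3)] by blast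
    have el': "e \<cdot> l' = s \<cdot> \<epsilon>'"
      by (rule biproduct_eqI[OF P, of _ C]) (use l' \<epsilon>' e s D Q(4) Y(4) in \<open>auto simp: Hom_iff\<close>)
    have j': "i1 \<cdot> j \<in> Hom K S1 P" "\<epsilon>' \<cdot> i1 \<cdot> j = g" "l' \<cdot> i1 \<cdot> j = f"
      using comp_rewrite[OF \<epsilon>'(2), of j] comp_rewrite[OF l'(2), of j] \<epsilon>' l' Q D by (auto simp: Hom_iff)
    have "\<exists>b \<in> Hom K (Dom K a') P. \<epsilon>' \<cdot> b = a'" if a': "a' \<in> insert a F" for a'
    proof (cases "a' = a")
      case True
      then show ?thesis using \<epsilon>' D by blast
    next
      case False
      then obtain b where b: "b \<in> Hom K (Dom K a') Q" "\<epsilon> \<cdot> b = a'"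
        using QF a' by blast
      have "i1 \<cdot> b \<in> Hom K (Dom K a') P" "\<epsilon>' \<cdot> i1 \<cdot> b = a'"
        using comp_rewrite[OF \<epsilon>'(2), of b] \<epsilon>' b D by (auto simp: Hom_iff)
      then show ?thesis by blast
    qed
    then show ?case
      using X_biproduct[OF P Q(1) Y(1)] \<epsilon>'(1) l'(1) el' j' by blast
  qed
  then obtain Q \<epsilon> l j where Q: "Q \<in> X" "\<epsilon> \<in> Hom K Q S" "l \<in> Hom K Q B" "e \<cdot> l = s \<cdot> \<epsilon>"
      "j \<in> Hom K S1 Q" "\<epsilon> \<cdot> j = g" "l \<cdot> j = f"
    and QF: "\<And>a. a \<in> F \<Longrightarrow> \<exists>b \<in> Hom K (Dom K a) Q. \<epsilon> \<cdot> b = a"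
    by blast
  have "epic K \<epsilon>"
  proof (rule epicI)
    show "\<epsilon> \<in> Arr K" using Q by (simp add: Hom_iff)
    fix t assume t: "t \<in> Arr K" "Dom K t = Cod K \<epsilon>" "t \<cdot> \<epsilon> = Zero K (Dom K \<epsilon>) (Cod K t)"
    have tS: "t \<in> Hom K S (Cod K t)" using t Q by (simp add: Hom_iff)
    have "t \<cdot> a = Zero K (Dom K a) (Cod K t)" if "a \<in> F" for a
    proof -
      obtain b where b: "b \<in> Hom K (Dom K a) Q" "\<epsilon> \<cdot> b = a"
        using QF[OF \<open>a \<in> F\<close>] by blast
      have "t \<cdot> \<epsilon> \<cdot> b = Zero K (Dom K \<epsilon>) (Cod K t) \<cdot> b"
        by (rule comp_rewrite[OF t(3)]) (use t Q b in \<open>auto simp: Hom_iff\<close>)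
      then show ?thesis
        using b Q hom_objs[OF tS] by (simp add: Hom_iff)
    qed
    then show "t = Zero K (Cod K \<epsilon>) (Cod K t)"
      using F_epic[OF tS] tS Q by (simp add: Hom_iff)
  qed
  then show ?thesis
    using that Q by blast
qed

text \<open>
  An arrow \<open>S\<^sub>1 \<rightarrow> A \<rightarrow> B\<close> factors through some \<open>S'\<close> in \<open>X\<close>, and \<open>S' \<rightarrow> B \<rightarrow> C\<close> factors through some \<open>S\<close> in \<open>X\<close> such that
  \<open>S\<^sub>1 \<rightarrow> S' \<rightarrow> S\<close> is zero. Covering \<open>S\<close> by an object \<open>Q\<close> that contains \<open>S'\<close> and lifts to \<open>B\<close>, the arrow
  \<open>S\<^sub>1 \<rightarrow> Q\<close> lands in the kernel \<open>R\<close> of \<open>Q \<rightarrow> S\<close>, which maps to \<open>A\<close>.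
\<close>

lemma factoring_kernel_of_epic:
  assumes e: "epic K e" "e \<in> Hom K B C" and k: "is_kernel K k e" "k \<in> Hom K A B"
    and B: "factoring B" and C: "factoring C"
  shows "factoring A"
proof (rule factoringI)
  have ob: "A \<in> Obj K" "B \<in> Obj K" "C \<in> Obj K"
    using hom_objs e k by auto
  show "A \<in> Obj K" by (rule ob)
  fix S0 S1 p f
  assume h: "S0 \<in> X" "S1 \<in> X" "p \<in> Hom K S0 S1" "f \<in> Hom K S1 A" "f \<cdot> p = Zero K S0 A"
  note S01 = X_obj[OF h(1)] X_obj[OF h(2)]
  have kf: "k \<cdot> f \<in> Hom K S1 B" "(k \<cdot> f) \<cdot> p = Zero K S0 B"
    using h k S01 by (auto simp: Hom_iff)
  obtain S' g f' where g: "S' \<in> X" "g \<in> Hom K S1 S'" "f' \<in> Hom K S' B" "f' \<cdot> g = k \<cdot> f"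
      "g \<cdot> p = Zero K S0 S'"
    using factoringE[OF B h(1-3) kf] by blast
  have ek: "e \<cdot> k = Zero K A C"
    using kernel_comp_zero k e by blast
  have ef': "e \<cdot> f' \<in> Hom K S' C" "(e \<cdot> f') \<cdot> g = Zero K S1 C"
    using comp_rewrite[OF ek, of f] g h e k ob by (auto simp: Hom_iff)
  obtain S g' s where s: "S \<in> X" "g' \<in> Hom K S' S" "s \<in> Hom K S C" "s \<cdot> g' = e \<cdot> f'"
      "g' \<cdot> g = Zero K S1 S"
    using factoringE[OF C h(2) g(1,2) ef'] by blast
  obtain Q \<epsilon> l j where Q: "Q \<in> X" "epic K \<epsilon>" "\<epsilon> \<in> Hom K Q S" "l \<in> Hom K Q B" "e \<cdot> l = s \<cdot> \<epsilon>"
    "j \<in> Hom K S' Q" "\<epsilon> \<cdot> j = g'" "l \<cdot> j = f'"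
    using lift_over_epic[OF e s(1,3) g(1,3) s(2) s(4)[symmetric]] by blast
  obtain R \<rho> where \<rho>: "\<rho> \<in> Hom K R Q" "is_kernel K \<rho> \<epsilon>"
    using kernel_exists[OF Q(3)] by blast
  have R: "R \<in> X"
    using X_kernel[OF Q(2,3) \<rho>(2,1) Q(1) s(1)] .
  have jg: "j \<cdot> g \<in> Hom K S1 Q" "\<epsilon> \<cdot> j \<cdot> g = Zero K S1 S"
    using comp_rewrite[OF Q(7), of g] Q g s by (auto simp: Hom_iff)
  obtain h2 where h2: "h2 \<in> Hom K S1 R" "\<rho> \<cdot> h2 = j \<cdot> g"
    using kernel_lift_hom[OF \<rho>(2,1) Q(3) jg] by blast
  have \<epsilon>\<rho>: "\<epsilon> \<cdot> \<rho> = Zero K R S"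
    using kernel_comp_zero \<rho> Q by blast
  have l\<rho>: "l \<cdot> \<rho> \<in> Hom K R B" "e \<cdot> l \<cdot> \<rho> = Zero K R C"
    using comp_rewrite[OF Q(5), of \<rho>] \<epsilon>\<rho> \<rho> Q e s X_obj[OF R] by (auto simp: Hom_iff)
  obtain v where v: "v \<in> Hom K R A" "k \<cdot> v = l \<cdot> \<rho>"
    using kernel_lift_hom[OF k e(2) l\<rho>] by blast
  have "v \<cdot> h2 = f"
  proof (rule monic_cancel[OF kernel_monic[OF k(1)] k(2)])
    show "v \<cdot> h2 \<in> Hom K S1 A" "f \<in> Hom K S1 A"
      using v h2 h by (auto simp: Hom_iff)
    have "k \<cdot> v \<cdot> h2 = l \<cdot> \<rho> \<cdot> h2"
      using comp_rewrite[OF v(2), of h2] v h2 k \<rho> Q by (simp add: Hom_iff)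
    also have "\<dots> = l \<cdot> j \<cdot> g"
      using h2 by simp
    also have "\<dots> = k \<cdot> f"
      using comp_rewrite[OF Q(8), of g] g Q by (simp add: Hom_iff)
    finally show "k \<cdot> v \<cdot> h2 = k \<cdot> f" .
  qed
  moreover have "h2 \<cdot> p = Zero K S0 R"
  proof (rule monic_cancel_zero[OF kernel_monic[OF \<rho>(2)] \<rho>(1)])
    show "h2 \<cdot> p \<in> Hom K S0 R"
      using h2 h by (auto simp: Hom_iff)
    have "\<rho> \<cdot> h2 \<cdot> p = j \<cdot> g \<cdot> p"
      using comp_rewrite[OF h2(2), of p] h2 \<rho> h Q g by (simp add: Hom_iff)
    then show "\<rho> \<cdot> h2 \<cdot> p = Zero K S0 Q"
      using g Q S01 by (simp add: Hom_iff)
  qed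
  ultimately show "\<exists>S2 g f'. S2 \<in> X \<and> g \<in> Hom K S1 S2 \<and> f' \<in> Hom K S2 A \<and> f' \<cdot> g = f \<and> g \<cdot> p = Zero K S0 S2"
    using R h2(1) v(1) by blast
qed

text \<open>
  Factor \<open>S\<^sub>1 \<rightarrow> B \<rightarrow> C\<close> through some \<open>S\<close> in \<open>X\<close> and cover \<open>S\<close> by an object \<open>Q\<close> that contains \<open>S\<^sub>1\<close> and lifts to \<open>B\<close>. The
  kernel \<open>R\<close> of \<open>Q \<rightarrow> S\<close> is in \<open>X\<close> and maps to \<open>A\<close>; let \<open>R \<rightarrow> SA \<rightarrow> A\<close> be a factorization through \<open>X\<close> that kills the arrow
  \<open>p' : S\<^sub>0 \<rightarrow> R\<close> induced by \<open>p\<close>. The pushout \<open>E\<close> of \<open>SA\<close> and \<open>Q\<close> under \<open>R\<close> is an extension of \<open>S\<close> by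
  \<open>SA\<close>, and \<open>S\<^sub>1 \<rightarrow> Q \<rightarrow> E \<rightarrow> B\<close> is the required factorization.
\<close>

lemma factoring_extension:
  assumes exact: "short_exact K i e" and i: "i \<in> Hom K A B" and e: "e \<in> Hom K B C"
    and A: "factoring A" and C: "factoring C"
  shows "factoring B"
proof (rule factoringI)
  have ob: "A \<in> Obj K" "B \<in> Obj K" "C \<in> Obj K"
    using hom_objs e i by auto
  have ker: "is_kernel K i e" and epic_e: "epic K e"
    using exact cokernel_epic unfolding short_exact_def by auto
  show "B \<in> Obj K" by (rule ob)
  fix S0 S1 p f
  assume h: "S0 \<in> X" "S1 \<in> X" "p \<in> Hom K S0 S1" "f \<in> Hom K S1 B" "f \<cdot> p = Zero K S0 B"
  note S01 = X_obj[OF h(1)] X_obj[OF h(2)]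
  have ef: "e \<cdot> f \<in> Hom K S1 C" "(e \<cdot> f) \<cdot> p = Zero K S0 C"
    using h e S01 by (auto simp: Hom_iff)
  obtain S g s where g: "S \<in> X" "g \<in> Hom K S1 S" "s \<in> Hom K S C" "s \<cdot> g = e \<cdot> f" "g \<cdot> p = Zero K S0 S"
    using factoringE[OF C h(1-3) ef] by blast
  obtain Q \<epsilon> l j where Q: "Q \<in> X" "epic K \<epsilon>" "\<epsilon> \<in> Hom K Q S" "l \<in> Hom K Q B" "e \<cdot> l = s \<cdot> \<epsilon>"
    "j \<in> Hom K S1 Q" "\<epsilon> \<cdot> j = g" "l \<cdot> j = f"
    using lift_over_epic[OF epic_e e g(1,3) h(2,4) g(2) g(4)[symmetric]] by blast
  obtain R \<rho> where \<rho>: "\<rho> \<in> Hom K R Q" "is_kernel K \<rho> \<epsilon>"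
    using kernel_exists[OF Q(3)] by blast
  have R: "R \<in> X"
    using X_kernel[OF Q(2,3) \<rho>(2,1) Q(1) g(1)] .
  have \<epsilon>\<rho>: "\<epsilon> \<cdot> \<rho> = Zero K R S"
    using kernel_comp_zero \<rho> Q by blast
  have l\<rho>: "l \<cdot> \<rho> \<in> Hom K R B" "e \<cdot> l \<cdot> \<rho> = Zero K R C"
    using comp_rewrite[OF Q(5), of \<rho>] \<epsilon>\<rho> \<rho> Q e g X_obj[OF R] by (auto simp: Hom_iff)
  obtain \<alpha> where \<alpha>: "\<alpha> \<in> Hom K R A" "i \<cdot> \<alpha> = l \<cdot> \<rho>"
    using kernel_lift_hom[OF ker i e l\<rho>] by blast
  have jp: "j \<cdot> p \<in> Hom K S0 Q" "\<epsilon> \<cdot> j \<cdot> p = Zero K S0 S"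
    using comp_rewrite[OF Q(7), of p] Q g h by (auto simp: Hom_iff)
  obtain p' where p': "p' \<in> Hom K S0 R" "\<rho> \<cdot> p' = j \<cdot> p"
    using kernel_lift_hom[OF \<rho>(2,1) Q(3) jp] by blast
  have "\<alpha> \<cdot> p' = Zero K S0 A"
  proof (rule monic_cancel_zero[OF kernel_monic[OF ker] i])
    show "\<alpha> \<cdot> p' \<in> Hom K S0 A"
      using \<alpha> p' by (auto simp: Hom_iff)
    have "i \<cdot> \<alpha> \<cdot> p' = l \<cdot> \<rho> \<cdot> p'"
      using comp_rewrite[OF \<alpha>(2), of p'] \<alpha> p' \<rho> Q i by (simp add: Hom_iff)
    also have "\<dots> = l \<cdot> j \<cdot> p"
      using p' by simp
    also have "\<dots> = Zero K S0 B"
      using comp_rewrite[OF Q(8), of p] h Q by (simp add: Hom_iff)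
    finally show "i \<cdot> \<alpha> \<cdot> p' = Zero K S0 B" .
  qed
  then obtain SA \<alpha>' a where a: "SA \<in> X" "\<alpha>' \<in> Hom K R SA" "a \<in> Hom K SA A" "a \<cdot> \<alpha>' = \<alpha>" "\<alpha>' \<cdot> p' = Zero K S0 SA"
    using factoringE[OF A h(1) R p'(1) \<alpha>(1)] by blast
  obtain E ia b \<psi> where E: "ia \<in> Hom K SA E" "b \<in> Hom K Q E" "ia \<cdot> \<alpha>' = b \<cdot> \<rho>" "short_exact K ia \<psi>" "\<psi> \<in> Hom K E S"
    and E_univ: "\<And>M f g. f \<in> Hom K SA M \<Longrightarrow> g \<in> Hom K Q M \<Longrightarrow> f \<cdot> \<alpha>' = g \<cdot> \<rho> \<Longrightarrow>
       \<exists>u. u \<in> Hom K E M \<and> u \<cdot> ia = f \<and> u \<cdot> b = g"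
    by (rule pushout_extension[OF Q(2,3) \<rho>(2,1) a(2)]) (rule that)
  have E_X: "E \<in> X"
    using X_extension[OF E(4,1,5) a(1) g(1)] .
  have "(i \<cdot> a) \<cdot> \<alpha>' = l \<cdot> \<rho>"
    using a i \<alpha> by (simp add: Hom_iff)
  then obtain u where u: "u \<in> Hom K E B" "u \<cdot> b = l"
    using E_univ[of "i \<cdot> a" B l] Q(4) a i by (auto simp: Hom_iff)
  have "u \<cdot> b \<cdot> j = f"
    using comp_rewrite[OF u(2), of j] u E Q by (simp add: Hom_iff)
  moreover have "(b \<cdot> j) \<cdot> p = Zero K S0 E"
  proof -
    have "(b \<cdot> j) \<cdot> p = (b \<cdot> \<rho>) \<cdot> p'"
      using p' E(2) Q(6) \<rho>(1) h(3) by (simp add: Hom_iff)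
    also have "\<dots> = ia \<cdot> \<alpha>' \<cdot> p'"
      by (rule comp_rewrite[OF E(3), symmetric]) (use E(1) p'(1) a(2) in \<open>auto simp: Hom_iff\<close>)
    also have "\<dots> = Zero K S0 E"
      using a(5) E S01 by (simp add: Hom_iff)
    finally show ?thesis .
  qed
  moreover have "b \<cdot> j \<in> Hom K S1 E"
    using E Q by (auto simp: Hom_iff)
  ultimately show "\<exists>S2 g f'. S2 \<in> X \<and> g \<in> Hom K S1 S2 \<and> f' \<in> Hom K S2 B \<and> f' \<cdot> g = f \<and> g \<cdot> p = Zero K S0 S2"
    using E_X u(1) by blast
qed

text \<open>
  \<open>B\<close> is the direct sum of the \<open>D i\<close> with \<open>i \<in> F\<close>; it is factoring because direct sums are extensions. In the
  induction step \<open>w\<close> sends the new summand to its copy in the larger sum and all other summands as before.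
\<close>

lemma factoring_finite_part_of_coproduct:
  assumes P: "is_coproduct K I D P \<iota>" and D: "\<And>i. i \<in> I \<Longrightarrow> factoring (D i)"
    and F: "finite F" "F \<subseteq> I"
  shows "\<exists>B m w. factoring B \<and> m \<in> Hom K B P \<and> w \<in> Hom K P B \<and> (\<forall>i \<in> F. m \<cdot> w \<cdot> \<iota> i = \<iota> i)"
  using F
proof (induction F rule: finite_induct)
  case empty
  obtain Z where Z: "is_zero_object K Z"
    using zero_object by blast
  note Z_X = X_zero[OF Z]
  show ?case
    by (intro exI[of _ Z] exI[of _ "Zero K Z P"] exI[of _ "Zero K P Z"])
      (use factoring_X[OF Z_X] X_obj[OF Z_X] coproductD(1)[OF P] in \<open>auto simp: Hom_iff\<close>)
next
  case (insert i F)
  note DP = coproductD[OF P]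
  obtain B m w where B: "factoring B" "m \<in> Hom K B P" "w \<in> Hom K P B"
    and mw: "\<And>j. j \<in> F \<Longrightarrow> m \<cdot> w \<cdot> \<iota> j = \<iota> j"
    using insert by auto
  have i: "i \<in> I" using insert by blast
  obtain B' i1 p1 i2 p2 where B': "biproduct B (D i) B' i1 p1 i2 p2"
    using biproduct_exists factoring_obj[OF B(1)] factoring_obj[OF D[OF i]] by blast
  note DB = biproductD[OF B']
  have fact: "factoring B'"
    using factoring_extension[OF biproduct_short_exact[OF B'] DB(1,4) B(1) D[OF i]] .
  obtain m' where m': "m' \<in> Hom K B' P" "m' \<cdot> i1 = m" "m' \<cdot> i2 = \<iota> i"
    using biproduct_copair[OF B' B(2) DP(2)[OF i]] by blast
  have "(if j = i then i2 else i1 \<cdot> w \<cdot> \<iota> j) \<in> Hom K (D j) B'" if "j \<in> I" for j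
    using DP(2)[OF that] B DB by (auto simp: Hom_iff)
  then obtain w' where w': "w' \<in> Hom K P B'" "\<And>j. j \<in> I \<Longrightarrow> w' \<cdot> \<iota> j = (if j = i then i2 else i1 \<cdot> w \<cdot> \<iota> j)"
    using coproduct_copair[OF P DB(11), of "\<lambda>j. if j = i then i2 else i1 \<cdot> w \<cdot> \<iota> j"] by blast
  have "m' \<cdot> w' \<cdot> \<iota> j = \<iota> j" if j: "j \<in> insert i F" for j
  proof (cases "j = i")
    case True
    then show ?thesis using w'(2)[OF i] m' by simp
  next
    case False
    then have jF: "j \<in> F" "j \<in> I" using j insert by auto
    have "m' \<cdot> i1 \<cdot> w \<cdot> \<iota> j = m \<cdot> w \<cdot> \<iota> j"
      by (rule comp_rewrite[OF m'(2)]) (use m' DB B DP(2)[OF jF(2)] in \<open>auto simp: Hom_iff\<close>)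
    then show ?thesis
      using w'(2)[OF jF(2)] mw[OF jF(1)] False by simp
  qed
  then show ?case
    using fact m'(1) w'(1) by blast
qed

text \<open>
  The coproduct injections are jointly epic, so an arrow from an object of \<open>X\<close> takes its values in a finite part of the
  coproduct: \<open>f\<close> is killed by \<open>1 - m w\<close>, which vanishes on that part.
\<close>

lemma factoring_coproduct:
  assumes I: "small \<kappa> I" and P: "is_coproduct K I D P \<iota>" and D: "\<And>i. i \<in> I \<Longrightarrow> factoring (D i)"
  shows "factoring P"
proof (rule factoringI)
  note DP = coproductD[OF P]
  show "P \<in> Obj K" by (rule DP)
  fix S0 S1 p f
  assume h: "S0 \<in> X" "S1 \<in> X" "p \<in> Hom K S0 S1" "f \<in> Hom K S1 P" "f \<cdot> p = Zero K S0 P"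
  note S01 = X_obj[OF h(1)] X_obj[OF h(2)]
  have Dom_\<iota>: "Dom K (\<iota> i) = D i" if "i \<in> I" for i
    using DP(2)[OF that] by (simp add: Hom_iff)
  have "t = Zero K P N" if t: "t \<in> Hom K P N" "\<And>g. g \<in> \<iota> ` I \<Longrightarrow> t \<cdot> g = Zero K (Dom K g) N" for N t
  proof (rule coproduct_eqI[OF P t(1)])
    have N: "N \<in> Obj K" using t hom_objs by blast
    show "Zero K P N \<in> Hom K P N" using N DP(1) by (simp add: Hom_iff)
    show "t \<cdot> \<iota> i = Zero K P N \<cdot> \<iota> i" if "i \<in> I" for i
      using t(2)[of "\<iota> i"] that DP(2)[OF that] N by (simp add: Hom_iff)
  qed
  moreover have "g \<in> Hom K (Dom K g) P" if "g \<in> \<iota> ` I" for g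
    using that DP(2) Dom_\<iota> by auto
  ultimately obtain F' where F': "finite F'" "F' \<subseteq> \<iota> ` I"
    and kill: "\<And>N t. t \<in> Hom K P N \<Longrightarrow> (\<And>g. g \<in> F' \<Longrightarrow> t \<cdot> g = Zero K (Dom K g) N) \<Longrightarrow> t \<cdot> f = Zero K S1 N"
    using finitely_presentable_finite_subfamily[OF finitely_presentable[OF h(2)] h(4) small_image[OF I, of \<iota>]]
    by metis
  obtain F where F: "finite F" "F \<subseteq> I" "F' = \<iota> ` F"
    using finite_subset_image[OF F'] by blast
  obtain B m w where B: "factoring B" "m \<in> Hom K B P" "w \<in> Hom K P B"
    and mw: "\<And>j. j \<in> F \<Longrightarrow> m \<cdot> w \<cdot> \<iota> j = \<iota> j"
    using factoring_finite_part_of_coproduct[OF P D F(1,2)] by blast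
  have t: "Sub (Ide K P) (m \<cdot> w) \<in> Hom K P P"
    using B DP(1) by (simp add: Hom_iff)
  have "Sub (Ide K P) (m \<cdot> w) \<cdot> g = Zero K (Dom K g) P" if g: "g \<in> F'" for g
  proof -
    obtain j where j: "j \<in> F" "j \<in> I" "g = \<iota> j" using g F by blast
    have "Sub (Ide K P) (m \<cdot> w) \<cdot> \<iota> j = Sub (\<iota> j) (m \<cdot> w \<cdot> \<iota> j)"
      using DP(1) DP(2)[OF j(2)] B by (simp add: Hom_iff sub_comp)
    then show ?thesis
      using mw[OF j(1)] sub_eq_zero[of "\<iota> j" "\<iota> j"] DP(2)[OF j(2)] j(3) by (simp add: Hom_iff)
  qed
  then have "Sub (Ide K P) (m \<cdot> w) \<cdot> f = Zero K S1 P"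
    using kill[OF t] by blast
  then have "Sub f (m \<cdot> w \<cdot> f) = Zero K S1 P"
    using DP(1) h B by (simp add: Hom_iff sub_comp)
  then have f: "m \<cdot> w \<cdot> f = f"
    using sub_eq_zero[of f "m \<cdot> w \<cdot> f"] h B by (simp add: Hom_iff)
  have wf: "w \<cdot> f \<in> Hom K S1 B" "(w \<cdot> f) \<cdot> p = Zero K S0 B"
    using B h S01 by (auto simp: Hom_iff)
  obtain S2 g f' where g: "S2 \<in> X" "g \<in> Hom K S1 S2" "f' \<in> Hom K S2 B" "f' \<cdot> g = w \<cdot> f" "g \<cdot> p = Zero K S0 S2"
    using factoringE[OF B(1) h(1-3) wf] by blast
  have "(m \<cdot> f') \<cdot> g = f" "m \<cdot> f' \<in> Hom K S2 P"
    using g B f by (auto simp: Hom_iff)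
  then show "\<exists>S2 g f'. S2 \<in> X \<and> g \<in> Hom K S1 S2 \<and> f' \<in> Hom K S2 P \<and> f' \<cdot> g = f \<and> g \<cdot> p = Zero K S0 S2"
    using g by blast
qed

end

section \<open>The canonical direct system of a factoring object\<close>

context presentable_class
begin

text \<open>
  By finite presentability each object of \<open>X\<close> is a quotient of a finite direct sum of generators, hence of the
  coproduct \<open>U\<close> of countably many copies of each generator. Such a quotient is determined up to isomorphism by the set of arrows
  from generators to \<open>U\<close> that it kills, and there is only a small set of such sets.
\<close>

lemma small_skeleton:
  obtains X\<^sub>0 where "X\<^sub>0 \<subseteq> X" "small \<kappa> X\<^sub>0" "\<And>S. S \<in> X \<Longrightarrow> \<exists>S' \<in> X\<^sub>0. isomorphic K S S'"
proof -
  obtain G where G: "G \<subseteq> X" "small \<kappa> G" "generating K G"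
    using small_generators by blast
  have "small \<kappa> (G \<times> (UNIV :: nat set))"
    by (intro small_Sigma inacc G small_nat)
  moreover have "fst i \<in> Obj K" if "i \<in> G \<times> (UNIV :: nat set)" for i
    using that G(1) X_obj by auto
  ultimately obtain U \<iota> where U: "is_coproduct K (G \<times> (UNIV :: nat set)) fst U \<iota>"
    using coproduct_exists[of "G \<times> (UNIV :: nat set)" fst] by metis
  note DU = coproductD[OF U]
  have "\<exists>\<epsilon>. \<epsilon> \<in> Hom K U S \<and> epic K \<epsilon>" if S: "S \<in> X" for S
  proof -
    have S_obj: "S \<in> Obj K" by (rule X_obj[OF S])
    define \<Gamma> where "\<Gamma> = (\<Union>Y\<in>G. Hom K Y S)"
    have "small \<kappa> \<Gamma>"
      unfolding \<Gamma>_def by (rule small_UN[OF inacc G(2)]) (rule small_Hom)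
    moreover have \<Gamma>_hom: "a \<in> Hom K (Dom K a) S" "Dom K a \<in> G" if "a \<in> \<Gamma>" for a
      using that unfolding \<Gamma>_def by (auto simp: Hom_iff)
    moreover have "Ide K S \<in> Hom K S S"
      using S_obj by (simp add: Hom_iff)
    moreover have "t = Zero K S N" if t: "t \<in> Hom K S N" "\<And>a. a \<in> \<Gamma> \<Longrightarrow> t \<cdot> a = Zero K (Dom K a) N" for N t
    proof (rule ccontr)
      have N: "N \<in> Obj K" using t hom_objs by blast
      assume "t \<noteq> Zero K S N"
      moreover have "Zero K S N \<in> Hom K S N" using N S_obj by (simp add: Hom_iff)
      ultimately obtain Y h where h: "Y \<in> G" "h \<in> Hom K Y S" "t \<cdot> h \<noteq> Zero K S N \<cdot> h"
        using G(3) t(1) unfolding generating_def by blast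
      then have "h \<in> \<Gamma>" unfolding \<Gamma>_def by blast
      then show False
        using t(2)[of h] h N by (simp add: Hom_iff)
    qed
    ultimately obtain F where F: "finite F" "F \<subseteq> \<Gamma>"
      and F_epic: "\<And>N t. t \<in> Hom K S N \<Longrightarrow> (\<And>a. a \<in> F \<Longrightarrow> t \<cdot> a = Zero K (Dom K a) N) \<Longrightarrow> t \<cdot> Ide K S = Zero K S N"
      using finitely_presentable_finite_subfamily[OF finitely_presentable[OF S], of "Ide K S" S \<Gamma>]
      by metis
    obtain l where l: "set l = F"
      using finite_list[OF F(1)] by blast
    \<comment> \<open>The \<open>k\<close>-th arrow of the list lives on the \<open>k\<close>-th copy of its domain; all other copies go to zero.\<close>
    define \<mu> where "\<mu> = (\<lambda>(Y, k). if k < length l \<and> Dom K (l ! k) = Y then l ! k else Zero K Y S)"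
    have "\<mu> i \<in> Hom K (fst i) S" if "i \<in> G \<times> UNIV" for i
    proof (cases "snd i < length l \<and> Dom K (l ! snd i) = fst i")
      case True
      then have "l ! snd i \<in> \<Gamma>" using l F(2) nth_mem by blast
      then show ?thesis
        using \<Gamma>_hom(1)[of "l ! snd i"] True unfolding \<mu>_def by (simp add: case_prod_unfold)
    next
      case False
      then show ?thesis
        using that G(1) X_obj[of "fst i"] S_obj unfolding \<mu>_def by (auto simp: case_prod_unfold Hom_iff)
    qed
    then obtain u where u: "u \<in> Hom K U S" "\<And>i. i \<in> G \<times> UNIV \<Longrightarrow> u \<cdot> \<iota> i = \<mu> i"
      using coproduct_copair[OF U S_obj, of \<mu>] by blast
    have "epic K u"
    proof (rule epicI)
      show "u \<in> Arr K" using u by (simp add: Hom_iff)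
      fix t assume t: "t \<in> Arr K" "Dom K t = Cod K u" "t \<cdot> u = Zero K (Dom K u) (Cod K t)"
      have tS: "t \<in> Hom K S (Cod K t)" using t u by (simp add: Hom_iff)
      have "t \<cdot> a = Zero K (Dom K a) (Cod K t)" if a: "a \<in> F" for a
      proof -
        obtain k where k: "k < length l" "l ! k = a"
          using a l by (metis in_set_conv_nth)
        let ?i = "(Dom K a, k)"
        have i: "?i \<in> G \<times> UNIV" using \<Gamma>_hom(2) F(2) a by blast
        have "u \<cdot> \<iota> ?i = a"
          using u(2)[OF i] k unfolding \<mu>_def by simp
        moreover have "t \<cdot> u \<cdot> \<iota> ?i = Zero K (Dom K u) (Cod K t) \<cdot> \<iota> ?i"
          by (rule comp_rewrite[OF t(3)]) (use t u(1) DU(2)[OF i] in \<open>auto simp: Hom_iff\<close>)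
        ultimately show ?thesis
          using DU(2)[OF i] u(1) hom_objs[OF tS] by (simp add: Hom_iff)
      qed
      then show "t = Zero K (Cod K u) (Cod K t)"
        using F_epic[OF tS] tS u(1) by (simp add: Hom_iff)
    qed
    then show ?thesis using u by blast
  qed
  then obtain \<epsilon> where \<epsilon>: "\<And>S. S \<in> X \<Longrightarrow> \<epsilon> S \<in> Hom K U S \<and> epic K (\<epsilon> S)"
    by metis
  define rel where "rel S = {h \<in> (\<Union>Y\<in>G. Hom K Y U). \<epsilon> S \<cdot> h = Zero K (Dom K h) S}" for S
  have iso: "isomorphic K S S'" if S: "S \<in> X" "S' \<in> X" "rel S = rel S'" for S S'
  proof -
    have S_obj: "S \<in> Obj K" "S' \<in> Obj K" using S X_obj by auto
    have rel_iff: "\<epsilon> S \<cdot> h = Zero K Y S \<longleftrightarrow> \<epsilon> S' \<cdot> h = Zero K Y S'" if "Y \<in> G" "h \<in> Hom K Y U" for Y h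
    proof -
      have "h \<in> rel S \<longleftrightarrow> \<epsilon> S \<cdot> h = Zero K Y S" "h \<in> rel S' \<longleftrightarrow> \<epsilon> S' \<cdot> h = Zero K Y S'"
        using that unfolding rel_def by (auto simp: Hom_iff)
      then show ?thesis using S(3) by simp
    qed
    note eS = \<epsilon>[OF S(1), THEN conjunct1] \<epsilon>[OF S(1), THEN conjunct2]
    note eS' = \<epsilon>[OF S(2), THEN conjunct1] \<epsilon>[OF S(2), THEN conjunct2]
    obtain v where v: "v \<in> Hom K S S'" "v \<cdot> \<epsilon> S = \<epsilon> S'"
      using factor_through_epic[OF G(3) eS(2,1) eS'(1)] rel_iff by blast
    obtain w where w: "w \<in> Hom K S' S" "w \<cdot> \<epsilon> S' = \<epsilon> S"
      using factor_through_epic[OF G(3) eS'(2,1) eS(1)] rel_iff by blast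
    have "w \<cdot> v = Ide K S"
      by (rule epic_cancel[OF eS(2,1), of _ S]) (use v w eS S_obj in \<open>auto simp: Hom_iff\<close>)
    moreover have "v \<cdot> w = Ide K S'"
      by (rule epic_cancel[OF eS'(2,1), of _ S']) (use v w eS' S_obj in \<open>auto simp: Hom_iff\<close>)
    ultimately show ?thesis
      unfolding isomorphic_def using v w S_obj by blast
  qed
  define rep where "rep V = (SOME S. S \<in> X \<and> rel S = V)" for V
  have rep: "rep (rel S) \<in> X \<and> rel (rep (rel S)) = rel S" if "S \<in> X" for S
    unfolding rep_def by (rule someI[of _ S]) (use that in blast)
  have "small \<kappa> (\<Union>Y\<in>G. Hom K Y U)"
    by (rule small_UN[OF inacc G(2)]) (rule small_Hom)
  then have "small \<kappa> (rel ` X)"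
    by (rule small_subset[OF small_Pow[OF inacc]]) (auto simp: rel_def)
  then have "small \<kappa> (rep ` rel ` X)"
    by (rule small_image)
  then show ?thesis
    using that[of "rep ` rel ` X"] rep iso by fastforce
qed

lemma factoring_finite:
  assumes L: "factoring L" and S: "S \<in> X" "f \<in> Hom K S L"
    and \<Delta>: "finite \<Delta>" "\<And>\<delta>. \<delta> \<in> \<Delta> \<Longrightarrow> \<delta> \<in> Hom K (Dom K \<delta>) S \<and> Dom K \<delta> \<in> X \<and> f \<cdot> \<delta> = Zero K (Dom K \<delta>) L"
  shows "\<exists>S' g f'. S' \<in> X \<and> g \<in> Hom K S S' \<and> f' \<in> Hom K S' L \<and> f' \<cdot> g = f \<and>
    (\<forall>\<delta> \<in> \<Delta>. g \<cdot> \<delta> = Zero K (Dom K \<delta>) S')"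
  using \<Delta>
proof (induction \<Delta> rule: finite_induct)
  case empty
  show ?case
    by (intro exI[of _ S] exI[of _ "Ide K S"] exI[of _ f]) (use S X_obj[OF S(1)] in \<open>auto simp: Hom_iff\<close>)
next
  case (insert \<delta> \<Delta>)
  obtain S1 g1 f1 where g1: "S1 \<in> X" "g1 \<in> Hom K S S1" "f1 \<in> Hom K S1 L" "f1 \<cdot> g1 = f"
    and kill: "\<And>\<delta>. \<delta> \<in> \<Delta> \<Longrightarrow> g1 \<cdot> \<delta> = Zero K (Dom K \<delta>) S1"
    using insert by auto
  have \<delta>: "\<delta> \<in> Hom K (Dom K \<delta>) S" "Dom K \<delta> \<in> X" "f \<cdot> \<delta> = Zero K (Dom K \<delta>) L"
    using insert by auto
  have g1\<delta>: "g1 \<cdot> \<delta> \<in> Hom K (Dom K \<delta>) S1" "f1 \<cdot> g1 \<cdot> \<delta> = Zero K (Dom K \<delta>) L"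
    using comp_rewrite[OF g1(4), of \<delta>] g1 \<delta> by (auto simp: Hom_iff)
  obtain S2 g f' where g: "S2 \<in> X" "g \<in> Hom K S1 S2" "f' \<in> Hom K S2 L" "f' \<cdot> g = f1"
      "g \<cdot> g1 \<cdot> \<delta> = Zero K (Dom K \<delta>) S2"
    using factoringE[OF L \<delta>(2) g1(1) g1\<delta>(1) g1(3) g1\<delta>(2)] by blast
  have "(g \<cdot> g1) \<cdot> \<delta>' = Zero K (Dom K \<delta>') S2" if "\<delta>' \<in> insert \<delta> \<Delta>" for \<delta>'
  proof -
    have d: "\<delta>' \<in> Hom K (Dom K \<delta>') S" using insert that by blast
    have "(g \<cdot> g1) \<cdot> \<delta>' = g \<cdot> g1 \<cdot> \<delta>'"
      using d g(2) g1(2) by (simp add: Hom_iff)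
    then show ?thesis
      using that g(2,5) kill[of \<delta>'] hom_objs[OF d] by (auto simp: Hom_iff)
  qed
  moreover have "g \<cdot> g1 \<in> Hom K S S2" "f' \<cdot> g \<cdot> g1 = f"
    using comp_rewrite[OF g(4), of g1] g g1 by (auto simp: Hom_iff)
  ultimately show ?case
    using g(1,3) by blast
qed

end

text \<open>
  An object \<open>t\<close> over \<open>L\<close> is a triple \<open>(S, f, n)\<close> with \<open>f : S \<rightarrow> L\<close>; the label \<open>n\<close> provides infinitely many copies, so that a
  fresh one is always at hand. A stage \<open>(t, R)\<close> consists of a finite set \<open>Domain R\<close> of such objects with an arrow over \<open>L\<close> from
  each of them to \<open>t\<close>, itself one of them. A later stage extends the set, has a top object that is new, and is compatible
  with the arrows. Newness of the top makes the order antisymmetric, and compatibility makes the arrow from the old top to the new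
  one functorial. Since the later stage records this arrow, it is determined by the two stages. The poset is directed because the
  finitely many disagreements between two stages can be removed by the factoring property.
\<close>

locale canonical_system = presentable_class \<kappa> K X
  for \<kappa> :: "'u rel" and K :: "('o, 'm) precat" (structure) and X :: "'o set" +
  fixes X\<^sub>0 :: "'o set" and L :: 'o
  assumes skeleton: "X\<^sub>0 \<subseteq> X" "small \<kappa> X\<^sub>0" "\<And>S. S \<in> X \<Longrightarrow> \<exists>S' \<in> X\<^sub>0. isomorphic K S S'"
    and factoring: "factoring L"
begin

abbreviation ob :: "'o \<times> 'm \<times> nat \<Rightarrow> 'o" where "ob v \<equiv> fst v"
abbreviation str :: "'o \<times> 'm \<times> nat \<Rightarrow> 'm" where "str v \<equiv> fst (snd v)"

definition nodes :: "('o \<times> 'm \<times> nat) set" where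
  "nodes = {v. ob v \<in> X\<^sub>0 \<and> str v \<in> Hom K (ob v) L}"

definition stages :: "(('o \<times> 'm \<times> nat) \<times> (('o \<times> 'm \<times> nat) \<times> 'm) set) set" where
  "stages = {(t, R). t \<in> nodes \<and> finite R \<and> single_valued R \<and> (t, Ide K (ob t)) \<in> R \<and>
     (\<forall>(v, m) \<in> R. v \<in> nodes \<and> m \<in> Hom K (ob v) (ob t) \<and> str t \<cdot> m = str v)}"

definition precedes where
  "precedes e e' \<longleftrightarrow> e \<in> stages \<and> e' \<in> stages \<and>
     (e = e' \<or> fst e' \<notin> Domain (snd e) \<and>
        (\<exists>m'. (fst e, m') \<in> snd e' \<and> (\<forall>(v, m) \<in> snd e. (v, m' \<cdot> m) \<in> snd e')))"

definition trans_map where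
  "trans_map e e' = (THE m. (fst e, m) \<in> snd e')"

lemma nodesD:
  assumes "v \<in> nodes"
  shows "ob v \<in> X\<^sub>0" "ob v \<in> X" "ob v \<in> Obj K" "str v \<in> Hom K (ob v) L"
  using assms skeleton X_obj unfolding nodes_def by auto

lemma stagesD:
  assumes "e \<in> stages"
  shows "fst e \<in> nodes" "finite (snd e)" "single_valued (snd e)" "(fst e, Ide K (ob (fst e))) \<in> snd e"
    "\<And>v m. (v, m) \<in> snd e \<Longrightarrow> v \<in> nodes \<and> m \<in> Hom K (ob v) (ob (fst e)) \<and> str (fst e) \<cdot> m = str v"
proof -
  have e: "fst e \<in> nodes \<and> finite (snd e) \<and> single_valued (snd e) \<and> (fst e, Ide K (ob (fst e))) \<in> snd e \<and>
     (\<forall>(v, m) \<in> snd e. v \<in> nodes \<and> m \<in> Hom K (ob v) (ob (fst e)) \<and> str (fst e) \<cdot> m = str v)"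
    using assms unfolding stages_def by (simp add: case_prod_unfold)
  then show "fst e \<in> nodes" "finite (snd e)" "single_valued (snd e)" "(fst e, Ide K (ob (fst e))) \<in> snd e"
    by blast+
  show "v \<in> nodes \<and> m \<in> Hom K (ob v) (ob (fst e)) \<and> str (fst e) \<cdot> m = str v" if "(v, m) \<in> snd e" for v m
    using bspec[OF e[THEN conjunct2, THEN conjunct2, THEN conjunct2, THEN conjunct2] that] by simp
qed

lemma trans_map_eq: "e' \<in> stages \<Longrightarrow> (fst e, m) \<in> snd e' \<Longrightarrow> trans_map e e' = m"
  unfolding trans_map_def using stagesD(3)[of e'] by (auto dest: single_valuedD)

lemma precedesD:
  assumes "precedes e e'"
  shows "e \<in> stages" "e' \<in> stages" "(fst e, trans_map e e') \<in> snd e'"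
    "trans_map e e' \<in> Hom K (ob (fst e)) (ob (fst e'))" "str (fst e') \<cdot> trans_map e e' = str (fst e)"
    "\<And>v m. (v, m) \<in> snd e \<Longrightarrow> (v, trans_map e e' \<cdot> m) \<in> snd e'"
proof -
  show st: "e \<in> stages" "e' \<in> stages"
    using assms unfolding precedes_def by auto
  obtain m' where m': "(fst e, m') \<in> snd e'" "\<And>v m. (v, m) \<in> snd e \<Longrightarrow> (v, m' \<cdot> m) \<in> snd e'"
  proof (cases "e = e'")
    case True
    have "(v, Ide K (ob (fst e)) \<cdot> m) \<in> snd e'" if "(v, m) \<in> snd e" for v m
      using stagesD(5)[OF st(1) that] that True by (simp add: Hom_iff)
    then show ?thesis
      using that stagesD(4)[OF st(1)] True by blast
  next
    case False
    then show ?thesis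
      using that assms unfolding precedes_def by blast
  qed
  have eq: "trans_map e e' = m'"
    using trans_map_eq[OF st(2) m'(1)] .
  show "(fst e, trans_map e e') \<in> snd e'" "\<And>v m. (v, m) \<in> snd e \<Longrightarrow> (v, trans_map e e' \<cdot> m) \<in> snd e'"
    using m' eq by auto
  show "trans_map e e' \<in> Hom K (ob (fst e)) (ob (fst e'))" "str (fst e') \<cdot> trans_map e e' = str (fst e)"
    using stagesD(5)[OF st(2) m'(1)] eq by auto
qed

lemma precedes_refl: "e \<in> stages \<Longrightarrow> precedes e e"
  unfolding precedes_def by blast

lemma trans_map_comp:
  assumes "precedes e e'" "precedes e' e''"
  shows "trans_map e' e'' \<cdot> trans_map e e' = trans_map e e''"
  using trans_map_eq[OF precedesD(2)[OF assms(2)] precedesD(6)[OF assms(2) precedesD(3)[OF assms(1)]]] by simp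

lemma precedes_trans:
  assumes "precedes e e'" "precedes e' e''"
  shows "precedes e e''"
proof (cases "e = e' \<or> e' = e''")
  case True
  then show ?thesis using assms by auto
next
  case False
  note D = precedesD[OF assms(1)] and D' = precedesD[OF assms(2)]
  have "fst e'' \<notin> Domain (snd e')"
    using assms(2) False unfolding precedes_def by blast
  then have "fst e'' \<notin> Domain (snd e)"
    using D(6) by blast
  moreover have "(v, (trans_map e' e'' \<cdot> trans_map e e') \<cdot> m) \<in> snd e''" if "(v, m) \<in> snd e" for v m
    using D'(6)[OF D(6)[OF that]] stagesD(5)[OF D(1) that] D(4) D'(4) by (simp add: Hom_iff)
  moreover have "(fst e, trans_map e' e'' \<cdot> trans_map e e') \<in> snd e''"
    using D'(6)[OF D(3)] .
  ultimately show ?thesis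
    unfolding precedes_def using D(1) D'(2) by blast
qed

lemma precedes_antisym:
  assumes "precedes e e'" "precedes e' e"
  shows "e = e'"
proof (rule ccontr)
  assume "e \<noteq> e'"
  then have "fst e' \<notin> Domain (snd e)"
    using assms(1) unfolding precedes_def by blast
  moreover have "fst e' \<in> Domain (snd e)"
    using precedesD(3)[OF assms(2)] by blast
  ultimately show False by blast
qed

text \<open>
  A common upper bound is obtained by adding a fresh copy of \<open>(S, f)\<close> as the new top, to which the members of both
  stages map through the old tops. The assumption \<open>agree\<close> makes this well defined on common members.
\<close>

lemma amalgamate:
  assumes e1: "e\<^sub>1 \<in> stages" and e2: "e\<^sub>2 \<in> stages" and S: "S \<in> X\<^sub>0" "f \<in> Hom K S L"
    and m1: "m\<^sub>1 \<in> Hom K (ob (fst e\<^sub>1)) S" "f \<cdot> m\<^sub>1 = str (fst e\<^sub>1)"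
    and m2: "m\<^sub>2 \<in> Hom K (ob (fst e\<^sub>2)) S" "f \<cdot> m\<^sub>2 = str (fst e\<^sub>2)"
    and agree: "\<And>v x y. (v, x) \<in> snd e\<^sub>1 \<Longrightarrow> (v, y) \<in> snd e\<^sub>2 \<Longrightarrow> m\<^sub>1 \<cdot> x = m\<^sub>2 \<cdot> y"
  obtains e where "precedes e\<^sub>1 e" "precedes e\<^sub>2 e" "ob (fst e) = S" "trans_map e\<^sub>1 e = m\<^sub>1"
proof -
  note D1 = stagesD[OF e1] and D2 = stagesD[OF e2]
  have S_obj: "S \<in> Obj K" using S hom_objs by blast
  have "finite ((\<lambda>v. snd (snd v)) ` (Domain (snd e\<^sub>1) \<union> Domain (snd e\<^sub>2)))"
    using D1(2) D2(2) by (auto simp: finite_Domain)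
  then obtain n where n: "n \<notin> (\<lambda>v. snd (snd v)) ` (Domain (snd e\<^sub>1) \<union> Domain (snd e\<^sub>2))"
    using ex_new_if_finite[OF infinite_UNIV_nat] by metis
  define t where "t = (S, f, n)"
  have t: "t \<notin> Domain (snd e\<^sub>1)" "t \<notin> Domain (snd e\<^sub>2)"
    using n unfolding t_def by force+
  have t_node: "t \<in> nodes" "ob t = S" "str t = f"
    using S unfolding t_def nodes_def by auto
  define R where "R = insert (t, Ide K S) ((\<lambda>(v, m). (v, m\<^sub>1 \<cdot> m)) ` snd e\<^sub>1 \<union> (\<lambda>(v, m). (v, m\<^sub>2 \<cdot> m)) ` snd e\<^sub>2)"
  have R_cases: "(v, m) \<in> R \<longleftrightarrow> v = t \<and> m = Ide K S \<or> (\<exists>x. (v, x) \<in> snd e\<^sub>1 \<and> m = m\<^sub>1 \<cdot> x) \<or>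
      (\<exists>x. (v, x) \<in> snd e\<^sub>2 \<and> m = m\<^sub>2 \<cdot> x)" for v m
    unfolding R_def by force
  have "single_valued R"
  proof (rule single_valuedI)
    fix v x y assume "(v, x) \<in> R" "(v, y) \<in> R"
    then show "x = y"
      using t D1(3) D2(3) agree unfolding R_cases by (metis DomainI single_valuedD)
  qed
  moreover have "finite R"
    unfolding R_def using D1(2) D2(2) by simp
  moreover have "v \<in> nodes \<and> m \<in> Hom K (ob v) S \<and> f \<cdot> m = str v" if vm: "(v, m) \<in> R" for v m
  proof -
    consider "v = t" "m = Ide K S" | x where "(v, x) \<in> snd e\<^sub>1" "m = m\<^sub>1 \<cdot> x" | x where "(v, x) \<in> snd e\<^sub>2" "m = m\<^sub>2 \<cdot> x"
      using vm unfolding R_cases by blast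
    then show ?thesis
    proof cases
      case 1
      then show ?thesis using t_node S S_obj by (simp add: Hom_iff)
    next
      case 2
      have "f \<cdot> m\<^sub>1 \<cdot> x = str (fst e\<^sub>1) \<cdot> x"
        by (rule comp_rewrite[OF m1(2)]) (use D1(5)[OF 2(1)] S m1 in \<open>auto simp: Hom_iff\<close>)
      then show ?thesis
        using D1(5)[OF 2(1)] m1(1) 2(2) by (auto simp: Hom_iff)
    next
      case 3
      have "f \<cdot> m\<^sub>2 \<cdot> x = str (fst e\<^sub>2) \<cdot> x"
        by (rule comp_rewrite[OF m2(2)]) (use D2(5)[OF 3(1)] S m2 in \<open>auto simp: Hom_iff\<close>)
      then show ?thesis
        using D2(5)[OF 3(1)] m2(1) 3(2) by (auto simp: Hom_iff)
    qed
  qed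
  moreover have "(t, Ide K S) \<in> R"
    unfolding R_def by blast
  ultimately have stage: "(t, R) \<in> stages"
    unfolding stages_def using t_node by auto
  have m1R: "(fst e\<^sub>1, m\<^sub>1) \<in> R"
    unfolding R_cases using D1(4) m1(1) by (metis Hom_iff comp_ide)
  have m2R: "(fst e\<^sub>2, m\<^sub>2) \<in> R"
    unfolding R_cases using D2(4) m2(1) by (metis Hom_iff comp_ide)
  have "precedes e\<^sub>1 (t, R)"
    unfolding precedes_def using e1 stage t(1) m1R R_cases by auto
  moreover have "precedes e\<^sub>2 (t, R)"
    unfolding precedes_def using e2 stage t(2) m2R R_cases by auto
  moreover have "trans_map e\<^sub>1 (t, R) = m\<^sub>1"
    using trans_map_eq[OF stage, of e\<^sub>1 m\<^sub>1] m1R by simp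
  ultimately show ?thesis
    using that[of "(t, R)"] t_node by simp
qed

lemma factoring_finite_skeleton:
  assumes S: "S \<in> X" "f \<in> Hom K S L"
    and \<Delta>: "finite \<Delta>" "\<And>\<delta>. \<delta> \<in> \<Delta> \<Longrightarrow> \<delta> \<in> Hom K (Dom K \<delta>) S \<and> Dom K \<delta> \<in> X \<and> f \<cdot> \<delta> = Zero K (Dom K \<delta>) L"
  obtains S' g f' where "S' \<in> X\<^sub>0" "g \<in> Hom K S S'" "f' \<in> Hom K S' L" "f' \<cdot> g = f"
    "\<And>\<delta>. \<delta> \<in> \<Delta> \<Longrightarrow> g \<cdot> \<delta> = Zero K (Dom K \<delta>) S'"
proof -
  obtain S1 g f' where g: "S1 \<in> X" "g \<in> Hom K S S1" "f' \<in> Hom K S1 L" "f' \<cdot> g = f"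
    and kill: "\<And>\<delta>. \<delta> \<in> \<Delta> \<Longrightarrow> g \<cdot> \<delta> = Zero K (Dom K \<delta>) S1"
    using factoring_finite[OF factoring S \<Delta>] by blast
  obtain S' where S': "S' \<in> X\<^sub>0" "isomorphic K S1 S'"
    using skeleton(3)[OF g(1)] by blast
  obtain u v where u: "u \<in> Hom K S1 S'" and v: "v \<in> Hom K S' S1" and vu: "v \<cdot> u = Ide K S1"
    using isomorphicE[OF S'(2)] by metis
  have "(f' \<cdot> v) \<cdot> u \<cdot> g = f"
    using comp_rewrite[OF vu, of g] u v g by (simp add: Hom_iff)
  moreover have "u \<cdot> g \<in> Hom K S S'" "f' \<cdot> v \<in> Hom K S' L"
    using u v g by (auto simp: Hom_iff)
  moreover have "(u \<cdot> g) \<cdot> \<delta> = Zero K (Dom K \<delta>) S'" if "\<delta> \<in> \<Delta>" for \<delta>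
  proof -
    have d: "\<delta> \<in> Hom K (Dom K \<delta>) S" "Dom K \<delta> \<in> Obj K"
      using \<Delta>(2)[OF that] X_obj by auto
    have "(u \<cdot> g) \<cdot> \<delta> = u \<cdot> g \<cdot> \<delta>"
      using d(1) u g(2) by (simp add: Hom_iff)
    then show ?thesis
      using kill[OF that] u d(2) by (simp add: Hom_iff)
  qed
  ultimately show ?thesis
    using that[OF S'(1)] by blast
qed

text \<open>
  Map the direct sum of the two tops to \<open>L\<close>. The differences of the two arrows into it from each common member are killed by this
  map, so they are already killed by an arrow to an object of the skeleton.
\<close>

lemma stages_directed:
  assumes e1: "e\<^sub>1 \<in> stages" and e2: "e\<^sub>2 \<in> stages"
  shows "\<exists>e. precedes e\<^sub>1 e \<and> precedes e\<^sub>2 e"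
proof -
  note D1 = stagesD[OF e1] and D2 = stagesD[OF e2]
  note N1 = nodesD[OF D1(1)] and N2 = nodesD[OF D2(1)]
  obtain P i p j q where P: "biproduct (ob (fst e\<^sub>1)) (ob (fst e\<^sub>2)) P i p j q"
    using biproduct_exists N1(3) N2(3) by blast
  note DP = biproductD[OF P]
  obtain f where f: "f \<in> Hom K P L" "f \<cdot> i = str (fst e\<^sub>1)" "f \<cdot> j = str (fst e\<^sub>2)"
    using biproduct_copair[OF P N1(4) N2(4)] by blast
  define \<Delta> where "\<Delta> = {Sub (i \<cdot> x) (j \<cdot> y) | v x y. (v, x) \<in> snd e\<^sub>1 \<and> (v, y) \<in> snd e\<^sub>2}"
  have "\<Delta> \<subseteq> (\<lambda>((v, x), (w, y)). Sub (i \<cdot> x) (j \<cdot> y)) ` (snd e\<^sub>1 \<times> snd e\<^sub>2)"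
    unfolding \<Delta>_def by force
  then have fin: "finite \<Delta>"
    using D1(2) D2(2) finite_subset by blast
  have \<Delta>_prop: "\<delta> \<in> Hom K (Dom K \<delta>) P \<and> Dom K \<delta> \<in> X \<and> f \<cdot> \<delta> = Zero K (Dom K \<delta>) L" if "\<delta> \<in> \<Delta>" for \<delta>
  proof -
    obtain v x y where \<delta>: "\<delta> = Sub (i \<cdot> x) (j \<cdot> y)" "(v, x) \<in> snd e\<^sub>1" "(v, y) \<in> snd e\<^sub>2"
      using \<open>\<delta> \<in> \<Delta>\<close> unfolding \<Delta>_def by blast
    note x = D1(5)[OF \<delta>(2)] and y = D2(5)[OF \<delta>(3)]
    have fx: "f \<cdot> i \<cdot> x = str v"
      using comp_rewrite[OF f(2), of x] x f(1) DP by (simp add: Hom_iff)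
    have fy: "f \<cdot> j \<cdot> y = str v"
      using comp_rewrite[OF f(3), of y] y f(1) DP by (simp add: Hom_iff)
    have "f \<cdot> \<delta> = Sub (str v) (str v)"
      unfolding \<delta>(1) using x y f(1) DP fx fy by (simp add: Hom_iff comp_sub)
    moreover have "str v \<in> Hom K (ob v) L" "ob v \<in> X"
      using nodesD x by auto
    moreover have "\<delta> \<in> Hom K (ob v) P"
      unfolding \<delta>(1) using x y DP by (simp add: Hom_iff)
    ultimately show ?thesis
      using sub_eq_zero[of "str v" "str v"] by (simp add: Hom_iff)
  qed
  obtain S g f' where g: "S \<in> X\<^sub>0" "g \<in> Hom K P S" "f' \<in> Hom K S L" "f' \<cdot> g = f"
    and kill: "\<And>\<delta>. \<delta> \<in> \<Delta> \<Longrightarrow> g \<cdot> \<delta> = Zero K (Dom K \<delta>) S"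
    using factoring_finite_skeleton[OF X_biproduct[OF P N1(2) N2(2)] f(1) fin \<Delta>_prop] by metis
  have agree: "(g \<cdot> i) \<cdot> x = (g \<cdot> j) \<cdot> y" if xy: "(v, x) \<in> snd e\<^sub>1" "(v, y) \<in> snd e\<^sub>2" for v x y
  proof -
    note x = D1(5)[OF xy(1)] and y = D2(5)[OF xy(2)]
    have "Sub (i \<cdot> x) (j \<cdot> y) \<in> \<Delta>"
      unfolding \<Delta>_def using xy by blast
    then have "g \<cdot> Sub (i \<cdot> x) (j \<cdot> y) = Zero K (ob v) S"
      using kill x y DP by (simp add: Hom_iff)
    then have "Sub (g \<cdot> i \<cdot> x) (g \<cdot> j \<cdot> y) = Zero K (ob v) S"
      using x y DP g(2) by (simp add: Hom_iff comp_sub)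
    then show ?thesis
      using sub_eq_zero[of "g \<cdot> i \<cdot> x" "g \<cdot> j \<cdot> y"] x y DP g(2) by (simp add: Hom_iff)
  qed
  have "g \<cdot> i \<in> Hom K (ob (fst e\<^sub>1)) S" "f' \<cdot> g \<cdot> i = str (fst e\<^sub>1)"
    "g \<cdot> j \<in> Hom K (ob (fst e\<^sub>2)) S" "f' \<cdot> g \<cdot> j = str (fst e\<^sub>2)"
    using comp_rewrite[OF g(4), of i] comp_rewrite[OF g(4), of j] g f DP by (auto simp: Hom_iff)
  then show ?thesis
    using amalgamate[OF e1 e2 g(1,3), of "g \<cdot> i" "g \<cdot> j"] agree by metis
qed

lemma singleton_stage:
  assumes "v \<in> nodes"
  shows "(v, {(v, Ide K (ob v))}) \<in> stages"
  using assms nodesD[OF assms] unfolding stages_def by (auto simp: Hom_iff single_valued_def)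

lemma stages_nonempty: "stages \<noteq> {}"
proof -
  obtain Z where Z: "is_zero_object K Z"
    using zero_object by blast
  obtain S where S: "S \<in> X\<^sub>0"
    using skeleton(3)[OF X_zero[OF Z]] by blast
  have "(S, Zero K S L, 0) \<in> nodes"
    unfolding nodes_def using S skeleton(1) X_obj factoring_obj[OF factoring] by (auto simp: Hom_iff)
  then show ?thesis
    using singleton_stage by blast
qed

lemma stages_small: "small \<kappa> stages"
proof -
  define A where "A = (\<Union>S\<in>X\<^sub>0. \<Union>S'\<in>X\<^sub>0. Hom K S S')"
  have A: "small \<kappa> A"
    unfolding A_def by (intro small_UN inacc skeleton(2) small_Hom)
  have "small \<kappa> (X\<^sub>0 \<times> (\<Union>S\<in>X\<^sub>0. Hom K S L) \<times> (UNIV :: nat set))"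
    by (intro small_Sigma small_UN inacc skeleton(2) small_Hom small_nat)
  then have N: "small \<kappa> nodes"
    by (rule small_subset) (auto simp: nodes_def)
  have "small \<kappa> (nodes \<times> Pow (nodes \<times> A))"
    by (intro small_Sigma small_Pow inacc N A)
  then show ?thesis
  proof (rule small_subset)
    show "stages \<subseteq> nodes \<times> Pow (nodes \<times> A)"
    proof
      fix e assume e: "e \<in> stages"
      have "(v, m) \<in> nodes \<times> A" if "(v, m) \<in> snd e" for v m
        using stagesD(5)[OF e that] nodesD(1) stagesD(1)[OF e] unfolding A_def by blast
      then have "snd e \<subseteq> nodes \<times> A"
        by auto
      then show "e \<in> nodes \<times> Pow (nodes \<times> A)"
        using stagesD(1)[OF e] by (simp add: mem_Times_iff)
    qed
  qed
qed

lemma canonical_direct_system: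
  "direct_system K stages {(e, e'). precedes e e'} (\<lambda>e. ob (fst e)) trans_map"
proof -
  have "partial_order_on stages {(e, e'). precedes e e'}"
    unfolding order_on_defs
  proof (intro conjI)
    show "{(e, e'). precedes e e'} \<subseteq> stages \<times> stages"
      using precedesD(1,2) by blast
    show "refl_on stages {(e, e'). precedes e e'}"
      using precedes_refl unfolding refl_on_def by blast
    show "trans {(e, e'). precedes e e'}"
      using precedes_trans unfolding trans_def by blast
    show "antisym {(e, e'). precedes e e'}"
      using precedes_antisym unfolding antisym_def by blast
  qed
  moreover have "\<exists>e \<in> stages. precedes e\<^sub>1 e \<and> precedes e\<^sub>2 e" if "e\<^sub>1 \<in> stages" "e\<^sub>2 \<in> stages" for e\<^sub>1 e\<^sub>2
    using stages_directed[OF that] precedesD(2) by blast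
  ultimately have "directed_poset stages {(e, e'). precedes e e'}"
    unfolding directed_poset_def using stages_nonempty by blast
  moreover have "trans_map e e = Ide K (ob (fst e))" if "e \<in> stages" for e
    using trans_map_eq[OF that] stagesD(4)[OF that] by blast
  ultimately show ?thesis
    unfolding direct_system_def using precedesD(4) trans_map_comp nodesD(3) stagesD(1) by auto
qed

lemma kill_at_later_stage:
  assumes e: "e \<in> stages" and y: "y \<in> Hom K Y (ob (fst e))" "Y \<in> X" "str (fst e) \<cdot> y = Zero K Y L"
  obtains e' where "precedes e e'" "trans_map e e' \<cdot> y = Zero K Y (ob (fst e'))"
proof -
  note N = nodesD[OF stagesD(1)[OF e]]
  have "\<delta> \<in> Hom K (Dom K \<delta>) (ob (fst e)) \<and> Dom K \<delta> \<in> X \<and> str (fst e) \<cdot> \<delta> = Zero K (Dom K \<delta>) L"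
    if "\<delta> \<in> {y}" for \<delta>
    using that y by (auto simp: Hom_iff)
  then obtain S g f' where g: "S \<in> X\<^sub>0" "g \<in> Hom K (ob (fst e)) S" "f' \<in> Hom K S L" "f' \<cdot> g = str (fst e)"
    and kill: "\<And>\<delta>. \<delta> \<in> {y} \<Longrightarrow> g \<cdot> \<delta> = Zero K (Dom K \<delta>) S"
    using factoring_finite_skeleton[OF N(2,4), of "{y}"] by (metis finite.emptyI finite_insert)
  have "g \<cdot> x = g \<cdot> x'" if "(v, x) \<in> snd e" "(v, x') \<in> snd e" for v x x'
    using single_valuedD[OF stagesD(3)[OF e] that] by simp
  then obtain e' where "precedes e e'" "ob (fst e') = S" "trans_map e e' = g"
    using amalgamate[OF e e g(1,3) g(2,4) g(2,4)] by metis
  then show ?thesis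
    using that kill[of y] y by (simp add: Hom_iff)
qed

text \<open>
  The comparison map \<open>u\<close> from the colimit is monic since an arrow from a generator that it kills comes from a stage and dies at
  a later one; it is epic since every arrow from a generator to \<open>L\<close> is itself a one-element stage, up to isomorphism.
\<close>

lemma direct_limit_of_canonical_system:
  "L \<in> direct_limits_of K \<kappa> X"
proof -
  let ?r = "{(e, e'). precedes e e'}" and ?D = "\<lambda>e :: ('o \<times> 'm \<times> nat) \<times> (('o \<times> 'm \<times> nat) \<times> 'm) set. ob (fst e)"
  obtain C \<iota> where C: "is_direct_limit K stages ?r ?D trans_map C \<iota>"
    using direct_limit_exists[OF stages_small canonical_direct_system] by blast
  note DC = direct_limitD[OF C]
  have L_obj: "L \<in> Obj K" by (rule factoring_obj[OF factoring])
  have "str (fst e) \<in> Hom K (?D e) L" if "e \<in> stages" for e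
    using nodesD(4)[OF stagesD(1)[OF that]] .
  moreover have "str (fst e') \<cdot> trans_map e e' = str (fst e)" if "(e, e') \<in> ?r" for e e'
    using precedesD(5) that by blast
  ultimately obtain u where u: "u \<in> Hom K C L" "\<And>e. e \<in> stages \<Longrightarrow> u \<cdot> \<iota> e = str (fst e)"
    using direct_limit_copair[OF C L_obj, of "\<lambda>e. str (fst e)"] by blast
  obtain G where G: "G \<subseteq> X" "generating K G"
    using small_generators by blast
  have "monic K u"
  proof (rule monicI)
    show "u \<in> Arr K" using u by (simp add: Hom_iff)
    fix x assume x: "x \<in> Arr K" "Cod K x = Dom K u" "u \<cdot> x = Zero K (Dom K x) (Cod K u)"
    have xC: "x \<in> Hom K (Dom K x) C" "Dom K x \<in> Obj K"
      using x u Dom_Obj by (auto simp: Hom_iff)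
    show "x = Zero K (Dom K x) (Dom K u)"
    proof (rule ccontr)
      assume "x \<noteq> Zero K (Dom K x) (Dom K u)"
      moreover have "Dom K u = C" "Zero K (Dom K x) C \<in> Hom K (Dom K x) C"
        using u xC DC(2) by (auto simp: Hom_iff)
      ultimately obtain Y h where h: "Y \<in> G" "h \<in> Hom K Y (Dom K x)" "x \<cdot> h \<noteq> Zero K (Dom K x) C \<cdot> h"
        using G(2) xC unfolding generating_def by metis
      have Y: "Y \<in> X" "Y \<in> Obj K" using h G X_obj by auto
      have xh: "x \<cdot> h \<in> Hom K Y C" "u \<cdot> x \<cdot> h = Zero K Y L"
        using comp_rewrite[OF x(3), of h] xC h u L_obj by (auto simp: Hom_iff)
      obtain e y where e: "e \<in> stages" "y \<in> Hom K Y (?D e)" "\<iota> e \<cdot> y = x \<cdot> h"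
        using finitely_presentable_factor[OF finitely_presentable[OF Y(1)] stages_small C xh(1)] by blast
      have "u \<cdot> \<iota> e \<cdot> y = str (fst e) \<cdot> y"
        by (rule comp_rewrite[OF u(2)[OF e(1)]]) (use e u(1) DC(3)[OF e(1)] in \<open>auto simp: Hom_iff\<close>)
      then have "str (fst e) \<cdot> y = Zero K Y L"
        using e xh by simp
      then obtain e' where e': "precedes e e'" "trans_map e e' \<cdot> y = Zero K Y (?D e')"
        using kill_at_later_stage[OF e(1,2) Y(1)] by blast
      have "\<iota> e' \<cdot> trans_map e e' \<cdot> y = \<iota> e \<cdot> y"
        by (rule comp_rewrite) (use e(2) DC(4)[of e e'] DC(3)[OF precedesD(2)[OF e'(1)]] precedesD(4)[OF e'(1)] e'(1) in \<open>auto simp: Hom_iff\<close>)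
      then have "x \<cdot> h = Zero K Y C"
        using e'(2) e(3) DC(3)[OF precedesD(2)[OF e'(1)]] Y by (simp add: Hom_iff)
      then show False
        using h xC DC(2) by (simp add: Hom_iff)
    qed
  qed
  moreover have "epic K u"
  proof (rule epicI)
    show "u \<in> Arr K" using u by (simp add: Hom_iff)
    fix t assume t: "t \<in> Arr K" "Dom K t = Cod K u" "t \<cdot> u = Zero K (Dom K u) (Cod K t)"
    have tL: "t \<in> Hom K L (Cod K t)" "Cod K t \<in> Obj K"
      using t u Cod_Obj by (auto simp: Hom_iff)
    show "t = Zero K (Cod K u) (Cod K t)"
    proof (rule ccontr)
      assume "t \<noteq> Zero K (Cod K u) (Cod K t)"
      moreover have "Cod K u = L" "Zero K L (Cod K t) \<in> Hom K L (Cod K t)"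
        using u tL L_obj by (auto simp: Hom_iff)
      ultimately obtain Y h where h: "Y \<in> G" "h \<in> Hom K Y L" "t \<cdot> h \<noteq> Zero K L (Cod K t) \<cdot> h"
        using G(2) tL unfolding generating_def by metis
      have Y: "Y \<in> X" "Y \<in> Obj K" using h G X_obj by auto
      obtain Y' a b where Y': "Y' \<in> X\<^sub>0" and a: "a \<in> Hom K Y Y'" and b: "b \<in> Hom K Y' Y" "b \<cdot> a = Ide K Y"
        using skeleton(3)[OF Y(1)] isomorphicE by metis
      define v where "v = (Y', h \<cdot> b, 0 :: nat)"
      have v: "v \<in> nodes"
        unfolding v_def nodes_def using Y' b h by (auto simp: Hom_iff)
      define e where "e = (v, {(v, Ide K (ob v))})"
      have e: "e \<in> stages" "?D e = Y'"
        unfolding e_def using singleton_stage[OF v] by (auto simp: v_def)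
      have ue: "u \<cdot> \<iota> e = h \<cdot> b"
        using u(2)[OF e(1)] unfolding e_def v_def by simp
      have \<iota>e: "\<iota> e \<in> Hom K Y' C" using DC(3)[OF e(1)] e(2) by simp
      have "t \<cdot> u \<cdot> \<iota> e = Zero K (Dom K u) (Cod K t) \<cdot> \<iota> e"
        by (rule comp_rewrite[OF t(3)]) (use t u(1) \<iota>e in \<open>auto simp: Hom_iff\<close>)
      then have thb: "t \<cdot> h \<cdot> b = Zero K Y' (Cod K t)"
        using ue \<iota>e u(1) tL by (simp add: Hom_iff)
      have "t \<cdot> h = (t \<cdot> h \<cdot> b) \<cdot> a"
        using tL(1) h(2) a b by (simp add: Hom_iff)
      also have "\<dots> = Zero K Y (Cod K t)"
        unfolding thb using a tL(2) by (simp add: Hom_iff)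
      finally show False
        using h tL by (simp add: Hom_iff)
    qed
  qed
  ultimately have "isomorphic K C L"
    using monic_epic_isomorphic u(1) by blast
  then obtain \<iota>' where "is_direct_limit K stages ?r ?D trans_map L \<iota>'"
    using direct_limit_isomorphic[OF C] by blast
  then show ?thesis
    by (rule direct_limits_ofI[OF stages_small, rotated]) (use nodesD(2) stagesD(1) in blast)
qed

end

section \<open>The closure\<close>

context presentable_class
begin

lemma direct_limits_eq_factoring: "direct_limits_of K \<kappa> X = {L. factoring L}"
proof (intro equalityI subsetI CollectI)
  fix L assume "L \<in> direct_limits_of K \<kappa> X"
  then obtain I :: "'u set" and r D d \<iota> where "small \<kappa> I" "\<And>i. i \<in> I \<Longrightarrow> D i \<in> X" "is_direct_limit K I r D d L \<iota>"
    unfolding direct_limits_of_def by blast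
  then show "factoring L"
    using factoring_direct_limit[of I r D d L \<iota>] factoring_X by blast
next
  fix L assume "L \<in> {L. factoring L}"
  then have L: "factoring L" by blast
  obtain X\<^sub>0 where "X\<^sub>0 \<subseteq> X" "small \<kappa> X\<^sub>0" "\<And>S. S \<in> X \<Longrightarrow> \<exists>S' \<in> X\<^sub>0. isomorphic K S S'"
    using small_skeleton by blast
  then interpret canonical_system \<kappa> K X X\<^sub>0 L
    by unfold_locales (use L in auto)
  show "L \<in> direct_limits_of K \<kappa> X"
    by (rule direct_limit_of_canonical_system)
qed

lemma closed_extensions_factoring: "closed_extensions K {L. factoring L}"
  unfolding closed_extensions_def
proof (intro conjI allI impI)
  show "iso_closed K {L. factoring L}"
    unfolding iso_closed_def using factoring_isomorphic by blast
  show "Z \<in> {L. factoring L}" if "is_zero_object K Z" for Z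
    using factoring_X[OF X_zero[OF that]] by blast
  fix f g
  assume fg: "short_exact K f g \<and> Dom K f \<in> {L. factoring L} \<and> Cod K g \<in> {L. factoring L}"
  then have "f \<in> Hom K (Dom K f) (Cod K f)" "g \<in> Hom K (Cod K f) (Cod K g)"
    unfolding short_exact_def is_kernel_def by (auto simp: Hom_iff)
  then show "Cod K f \<in> {L. factoring L}"
    using factoring_extension fg by blast
qed

lemma closed_kernels_factoring: "closed_kernels_of_epis K {L. factoring L}"
  unfolding closed_kernels_of_epis_def
proof (intro allI impI)
  fix g k
  assume gk: "epic K g \<and> Dom K g \<in> {L. factoring L} \<and> Cod K g \<in> {L. factoring L} \<and> is_kernel K k g"
  then have "g \<in> Hom K (Dom K g) (Cod K g)" "k \<in> Hom K (Dom K k) (Dom K g)"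
    unfolding is_kernel_def by (auto simp: Hom_iff)
  then show "Dom K k \<in> {L. factoring L}"
    using factoring_kernel_of_epic gk by blast
qed

theorem closure_class_eq_direct_limits:
  "closure_class K \<kappa> X = direct_limits_of K \<kappa> X"
proof
  have "X \<subseteq> {L. factoring L}" "{L. factoring L} \<subseteq> Obj K"
    using factoring_X factoring_obj by auto
  moreover have "closed_coproducts K \<kappa> {L. factoring L}"
    unfolding closed_coproducts_def using factoring_coproduct by blast
  moreover have "closed_direct_limits K \<kappa> {L. factoring L}"
    unfolding closed_direct_limits_def direct_limits_of_def using factoring_direct_limit by blast
  moreover have "iso_closed K {L. factoring L}"
    using closed_extensions_factoring unfolding closed_extensions_def by blast
  ultimately show "closure_class K \<kappa> X \<subseteq> direct_limits_of K \<kappa> X"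
    unfolding closure_class_def direct_limits_eq_factoring
    using closed_extensions_factoring closed_kernels_factoring by blast
next
  have "direct_limits_of K \<kappa> X \<subseteq> X'" if "X \<subseteq> X'" "closed_direct_limits K \<kappa> X'" for X'
    using that unfolding closed_direct_limits_def direct_limits_of_def by blast
  then show "direct_limits_of K \<kappa> X \<subseteq> closure_class K \<kappa> X"
    unfolding closure_class_def by blast
qed

end

theorem propositionB:
  fixes \<kappa> :: "'u rel" and K :: "('o, 'm) precat" and S T :: "'o set"
  assumes "inaccessible \<kappa>"
    and "grothendieck_category \<kappa> K"
    and "S \<subseteq> Obj K" and "T \<subseteq> Obj K"
    and "\<forall>X \<in> T. finite_projective_dimension K X"
    and "\<exists>G \<subseteq> S \<union> T. small \<kappa> G \<and> generating K G"
    and "\<forall>X \<in> S \<union> T. finitely_presentable K \<kappa> X"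
    and "closed_extensions K (S \<union> T)"
    and "closed_kernels_of_epis K (S \<union> T)"
  shows "closure_class K \<kappa> (S \<union> T) = direct_limits_of K \<kappa> (S \<union> T)"
proof -
  interpret grothendieck_category \<kappa> K
    by (rule assms(2))
  interpret presentable_class \<kappa> K "S \<union> T"
    by unfold_locales (use assms in auto)
  show ?thesis
    by (rule closure_class_eq_direct_limits)
qed

end
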